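(* Let $K$ be a field of characteristic $0$ whose group of roots of unity $U$ is isomorphic to the cyclic group $C_2$ of order $2$ (this includes $K=\mathbb{Q}$ and $K=\mathbb{R}$), let $\mathcal{G}=\mathrm{GA}_2(K)$, and let $f\in\mathcal{G}$ be a CR element. Then any symmetry of $f$ in $\mathcal{G}$ of finite order is the identity or an involution. Moreover, the symmetry group $\mathcal{S}(f)=\{h\in\mathcal{G}\mid fh=hf\}$ contains at most one nontrivial finite subgroup, which is then of the form $\langle s\rangle$ with $s$ an involution that is conjugate in $\mathcal{G}$ to the linear map $I=\mathrm{diag}(-1,-1)$.
   Context: $\mathcal{G}=\mathrm{GA}_2(K)$ is the group, under composition, of polynomial automorphisms of the affine plane over $K$: maps $x'=P(x,y),\ y'=Q(x,y)$ with $P,Q\in K[x,y]$ that have a polynomial inverse; elements are formal polynomial maps, i.e. distinguished by their polynomials. A matrix in $\mathrm{GL}(2,K)$ is identified with the corresponding linear map. "Conjugate" means conjugate in $\mathcal{G}$. A symmetry of $f$ is an element of $\mathcal{G}$ commuting with $f$. An involution is an element $s$ with $s^2=1\neq s$. Let $\mathcal{A}\subset\mathcal{G}$ be the subgroup of affine maps $\boldsymbol{x}\mapsto M\boldsymbol{x}+\boldsymbol{a}$ ($M\in\mathrm{GL}(2,K)$, $\boldsymbol{a}\in K^2$), $\mathcal{E}\subset\mathcal{G}$ the subgroup of elementary maps $x'=\alpha x+P(y),\ y'=\beta y+v$ ($P\in K[y]$, $\alpha,\beta,v\in K$, $\alpha\beta\neq0$), and $\mathcal{B}=\mathcal{A}\cap\mathcal{E}$.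 Every $g\in\mathcal{G}\setminus\mathcal{B}$ can be written as $g=g_n\circ\cdots\circ g_1$ with $n\ge1$ and factors alternating between $\mathcal{A}\setminus\mathcal{B}$ and $\mathcal{E}\setminus\mathcal{B}$; $n$ depends only on $g$ and is called the length $\mathrm{len}(g)$; put $\mathrm{len}(g)=0$ for $g\in\mathcal{B}$. An element is cyclically reduced (has a cyclically reduced normal form) if its length is even and $>0$. A CR element is an element of $\mathcal{G}$ that is conjugate in $\mathcal{G}$ to a cyclically reduced element. *)

theory Defs
  imports
    "HOL-Computational_Algebra.Polynomial"
    "HOL-Algebra.Elementary_Groups"
    "HOL-Analysis.Determinants"
begin

text \<open>
  The ring \<open>K[x,y]\<close> is rendered as \<open>K[x][y]\<close>, i.e. as the type \<open>'a poly poly\<close>: the variable of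
  the inner (coefficient) polynomials is \<open>x\<close>, the variable of the outer polynomial is \<open>y\<close>.
  A formal polynomial map of the plane is the pair \<open>(P, Q)\<close> of its component polynomials.
\<close>

type_synonym 'a polymap = "'a poly poly \<times> 'a poly poly"

definition X :: "'a::comm_semiring_1 poly poly"
  where "X = [:[:0, 1:]:]"

definition Y :: "'a::comm_semiring_1 poly poly"
  where "Y = [:0, 1:]"

definition Const :: "'a::zero \<Rightarrow> 'a poly poly"
  where "Const a = [:[:a:]:]"

text \<open>\<open>psubst p (P, Q)\<close> is the substitution \<open>p(P(x,y), Q(x,y))\<close>.\<close>

definition psubst :: "'a::comm_ring_1 poly poly \<Rightarrow> 'a polymap \<Rightarrow> 'a poly poly"
  where "psubst p F =
    poly (map_poly (\<lambda>c. poly (map_poly Const c) (fst F)) p) (snd F)"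

text \<open>\<open>polymap_comp G F\<close> is the map \<open>G \<circ> F\<close>, which applies \<open>F\<close> first.\<close>

definition polymap_comp :: "'a::comm_ring_1 polymap \<Rightarrow> 'a polymap \<Rightarrow> 'a polymap"
  where "polymap_comp G F = (psubst (fst G) F, psubst (snd G) F)"

definition End2 :: "'a::comm_ring_1 polymap monoid"
  where "End2 = \<lparr>carrier = UNIV, mult = polymap_comp, one = (X, Y)\<rparr>"

definition GA2 :: "'a::comm_ring_1 polymap monoid"
  where "GA2 = units_of End2"

lemma Const_0 [simp]: "Const 0 = 0"
  by (simp add: Const_def)

lemma Const_1 [simp]: "Const 1 = 1"
  by (simp add: Const_def one_pCons)

lemma Const_add: "Const (a + b) = Const a + Const b"
  by (simp add: Const_def)

lemma Const_mult: "Const (a * b) = Const a * Const b"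
  for a b :: "'a::comm_ring_1"
  by (simp add: Const_def)

lemma psubst_0 [simp]: "psubst 0 F = 0"
  by (simp add: psubst_def)

lemma psubst_pCons:
  "psubst (pCons c p) F = poly (map_poly Const c) (fst F) + snd F * psubst p F"
  by (simp add: psubst_def map_poly_pCons)

lemma psubst_const: "psubst [:c:] F = poly (map_poly Const c) (fst F)"
  by (simp add: psubst_pCons)

lemma psubst_Const [simp]: "psubst (Const a) F = Const a"
  unfolding Const_def [of a] by (simp add: psubst_const map_poly_pCons Const_def)

lemma psubst_X [simp]: "psubst X F = fst F"
  by (simp add: X_def psubst_const map_poly_pCons)

lemma psubst_Y [simp]: "psubst Y F = snd F"
  by (simp add: Y_def psubst_pCons)

lemma map_poly_Const_add: "map_poly Const (p + q) = map_poly Const p + map_poly Const q"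
  for p q :: "'a::comm_ring_1 poly"
  by (rule poly_eqI) (simp add: coeff_map_poly Const_add)

lemma map_poly_Const_smult: "map_poly Const (smult a p) = smult (Const a) (map_poly Const p)"
  for p :: "'a::comm_ring_1 poly"
  by (rule poly_eqI) (simp add: coeff_map_poly Const_mult)

lemma map_poly_Const_mult: "map_poly Const (p * q) = map_poly Const p * map_poly Const q"
  for p q :: "'a::comm_ring_1 poly"
  by (induction p)
    (simp_all add: map_poly_pCons map_poly_Const_add map_poly_Const_smult)

lemma psubst_add: "psubst (p + q) F = psubst p F + psubst q F"
proof (induction p q rule: poly_induct2)
  case (pCons a p b q)
  then show ?case
    by (simp add: psubst_pCons map_poly_Const_add algebra_simps)
qed simp

lemma psubst_smult: "psubst (smult c p) F = psubst [:c:] F * psubst p F"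
  by (induction p) (simp_all add: psubst_pCons map_poly_Const_mult algebra_simps)

lemma psubst_mult: "psubst (p * q) F = psubst p F * psubst q F"
  by (induction p)
    (simp_all add: psubst_add psubst_smult psubst_pCons algebra_simps)

lemma psubst_const_psubst:
  "psubst (psubst [:c:] F) G = psubst [:c:] (polymap_comp F G)"
  by (induction c)
    (simp_all add: psubst_const map_poly_pCons psubst_add psubst_mult polymap_comp_def)

lemma psubst_psubst: "psubst (psubst p F) G = psubst p (polymap_comp F G)"
proof (induction p)
  case (pCons c p)
  then show ?case
    using psubst_const_psubst [of c F G]
    by (simp add: psubst_pCons psubst_add psubst_mult polymap_comp_def)
qed simp

lemma psubst_id [simp]: "psubst p (X, Y) = p"
proof (induction p)
  case (pCons c p)
  have "psubst [:c:] (X, Y) = [:c:]"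
    by (induction c) (simp_all add: psubst_const map_poly_pCons X_def Const_def)
  with pCons show ?case
    by (simp add: psubst_pCons Y_def)
qed simp

lemma monoid_End2: "Group.monoid End2"
  by (rule monoidI)
    (simp_all add: End2_def polymap_comp_def psubst_psubst)

lemma group_GA2: "Group.group GA2"
  unfolding GA2_def using monoid_End2 by (rule monoid.units_group)


definition affine_polymap :: "'a::field^2^2 \<Rightarrow> 'a^2 \<Rightarrow> 'a polymap"
  where "affine_polymap M a =
    (Const (M $ 1 $ 1) * X + Const (M $ 1 $ 2) * Y + Const (a $ 1),
     Const (M $ 2 $ 1) * X + Const (M $ 2 $ 2) * Y + Const (a $ 2))"

abbreviation linear_polymap :: "'a::field^2^2 \<Rightarrow> 'a polymap"
  where "linear_polymap M \<equiv> affine_polymap M 0"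

text \<open>Here \<open>map_poly (\<lambda>c. [:c:]) P\<close> is \<open>P(y)\<close>.\<close>

definition elementary_polymap ::
    "'a::field \<Rightarrow> 'a poly \<Rightarrow> 'a \<Rightarrow> 'a \<Rightarrow> 'a polymap"
  where "elementary_polymap \<alpha> P \<beta> v =
    (Const \<alpha> * X + map_poly (\<lambda>c. [:c:]) P, Const \<beta> * Y + Const v)"

definition Aff :: "'a::field polymap set"
  where "Aff = {affine_polymap M a | M a. invertible M}"

definition Elem :: "'a::field polymap set"
  where "Elem = {elementary_polymap \<alpha> P \<beta> v | \<alpha> P \<beta> v. \<alpha> * \<beta> \<noteq> 0}"

definition Bor :: "'a::field polymap set"
  where "Bor = Aff \<inter> Elem"

text \<open>The list \<open>[g\<^sub>n, \<dots>, g\<^sub>1]\<close> represents the composition \<open>g\<^sub>n \<circ> \<dots> \<circ> g\<^sub>1\<close>.\<close>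

definition normal_form :: "'a::field polymap list \<Rightarrow> 'a polymap \<Rightarrow> bool"
  where "normal_form gs g \<longleftrightarrow>
    gs \<noteq> [] \<and>
    set gs \<subseteq> (Aff - Bor) \<union> (Elem - Bor) \<and>
    successively (\<lambda>u v. (u \<in> Aff - Bor \<and> v \<in> Elem - Bor) \<or>
                        (u \<in> Elem - Bor \<and> v \<in> Aff - Bor)) gs \<and>
    g = foldr (mult GA2) gs \<one>\<^bsub>GA2\<^esub>"

definition len :: "'a::field polymap \<Rightarrow> nat"
  where "len g = (if g \<in> Bor then 0
                  else THE n. \<exists>gs. normal_form gs g \<and> length gs = n)"

definition cyclically_reduced :: "'a::field polymap \<Rightarrow> bool"
  where "cyclically_reduced g \<longleftrightarrow> g \<in> carrier GA2 \<and> even (len g) \<and> len g > 0"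


definition conjugate :: "('g, 'm) monoid_scheme \<Rightarrow> 'g \<Rightarrow> 'g \<Rightarrow> bool"
  where "conjugate G a b \<longleftrightarrow>
    a \<in> carrier G \<and> b \<in> carrier G \<and>
    (\<exists>g\<in>carrier G. b = g \<otimes>\<^bsub>G\<^esub> a \<otimes>\<^bsub>G\<^esub> inv\<^bsub>G\<^esub> g)"

definition CR_element :: "'a::field polymap \<Rightarrow> bool"
  where "CR_element f \<longleftrightarrow> (\<exists>g. cyclically_reduced g \<and> conjugate GA2 f g)"

definition symmetry_group :: "'a::field polymap \<Rightarrow> 'a polymap monoid"
  where "symmetry_group f =
    GA2\<lparr>carrier := {h \<in> carrier GA2. f \<otimes>\<^bsub>GA2\<^esub> h = h \<otimes>\<^bsub>GA2\<^esub> f}\<rparr>"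

definition involution :: "('g, 'm) monoid_scheme \<Rightarrow> 'g \<Rightarrow> bool"
  where "involution G s \<longleftrightarrow>
    s \<in> carrier G \<and> s \<otimes>\<^bsub>G\<^esub> s = \<one>\<^bsub>G\<^esub> \<and> s \<noteq> \<one>\<^bsub>G\<^esub>"

definition has_finite_order :: "('g, 'm) monoid_scheme \<Rightarrow> 'g \<Rightarrow> bool"
  where "has_finite_order G h \<longleftrightarrow>
    h \<in> carrier G \<and> (\<exists>n::nat. n > 0 \<and> h [^]\<^bsub>G\<^esub> n = \<one>\<^bsub>G\<^esub>)"

definition nontrivial_finite_subgroup :: "'g set \<Rightarrow> ('g, 'm) monoid_scheme \<Rightarrow> bool"
  where "nontrivial_finite_subgroup H G \<longleftrightarrow>
    subgroup H G \<and> finite H \<and> H \<noteq> {\<one>\<^bsub>G\<^esub>}"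

definition roots_of_unity :: "'a::field monoid"
  where "roots_of_unity =
    \<lparr>carrier = {z. \<exists>n::nat. n > 0 \<and> z ^ n = 1}, mult = (*), one = 1\<rparr>"

end

theory Submission
  imports Defs
begin

text \<open>
  By the theorem of Jung, \<open>GA\<^sub>2(K)\<close> is generated by the affine and the elementary maps. To see this,
  let \<open>(A, B)\<close> be an automorphism with inverse \<open>(P, Q)\<close> and put \<open>u = deg\<^sub>y A\<close>, \<open>v = deg\<^sub>y B\<close>. The
  Jacobian derivation \<open>J(P, -)\<close> is locally nilpotent, hence so is \<open>J(q, -)\<close> for the leading form \<open>q\<close>
  of \<open>P\<close> with respect to the weights \<open>(u, v)\<close>; comparing the nilpotency orders of \<open>x\<close> and \<open>y\<close> gives
  \<open>u dvd v\<close> or \<open>v dvd u\<close>. As \<open>q\<close> vanishes at the leading coefficients of \<open>A\<close>, \<open>B\<close>, one of them is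
  a multiple of a power of the other, and an elementary map lowers \<open>u + v\<close>.

  A degree count shows that alternating words are nontrivial, so \<open>GA\<^sub>2(K)\<close> is an amalgamated product
  over \<open>\<B>\<close>. An element \<open>h\<close> of finite order that commutes with a cyclically reduced \<open>g\<close> lies in
  \<open>\<B>\<close>, and so do its conjugates by the right segments of the word \<open>g \<circ> g\<close>. The affine letters
  exchange the two eigenvalues of \<open>h\<close>, and an elementary letter of degree \<open>m\<close> in \<open>y\<close> forces
  \<open>\<alpha> = \<beta>\<^sup>m\<close>. With \<open>\<plusminus>1\<close> as the only roots of unity, \<open>h\<close> is \<open>1\<close> or a half-turn
  \<open>\<^bold>x \<mapsto> \<^bold>d - \<^bold>x\<close>. The product of two such half-turns is a translation commuting with \<open>g\<close>, which the
  same conjugation argument shows to be trivial.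
\<close>

section \<open>Derivations\<close>

definition derivation :: "('a::comm_ring_1 \<Rightarrow> 'a) \<Rightarrow> bool" where
  "derivation D \<longleftrightarrow> (\<forall>a b. D (a + b) = D a + D b) \<and> (\<forall>a b. D (a * b) = D a * b + a * D b)"

lemma derivation_add: "derivation D \<Longrightarrow> D (a + b) = D a + D b"
  and derivation_mult: "derivation D \<Longrightarrow> D (a * b) = D a * b + a * D b"
  by (simp_all add: derivation_def)

lemma derivation_0: "derivation D \<Longrightarrow> D 0 = 0"
  using derivation_add [of D 0 0] by simp

lemma derivation_1: "derivation D \<Longrightarrow> D 1 = 0"
  using derivation_mult [of D 1 1] by simp

lemma derivation_funpow_add: "derivation D \<Longrightarrow> (D ^^ n) (a + b) = (D ^^ n) a + (D ^^ n) b"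
  by (induction n) (simp_all add: derivation_add)

lemma derivation_funpow_0: "derivation D \<Longrightarrow> (D ^^ n) 0 = 0"
  by (induction n) (simp_all add: derivation_0)

lemma derivation_funpow_eq_0_mono:
  assumes "derivation D" "(D ^^ m) a = 0" "m \<le> n"
  shows "(D ^^ n) a = 0"
proof -
  have "(D ^^ ((n - m) + m)) a = 0"
    by (simp only: funpow_add comp_apply assms(2) derivation_funpow_0 [OF assms(1)])
  then show ?thesis using assms(3) by simp
qed

lemma derivation_funpow_const_mult:
  assumes "derivation D" "D a = 0"
  shows "(D ^^ n) (a * b) = a * (D ^^ n) b"
  by (induction n) (simp_all add: derivation_mult assms)

text \<open>By the Leibniz rule the left side is a combination of terms
  \<open>(D ^^ a) f * (D ^^ b) g\<close> with \<open>a + b = i + j\<close>, and unless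
  \<open>a = i\<close> one of the two factors vanishes. The induction on \<open>i + j\<close> builds
  the remaining binomial coefficient by Pascal's rule.\<close>

lemma derivation_funpow_mult:
  assumes D: "derivation D" and "(D ^^ Suc i) f = 0" "(D ^^ Suc j) g = 0"
  shows "(D ^^ (i + j)) (f * g) = of_nat ((i + j) choose i) * ((D ^^ i) f * (D ^^ j) g)"
  using assms(2,3)
proof (induction "i + j" arbitrary: i j f g)
  case 0
  then show ?case by simp
next
  case (Suc n)
  show ?case
  proof (cases "i = 0 \<or> j = 0")
    case True
    then show ?thesis
    proof
      assume "i = 0"
      then show ?thesis using Suc.prems derivation_funpow_const_mult [OF D, of f j g] by simp
    next
      assume "j = 0"
      then show ?thesis using Suc.prems derivation_funpow_const_mult [OF D, of g i f]
        by (simp add: mult.commute)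
    qed
  next
    case False
    then obtain i' j' where ij: "i = Suc i'" "j = Suc j'" by (metis not0_implies_Suc)
    have n: "n = i' + j" "n = i + j'" using Suc.hyps(2) ij by auto
    have 1: "(D ^^ (i' + j)) (D f * g) =
        of_nat ((i' + j) choose i') * ((D ^^ i') (D f) * (D ^^ j) g)"
      using Suc.prems ij by (intro Suc.hyps(1) n) (simp_all only: funpow_simps_right comp_apply)
    have 2: "(D ^^ (i + j')) (f * D g) =
        of_nat ((i + j') choose i) * ((D ^^ i) f * (D ^^ j') (D g))"
      using Suc.prems ij by (intro Suc.hyps(1) n) (simp_all only: funpow_simps_right comp_apply)
    have "(D ^^ (i + j)) (f * g) = (D ^^ n) (D f * g + f * D g)"
      using Suc.hyps(2) by (metis derivation_mult [OF D] comp_apply funpow_Suc_right)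
    also have "\<dots> = (D ^^ (i' + j)) (D f * g) + (D ^^ (i + j')) (f * D g)"
      using n by (simp add: derivation_funpow_add [OF D])
    also have "\<dots> = of_nat ((n choose i') + (n choose i)) * ((D ^^ i) f * (D ^^ j) g)"
    proof -
      have "(D ^^ i') (D f) = (D ^^ i) f" "(D ^^ j') (D g) = (D ^^ j) g"
        by (simp_all only: ij funpow_simps_right comp_apply)
      then show ?thesis
        by (simp only: 1 [folded n(1)] 2 [folded n(2)] n(1) [symmetric] n(2) [symmetric]
            of_nat_add distrib_right)
    qed
    also have "(n choose i') + (n choose i) = (i + j) choose i"
      using Suc.hyps(2) ij by (metis add.commute binomial_Suc_Suc)
    finally show ?thesis .
  qed
qed

lemma derivation_funpow_mult_eq_0:
  assumes D: "derivation D" and "(D ^^ Suc i) f = 0" "(D ^^ Suc j) g = 0"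
  shows "(D ^^ Suc (i + j)) (f * g) = 0"
proof -
  \<comment> \<open>With \<open>Suc i\<close> as the bound for \<open>f\<close>, the surviving
    Leibniz term contains \<open>(D ^^ Suc i) f = 0\<close>.\<close>
  have "(D ^^ Suc (Suc i)) f = 0" using assms by (simp add: derivation_0)
  from derivation_funpow_mult [OF D this assms(3)] show ?thesis using assms(2) by simp
qed

text \<open>A degree function attached to a locally nilpotent derivation. It is a relation because
  \<open>0\<close> has no order.\<close>

definition deriv_order :: "('a::comm_ring_1 \<Rightarrow> 'a) \<Rightarrow> 'a \<Rightarrow> nat \<Rightarrow> bool" where
  "deriv_order D f n \<longleftrightarrow> (D ^^ n) f \<noteq> 0 \<and> (D ^^ Suc n) f = 0"

lemma deriv_order_unique:
  assumes "derivation D" "deriv_order D f m" "deriv_order D f n"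
  shows "m = n"
proof (rule ccontr)
  assume "m \<noteq> n"
  then consider "Suc m \<le> n" | "Suc n \<le> m" by linarith
  then show False
    using assms(2,3) derivation_funpow_eq_0_mono [OF assms(1), of "Suc m" f n]
      derivation_funpow_eq_0_mono [OF assms(1), of "Suc n" f m]
    by cases (simp_all add: deriv_order_def del: funpow.simps)
qed

text \<open>In a domain of characteristic 0 the surviving Leibniz term is nonzero, so orders add up
  like degrees.\<close>

lemma deriv_order_mult:
  fixes f g :: "'a::{idom, ring_char_0}"
  assumes "derivation D" "deriv_order D f m" "deriv_order D g n"
  shows "deriv_order D (f * g) (m + n)"
  using derivation_funpow_mult [OF assms(1), of m f n g]
    derivation_funpow_mult_eq_0 [OF assms(1), of m f n g] assms(2,3)
  by (simp add: deriv_order_def del: funpow.simps)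

lemma deriv_order_D:
  "D f \<noteq> 0 \<Longrightarrow> deriv_order D f n \<Longrightarrow> deriv_order D (D f) (n - 1) \<and> n \<ge> 1"
  by (cases n) (auto simp: deriv_order_def funpow_simps_right simp del: funpow.simps)

lemma deriv_order_exists:
  assumes "f \<noteq> 0" "(D ^^ n) f = 0"
  shows "\<exists>m. deriv_order D f m"
proof -
  define k where "k = (LEAST k. (D ^^ k) f = 0)"
  have k: "(D ^^ k) f = 0" unfolding k_def using assms(2) by (rule LeastI)
  then have "k \<noteq> 0" using assms(1) by (metis funpow_0)
  then obtain m where m: "k = Suc m" by (cases k) auto
  then have "(D ^^ m) f \<noteq> 0" using not_less_Least [of m "\<lambda>k. (D ^^ k) f = 0"] by (auto simp: k_def)
  with k m show ?thesis by (auto simp: deriv_order_def)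
qed

text \<open>The product has order 0 and orders add up, so each factor has order 0.\<close>

lemma locally_nilpotent_factor:
  fixes f g :: "'a::{idom, ring_char_0}"
  assumes D: "derivation D" and nil: "\<And>f. \<exists>n. (D ^^ n) f = 0"
    and "D (f * g) = 0" "f * g \<noteq> 0"
  shows "D f = 0"
proof -
  obtain m n where mn: "deriv_order D f m" "deriv_order D g n"
    using deriv_order_exists nil assms(4) by (metis mult_zero_left mult_zero_right)
  have "deriv_order D (f * g) 0" using assms(3,4) by (simp add: deriv_order_def)
  with deriv_order_mult [OF D mn] have "m + n = 0" using deriv_order_unique [OF D] by blast
  with mn show ?thesis by (simp add: deriv_order_def)
qed

text \<open>\<open>D\<close> lowers the order by one, and a divisor has at most the order of its
  nonzero multiple. So \<open>g dvd D f\<close> makes the order of \<open>g\<close> smaller than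
  that of \<open>f\<close>, and the second divisibility gives the opposite inequality.\<close>

lemma locally_nilpotent_not_both_dvd:
  fixes f g :: "'a::{idom, ring_char_0}"
  assumes D: "derivation D" and nil: "\<And>f. \<exists>n. (D ^^ n) f = 0"
    and "D f \<noteq> 0" "D g \<noteq> 0" "g dvd D f" "f dvd D g"
  shows False
proof -
  have *: "n < m" if prems: "D f \<noteq> 0" "g dvd D f" "deriv_order D f m" "deriv_order D g n" for f g m n
  proof -
    obtain h where h: "D f = g * h" using prems(2) by auto
    then obtain k where k: "deriv_order D h k"
      using deriv_order_exists nil prems(1) by (metis mult_zero_right)
    have "m - 1 = n + k"
      using deriv_order_unique [OF D] deriv_order_mult [OF D prems(4) k] deriv_order_D [OF prems(1,3)] h
      by metis
    then show ?thesis using deriv_order_D [OF prems(1,3)] by linarith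
  qed
  have "f \<noteq> 0" "g \<noteq> 0" using assms(3,4) derivation_0 [OF D] by auto
  then obtain m n where "deriv_order D f m" "deriv_order D g n"
    using deriv_order_exists nil by metis
  then show False using *[of f g m n] *[of g f n m] assms by simp
qed

lemma locally_nilpotent_add:
  assumes "derivation D" "\<exists>n. (D ^^ n) f = 0" "\<exists>n. (D ^^ n) g = 0"
  shows "\<exists>n. (D ^^ n) (f + g) = 0"
proof -
  obtain m n where "(D ^^ m) f = 0" "(D ^^ n) g = 0" using assms by auto
  then have "(D ^^ (max m n)) (f + g) = 0"
    using derivation_funpow_eq_0_mono [OF assms(1)]
    by (simp add: derivation_funpow_add [OF assms(1)])
  then show ?thesis ..
qed

lemma locally_nilpotent_mult:
  assumes D: "derivation D" and "\<exists>n. (D ^^ n) f = 0" "\<exists>n. (D ^^ n) g = 0"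
  shows "\<exists>n. (D ^^ n) (f * g) = 0"
proof -
  obtain m n where "(D ^^ m) f = 0" "(D ^^ n) g = 0" using assms by auto
  then have "(D ^^ Suc m) f = 0" "(D ^^ Suc n) g = 0" by (simp_all add: derivation_0 [OF D])
  from derivation_funpow_mult_eq_0 [OF D this] show ?thesis ..
qed

section \<open>The ring \<open>K[x,y]\<close> and its Jacobian derivations\<close>

lemma pCons_eq_add_Y: "pCons c p = [:c:] + Y * p"
  by (simp add: Y_def)

lemma const_pCons_eq: "[:pCons a c:] = Const a + X * [:c:]"
  by (simp add: X_def Const_def)

text \<open>Constants, \<open>X\<close> and \<open>Y\<close> generate the ring, so a property stable
  under sums and products can be checked on them.\<close>

lemma poly_poly_induct [case_names Const X Y add mult]:
  fixes p :: "'a::comm_ring_1 poly poly"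
  assumes C: "\<And>a. Q (Const a)" and QX: "Q X" and QY: "Q Y"
    and add: "\<And>p q. Q p \<Longrightarrow> Q q \<Longrightarrow> Q (p + q)"
    and mult: "\<And>p q. Q p \<Longrightarrow> Q q \<Longrightarrow> Q (p * q)"
  shows "Q p"
proof (induction p)
  case 0
  then show ?case using C [of 0] by simp
next
  case (pCons c p)
  have "Q [:c:]"
  proof (induction c)
    case 0
    then show ?case using C [of 0] by simp
  next
    case (pCons a c)
    then show ?case by (subst const_pCons_eq) (intro add mult C QX)
  qed
  then show ?case by (subst pCons_eq_add_Y) (intro add mult QY pCons)
qed

definition dx :: "'a::idom poly poly \<Rightarrow> 'a poly poly" where
  "dx = map_poly pderiv"

abbreviation dy :: "'a::idom poly poly \<Rightarrow> 'a poly poly" where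
  "dy \<equiv> pderiv"

lemma coeff_dx: "coeff (dx p) j = pderiv (coeff p j)"
  by (simp add: dx_def coeff_map_poly)

lemma derivation_pderiv: "derivation (pderiv :: 'a::idom poly \<Rightarrow> _)"
  by (simp add: derivation_def pderiv_add pderiv_mult algebra_simps)

lemma derivation_sum: "derivation D \<Longrightarrow> D (sum f A) = (\<Sum>i\<in>A. D (f i))"
  by (induction A rule: infinite_finite_induct) (simp_all add: derivation_0 derivation_add)

lemma derivation_dx: "derivation (dx :: 'a::idom poly poly \<Rightarrow> _)"
proof -
  have "dx (p * q) = dx p * q + p * dx q" for p q :: "'a poly poly"
  proof (rule poly_eqI)
    fix n
    have "coeff (dx (p * q)) n = (\<Sum>i\<le>n. pderiv (coeff p i) * coeff q (n - i) +
        coeff p i * pderiv (coeff q (n - i)))"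
      by (simp add: coeff_dx coeff_mult derivation_sum [OF derivation_pderiv] pderiv_mult
          algebra_simps)
    also have "\<dots> = coeff (dx p * q + p * dx q) n"
      by (simp add: coeff_mult coeff_dx sum.distrib)
    finally show "coeff (dx (p * q)) n = coeff (dx p * q + p * dx q) n" .
  qed
  moreover have "dx (p + q) = dx p + dx q" for p q :: "'a poly poly"
    by (rule poly_eqI) (simp add: coeff_dx pderiv_add)
  ultimately show ?thesis by (simp add: derivation_def)
qed

lemma dx_simps [simp]: "dx X = 1" "dx Y = 0" "dx (Const a) = 0"
  by (simp_all add: dx_def X_def Y_def Const_def map_poly_pCons pderiv_pCons one_pCons)

lemma dy_simps [simp]: "dy X = 0" "dy Y = 1" "dy (Const a) = 0"
  by (simp_all add: X_def Y_def Const_def pderiv_pCons)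

text \<open>The chain rule, for any derivation that kills the constants; both sides obey the same
  sum and product rules, which reduces it to generators.\<close>

lemma derivation_psubst:
  assumes D: "derivation D" and C: "\<And>a. D (Const a) = 0"
  shows "D (psubst p F) = psubst (dx p) F * D (fst F) + psubst (dy p) F * D (snd F)"
proof (induction p rule: poly_poly_induct)
  case (Const a)
  then show ?case by (simp add: C)
next
  case X
  have "psubst 1 F = 1" using psubst_Const [of 1 F] by simp
  then show ?case by simp
next
  case Y
  have "psubst 1 F = 1" using psubst_Const [of 1 F] by simp
  then show ?case by simp
next
  case (add p q)
  then show ?case
    by (simp add: psubst_add derivation_add [OF D] derivation_add [OF derivation_dx] pderiv_add
        algebra_simps)
next
  case (mult p q)
  then show ?case
    by (simp add: psubst_add psubst_mult derivation_mult [OF D] derivation_mult [OF derivation_dx]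
        pderiv_mult algebra_simps)
qed

lemmas dx_psubst = derivation_psubst [OF derivation_dx dx_simps(3)]
lemmas dy_psubst = derivation_psubst [OF derivation_pderiv dy_simps(3)]

text \<open>The Jacobian determinant of the map \<open>(p, q)\<close>. For fixed \<open>p\<close> it
  is a derivation in \<open>q\<close> that kills \<open>p\<close>.\<close>

definition jac :: "'a::idom poly poly \<Rightarrow> 'a poly poly \<Rightarrow> 'a poly poly" where
  "jac p q = dx p * dy q - dy p * dx q"

lemma derivation_jac: "derivation (jac p)"
  by (simp add: derivation_def jac_def derivation_add [OF derivation_dx] pderiv_add pderiv_mult
      derivation_mult [OF derivation_dx] algebra_simps)

lemma jac_self: "jac p p = 0"
  by (simp add: jac_def)

lemma jac_X: "jac p X = - dy p" and jac_Y: "jac p Y = dx p"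
  by (simp_all add: jac_def)

lemma jac_Const: "jac p (Const a) = 0"
  by (simp add: jac_def)

text \<open>In the coordinates \<open>fst F\<close>, \<open>snd F\<close> the derivation
  \<open>jac (fst F)\<close> is a multiple of the partial derivative by the second coordinate. Local
  nilpotency comes from here.\<close>

lemma jac_psubst_right:
  "jac (fst F) (psubst p F) = psubst (dy p) F * jac (fst F) (snd F)"
  by (simp add: jac_def dx_psubst dy_psubst algebra_simps)

lemma psubst_diff: "psubst (p - q) F = psubst p F - psubst q F"
  using psubst_add [of "p - q" q F] by simp

text \<open>The determinant of the chain rule: Jacobian determinants multiply under
  composition.\<close>

lemma jac_psubst:
  "jac (psubst p F) (psubst q F) = psubst (jac p q) F * jac (fst F) (snd F)"
  by (simp add: jac_def dx_psubst dy_psubst psubst_diff psubst_mult algebra_simps)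

text \<open>The elements killed by some power of \<open>D\<close> are closed under sums and
  products, so the generators decide.\<close>

lemma locally_nilpotentI:
  assumes D: "derivation D" and C: "\<And>a. D (Const a) = 0"
    and "\<exists>n. (D ^^ n) X = 0" "\<exists>n. (D ^^ n) Y = 0"
  shows "\<exists>n. (D ^^ n) p = 0"
proof (induction p rule: poly_poly_induct)
  case (Const a)
  have "(D ^^ 1) (Const a) = 0" by (simp add: C)
  then show ?case ..
qed (use assms locally_nilpotent_add [OF D] locally_nilpotent_mult [OF D] in auto)

section \<open>Weighted leading forms\<close>

text \<open>
  The variables \<open>x\<close>, \<open>y\<close> have weights \<open>u\<close>, \<open>v\<close>; the part \<open>q\<close> of weight \<open>d\<close> may be \<open>0\<close>. The
  weight \<open>d\<close> is an integer since differentiation may lower it below \<open>0\<close>.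
\<close>

definition leads :: "nat \<Rightarrow> nat \<Rightarrow> int \<Rightarrow> 'a::comm_ring_1 poly poly \<Rightarrow> 'a poly poly \<Rightarrow> bool" where
  "leads u v d p q \<longleftrightarrow> (\<forall>i j.
     (d \<le> int (u * i + v * j) \<longrightarrow> coeff (coeff p j) i = coeff (coeff q j) i) \<and>
     (int (u * i + v * j) \<noteq> d \<longrightarrow> coeff (coeff q j) i = 0))"

lemma leadsD1: "leads u v d p q \<Longrightarrow> d \<le> int (u * i + v * j) \<Longrightarrow> coeff (coeff p j) i = coeff (coeff q j) i"
  and leadsD2: "leads u v d p q \<Longrightarrow> int (u * i + v * j) \<noteq> d \<Longrightarrow> coeff (coeff q j) i = 0"
  by (auto simp: leads_def)

lemma leadsD3: "leads u v d p q \<Longrightarrow> d < int (u * i + v * j) \<Longrightarrow> coeff (coeff p j) i = 0"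
  using leadsD1 leadsD2 by fastforce

text \<open>This carries nilpotency over to leading forms: where an iterate of \<open>jac P\<close>
  vanishes, so does the corresponding iterate of \<open>jac q\<close>.\<close>

lemma leads_0: "leads u v d 0 q \<Longrightarrow> q = 0"
  by (intro poly_eqI) (metis coeff_0 leadsD1 leadsD2 le_less order_refl)

lemma leads_diff: "leads u v d p q \<Longrightarrow> leads u v d p' q' \<Longrightarrow> leads u v d (p - p') (q - q')"
  by (simp add: leads_def)

lemma coeff_coeff_mult:
  "coeff (coeff (p * q) j) i =
     (\<Sum>j'\<le>j. \<Sum>i'\<le>i. coeff (coeff p j') i' * coeff (coeff q (j - j')) (i - i'))"
  by (simp add: coeff_mult coeff_sum)

lemma weight_split:
  assumes "j' \<le> j" "i' \<le> i"
  shows "int (u * i + v * j) = int (u * i' + v * j') + int (u * (i - i') + v * (j - j'))"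
proof -
  obtain a b where "i = i' + a" "j = j' + b" using assms le_Suc_ex by metis
  then show ?thesis by (simp add: distrib_left)
qed

text \<open>In a product term of weight at least \<open>d + d'\<close> either one factor exceeds its
  bound, and then its coefficient is 0 on both sides, or both factors meet their bounds exactly, and
  then the coefficients agree.\<close>

lemma leads_mult:
  assumes p: "leads u v d p q" and p': "leads u v d' p' q'"
  shows "leads u v (d + d') (p * p') (q * q')"
  unfolding leads_def
proof (intro allI conjI impI)
  fix i j
  assume w: "d + d' \<le> int (u * i + v * j)"
  show "coeff (coeff (p * p') j) i = coeff (coeff (q * q') j) i"
    unfolding coeff_coeff_mult
  proof (intro sum.cong refl)
    fix i' j' assume "j' \<in> {..j}" "i' \<in> {..i}"
    then have "int (u * i + v * j) = int (u * i' + v * j') + int (u * (i - i') + v * (j - j'))"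
      by (intro weight_split) simp_all
    then consider "d < int (u * i' + v * j')" | "d' < int (u * (i - i') + v * (j - j'))"
      | "d = int (u * i' + v * j')" "d' = int (u * (i - i') + v * (j - j'))"
      using w by linarith
    then show "coeff (coeff p j') i' * coeff (coeff p' (j - j')) (i - i') =
        coeff (coeff q j') i' * coeff (coeff q' (j - j')) (i - i')"
    proof cases
      case 1
      then show ?thesis using leadsD3 [OF p 1] leadsD2 [OF p, of i' j'] by simp
    next
      case 2
      then show ?thesis using leadsD3 [OF p' 2] leadsD2 [OF p', of "i - i'" "j - j'"] by simp
    next
      case 3
      then show ?thesis
        using leadsD1 [OF p, of i' j'] leadsD1 [OF p', of "i - i'" "j - j'"] by simp
    qed
  qed
next
  fix i j
  assume w: "int (u * i + v * j) \<noteq> d + d'"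
  show "coeff (coeff (q * q') j) i = 0"
    unfolding coeff_coeff_mult
  proof (intro sum.neutral ballI)
    fix i' j' assume "j' \<in> {..j}" "i' \<in> {..i}"
    then have "int (u * i + v * j) = int (u * i' + v * j') + int (u * (i - i') + v * (j - j'))"
      by (intro weight_split) simp_all
    then consider "int (u * i' + v * j') \<noteq> d" | "int (u * (i - i') + v * (j - j')) \<noteq> d'"
      using w by linarith
    then show "coeff (coeff q j') i' * coeff (coeff q' (j - j')) (i - i') = 0"
      using leadsD2 [OF p] leadsD2 [OF p'] by cases auto
  qed
qed

lemma coeff_coeff_dx: "coeff (coeff (dx p) j) i = of_nat (Suc i) * coeff (coeff p j) (Suc i)"
  by (simp add: coeff_dx coeff_pderiv)

lemma coeff_coeff_dy: "coeff (coeff (dy p) j) i = of_nat (Suc j) * coeff (coeff p (Suc j)) i"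
  by (simp only: coeff_pderiv of_nat_poly) simp

lemma leads_dx: "leads u v d p q \<Longrightarrow> leads u v (d - int u) (dx p) (dx q)"
  unfolding leads_def coeff_coeff_dx
  by (intro allI conjI impI; simp only: mult_cancel_left mult_eq_0_iff)
    (force simp: algebra_simps)+

lemma leads_dy: "leads u v d p q \<Longrightarrow> leads u v (d - int v) (dy p) (dy q)"
  unfolding leads_def coeff_coeff_dy
  by (intro allI conjI impI; simp only: mult_cancel_left mult_eq_0_iff)
    (force simp: algebra_simps)+

text \<open>Each of the two products contains one derivative by \<open>x\<close> and one by
  \<open>y\<close>, which together lower the weight by \<open>u + v\<close>.\<close>

lemma leads_jac:
  assumes "leads u v d p q" "leads u v d' p' q'"
  shows "leads u v (d + d' - int u - int v) (jac p p') (jac q q')"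
proof -
  have "leads u v ((d - int u) + (d' - int v)) (dx p * dy p') (dx q * dy q')"
    "leads u v ((d - int v) + (d' - int u)) (dy p * dx p') (dy q * dx q')"
    using assms by (blast intro: leads_mult leads_dx leads_dy)+
  moreover have "(d - int u) + (d' - int v) = d + d' - int u - int v"
    "(d - int v) + (d' - int u) = d + d' - int u - int v" by simp_all
  ultimately show ?thesis unfolding jac_def by (intro leads_diff) simp_all
qed

lemma coeff_coeff_X: "coeff (coeff X j) i = (if i = 1 \<and> j = 0 then 1 else 0)"
  by (auto simp: X_def coeff_pCons split: nat.split)

lemma coeff_coeff_Y: "coeff (coeff Y j) i = (if i = 0 \<and> j = 1 then 1 else 0)"
  by (auto simp: Y_def coeff_pCons split: nat.split)

lemma leads_X: "leads u v (int u) X X" and leads_Y: "leads u v (int v) Y Y"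
  by (auto simp: leads_def coeff_coeff_X coeff_coeff_Y)

lemma leads_jac_funpow:
  assumes "leads u v d p q" "leads u v e r s"
  shows "leads u v (e + int n * (d - int u - int v)) ((jac p ^^ n) r) ((jac q ^^ n) s)"
proof (induction n)
  case 0
  then show ?case using assms by simp
next
  case (Suc n)
  have "d + (e + int n * (d - int u - int v)) - int u - int v = e + int (Suc n) * (d - int u - int v)"
    by (simp add: algebra_simps)
  then show ?case using leads_jac [OF assms(1) Suc] by (simp only: funpow.simps comp_apply)
qed

lemma poly_altdef_le: "degree p \<le> n \<Longrightarrow> poly p x = (\<Sum>i\<le>n. coeff p i * x ^ i)"
  for x :: "'a::comm_semiring_1"
  unfolding poly_altdef by (rule sum.mono_neutral_left) (auto simp: coeff_eq_0)

lemma coeff_sum_monom: "coeff (\<Sum>i\<le>m. monom (f i) i) k = (if k \<le> m then f k else 0)"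
  by (simp add: coeff_sum)

text \<open>The support of \<open>p\<close> is finite, so some weight on it is maximal;
  \<open>q\<close> collects the terms of that weight.\<close>

lemma ex_leads:
  fixes p :: "'a::comm_ring_1 poly poly"
  assumes "p \<noteq> 0"
  shows "\<exists>d q. leads u v (int d) p q \<and> q \<noteq> 0"
proof -
  define W where "W = {u * i + v * j |i j. coeff (coeff p j) i \<noteq> 0}"
  have "{(i, j). coeff (coeff p j) i \<noteq> 0} \<subseteq> (\<Union>j\<le>degree p. {..degree (coeff p j)} \<times> {j})"
  proof clarify
    fix i j assume nz: "coeff (coeff p j) i \<noteq> 0"
    then have "coeff p j \<noteq> 0" by (metis coeff_0)
    with nz show "(i, j) \<in> (\<Union>j\<le>degree p. {..degree (coeff p j)} \<times> {j})"
      by (simp add: le_degree)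
  qed
  then have fin: "finite {(i, j). coeff (coeff p j) i \<noteq> 0}"
    by (rule finite_subset) auto
  have "W = (\<lambda>(i, j). u * i + v * j) ` {(i, j). coeff (coeff p j) i \<noteq> 0}"
    by (auto simp: W_def)
  then have finW: "finite W" using fin by simp
  from assms obtain j where "coeff p j \<noteq> 0" by (meson leading_coeff_0_iff)
  then obtain i where "coeff (coeff p j) i \<noteq> 0" by (meson leading_coeff_0_iff)
  then have "W \<noteq> {}" by (auto simp: W_def)
  define d where "d = Max W"
  have dW: "d \<in> W" using finW \<open>W \<noteq> {}\<close> by (simp add: d_def)
  have dmax: "u * i + v * j \<le> d" if "coeff (coeff p j) i \<noteq> 0" for i j
    unfolding d_def using finW that by (intro Max_ge) (auto simp: W_def)
  \<comment> \<open>\<open>m\<close> and \<open>n\<close> bound the exponents in the support, so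
    that \<open>q\<close> can be written as a finite double sum.\<close>
  define m where "m = Max ((\<lambda>(i, j). i) ` {(i, j). coeff (coeff p j) i \<noteq> 0})"
  define n where "n = Max ((\<lambda>(i, j). j) ` {(i, j). coeff (coeff p j) i \<noteq> 0})"
  have mn: "i \<le> m \<and> j \<le> n" if "coeff (coeff p j) i \<noteq> 0" for i j
    unfolding m_def n_def using fin that by (intro conjI Max_ge) force+
  define q where "q = (\<Sum>j\<le>n. monom (\<Sum>i\<le>m. monom
      (if u * i + v * j = d then coeff (coeff p j) i else 0) i) j)"
  have q: "coeff (coeff q j) i = (if u * i + v * j = d then coeff (coeff p j) i else 0)" for i j
    using mn [of j i] unfolding q_def coeff_sum_monom
    by (cases "j \<le> n"; cases "i \<le> m") (simp_all only: if_True if_False coeff_sum_monom coeff_0, auto)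
  have "leads u v (int d) p q"
    unfolding leads_def q using dmax by (force simp flip: of_nat_add of_nat_mult)
  moreover from dW have "q \<noteq> 0" using q by (auto simp: W_def) (metis coeff_0)
  ultimately show ?thesis by blast
qed

section \<open>Top coefficients under substitution\<close>

lemma ex_coeff_bounds:
  fixes p :: "'a::zero poly poly"
  shows "\<exists>m. \<forall>j. degree (coeff p j) \<le> m"
proof
  show "\<forall>j. degree (coeff p j) \<le> (\<Sum>j\<le>degree p. degree (coeff p j))"
  proof
    fix j
    show "degree (coeff p j) \<le> (\<Sum>j\<le>degree p. degree (coeff p j))"
    proof (cases "j \<le> degree p")
      case True
      then show ?thesis by (intro member_le_sum) auto
    qed (simp add: coeff_eq_0)
  qed
qed

text \<open>The bounds may exceed the actual degrees, which allows one index range for a polynomial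
  and its leading form.\<close>

lemma psubst_sum_le:
  assumes "degree p \<le> n" "\<And>j. degree (coeff p j) \<le> m"
  shows "psubst p F = (\<Sum>j\<le>n. \<Sum>i\<le>m. Const (coeff (coeff p j) i) * fst F ^ i * snd F ^ j)"
proof -
  have 1: "poly (map_poly Const c) a = (\<Sum>i\<le>m. Const (coeff c i) * a ^ i)" if "degree c \<le> m"
    for c and a :: "'a poly poly"
  proof -
    have "degree (map_poly Const c) \<le> m" using that map_poly_degree_leq order_trans by blast
    from poly_altdef_le [OF this] show ?thesis by (simp add: coeff_map_poly)
  qed
  have "degree (map_poly (\<lambda>c. poly (map_poly Const c) (fst F)) p) \<le> n"
    using assms(1) map_poly_degree_leq order_trans by blast
  then show ?thesis
    by (simp add: psubst_def poly_altdef_le coeff_map_poly 1 assms(2) sum_distrib_right)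
qed

lemma coeff_mult_le:
  assumes "degree p \<le> m" "degree q \<le> n"
  shows "coeff (p * q) (m + n) = coeff p m * coeff q n"
proof -
  have "coeff (p * q) (m + n) = (\<Sum>i\<in>{m}. coeff p i * coeff q (m + n - i))"
    unfolding coeff_mult
  proof (rule sum.mono_neutral_right; safe?)
    fix i assume "i \<le> m + n" "i \<notin> {}" "coeff p i * coeff q (m + n - i) \<noteq> 0"
    then have "i \<le> m" "m + n - i \<le> n" using assms
      by (metis le_degree mult_zero_left order_trans, metis le_degree mult_zero_right order_trans)
    then show "i = m" by simp
  qed auto
  then show ?thesis by simp
qed

lemma degree_power_le': "degree p \<le> m \<Longrightarrow> degree (p ^ i) \<le> m * i"
  by (meson degree_power_le mult_le_mono1 order_trans)

lemma coeff_power_le: "degree p \<le> m \<Longrightarrow> coeff (p ^ i) (m * i) = coeff p m ^ i"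
  by (induction i) (simp_all add: coeff_mult_le degree_power_le' one_pCons)

text \<open>Substituted into \<open>x^i y^j\<close>, the pair \<open>(A, B)\<close> gives degree at
  most \<open>u * i + v * j\<close> in \<open>y\<close>. Terms of weight above \<open>d\<close> do
  not occur in \<open>p\<close>, those below \<open>d\<close> cannot reach \<open>y^d\<close>, and
  those of weight \<open>d\<close> contribute the product of the top coefficients.\<close>

lemma coeff_psubst_leads:
  assumes pq: "leads u v (int d) p q"
    and deg: "degree A \<le> u" "degree B \<le> v"
    and q: "degree q \<le> n" "\<And>j. degree (coeff q j) \<le> m"
  shows "coeff (psubst p (A, B)) d =
    (\<Sum>j\<le>n. \<Sum>i\<le>m. smult (coeff (coeff q j) i) (coeff A u ^ i * coeff B v ^ j))"
proof -
  obtain m' where m': "\<And>j. degree (coeff p j) \<le> m'" using ex_coeff_bounds [of p] by auto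
  have "coeff (Const (coeff (coeff p j) i) * A ^ i * B ^ j) d =
      smult (coeff (coeff q j) i) (coeff A u ^ i * coeff B v ^ j)" for i j
  proof -
    have le: "degree (A ^ i * B ^ j) \<le> u * i + v * j"
      by (meson add_mono deg degree_mult_le degree_power_le' order_trans)
    have 0: "coeff (Const (coeff (coeff p j) i) * A ^ i * B ^ j) d =
        smult (coeff (coeff p j) i) (coeff (A ^ i * B ^ j) d)"
      by (simp add: Const_def mult.assoc)
    consider "d < u * i + v * j" | "u * i + v * j = d" | "u * i + v * j < d" by linarith
    then show ?thesis
    proof cases
      case 1
      then have "int d < int (u * i + v * j)" by linarith
      with 0 1 show ?thesis using leadsD3 [OF pq, of i j] leadsD2 [OF pq, of i j] by simp
    next
      case 2
      have "coeff (coeff p j) i = coeff (coeff q j) i"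
        by (rule leadsD1 [OF pq]) (simp flip: 2)
      moreover have "coeff (A ^ i * B ^ j) (u * i + v * j) = coeff A u ^ i * coeff B v ^ j"
        by (simp add: coeff_mult_le coeff_power_le degree_power_le' deg)
      ultimately show ?thesis using 0 2 by simp
    next
      case 3
      then have "int (u * i + v * j) \<noteq> int d" by linarith
      then have "coeff (coeff q j) i = 0" by (rule leadsD2 [OF pq])
      moreover have "coeff (A ^ i * B ^ j) d = 0" using le 3 by (intro coeff_eq_0) linarith
      ultimately show ?thesis using 0 by simp
    qed
  qed
  \<comment> \<open>The maxima cover both \<open>p\<close> and \<open>q\<close>; once only
    coefficients of \<open>q\<close> are left, the surplus terms are 0 and the ranges shrink
    again.\<close>
  moreover have "psubst p (A, B) = (\<Sum>j\<le>max n (degree p). \<Sum>i\<le>max m m'.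
      Const (coeff (coeff p j) i) * A ^ i * B ^ j)"
    using psubst_sum_le [of p "max n (degree p)" "max m m'" "(A, B)"] m'
    by (simp add: le_max_iff_disj)
  ultimately have "coeff (psubst p (A, B)) d = (\<Sum>j\<le>max n (degree p). \<Sum>i\<le>max m m'.
      smult (coeff (coeff q j) i) (coeff A u ^ i * coeff B v ^ j))"
    by (simp add: coeff_sum)
  also have "\<dots> = (\<Sum>j\<le>n. \<Sum>i\<le>max m m'. smult (coeff (coeff q j) i) (coeff A u ^ i * coeff B v ^ j))"
    using q(1) by (intro sum.mono_neutral_right) (auto intro!: sum.neutral simp: coeff_eq_0)
  also have "\<dots> = (\<Sum>j\<le>n. \<Sum>i\<le>m. smult (coeff (coeff q j) i) (coeff A u ^ i * coeff B v ^ j))"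
  proof (rule sum.cong [OF refl])
    fix j
    have "coeff (coeff q j) i = 0" if "i > m" for i
      using q(2) [of j] that by (intro coeff_eq_0) linarith
    then show "(\<Sum>i\<le>max m m'. smult (coeff (coeff q j) i) (coeff A u ^ i * coeff B v ^ j)) =
        (\<Sum>i\<le>m. smult (coeff (coeff q j) i) (coeff A u ^ i * coeff B v ^ j))"
      by (intro sum.mono_neutral_right) auto
  qed
  finally show ?thesis .
qed

section \<open>Degrees of the components of an automorphism\<close>

text \<open>Multiplicativity of the Jacobian makes \<open>jac P Q\<close> a divisor of
  \<open>1\<close>, and the units of \<open>K[x][y]\<close> are the nonzero constants.\<close>

lemma jac_const_if_inverse:
  fixes P Q :: "'a::field_char_0 poly poly"
  assumes "psubst A (P, Q) = X" "psubst B (P, Q) = Y"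
  shows "\<exists>c. jac P Q = Const c \<and> c \<noteq> 0"
proof -
  have "jac X Y = (1 :: 'a poly poly)" by (simp add: jac_def)
  then have "1 = psubst (jac A B) (P, Q) * jac P Q"
    using jac_psubst [of A "(P, Q)" B] assms by simp
  then have "jac P Q dvd 1" by (metis dvd_triv_right)
  then obtain c where "jac P Q = [:c:]" "c dvd 1" using is_unit_poly_iff by blast
  then obtain a where "c = [:a:]" "a dvd 1" using is_unit_poly_iff [of c] by blast
  with \<open>jac P Q = [:c:]\<close> show ?thesis by (auto simp: Const_def)
qed

text \<open>Since \<open>jac P Q\<close> is a constant \<open>c\<close>, \<open>jac P\<close> acts
  on polynomials in \<open>P\<close>, \<open>Q\<close> as \<open>c\<close> times the derivative by
  the second variable, which is nilpotent on each polynomial. Both \<open>X\<close> and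
  \<open>Y\<close> are such polynomials, namely \<open>A(P, Q)\<close> and
  \<open>B(P, Q)\<close>.\<close>

lemma jac_locally_nilpotent:
  fixes P Q :: "'a::field_char_0 poly poly"
  assumes A: "psubst A (P, Q) = X" and B: "psubst B (P, Q) = Y"
  shows "\<exists>n. (jac P ^^ n) X = 0" "\<exists>n. (jac P ^^ n) Y = 0"
proof -
  obtain c where c: "jac P Q = Const c" using jac_const_if_inverse [OF assms] by auto
  have pow: "jac P (Const c ^ n) = 0" for n
    by (induction n) (simp_all add: derivation_mult [OF derivation_jac] derivation_1 [OF derivation_jac]
        jac_Const)
  have D: "(jac P ^^ n) (psubst p (P, Q)) = psubst ((dy ^^ n) p) (P, Q) * Const c ^ n" for n p
  proof (induction n)
    case (Suc n)
    then show ?case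
      using jac_psubst_right [of "(P, Q)" "(dy ^^ n) p"] c
      by (simp add: derivation_mult [OF derivation_jac] pow algebra_simps)
  qed simp
  have "(dy ^^ Suc (degree p)) p = 0" for p :: "'a poly poly"
    by (rule poly_eqI) (simp add: coeff_higher_pderiv coeff_eq_0 del: funpow.simps)
  then have "(jac P ^^ Suc (degree p)) (psubst p (P, Q)) = 0" for p
    by (simp only: D psubst_0 mult_zero_left)
  from this [of A] this [of B]
  show "\<exists>n. (jac P ^^ n) X = 0" "\<exists>n. (jac P ^^ n) Y = 0" unfolding A B by blast+
qed

text \<open>
  The sum is the coefficient of \<open>y\<^sup>d\<close> in \<open>P(A, B) = x\<close>, that is, \<open>q\<close> evaluated at the leading
  coefficients of \<open>A\<close> and \<open>B\<close>.
\<close>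

lemma leading_form_relation:
  fixes P :: "'a::field_char_0 poly poly"
  assumes PAB: "psubst P (A, B) = X" and uv: "degree A > 0" "degree B > 0"
  obtains d q n m where "leads (degree A) (degree B) (int d) P q" "q \<noteq> 0"
    "degree q \<le> n" "\<forall>j. degree (coeff q j) \<le> m"
    "(\<Sum>j\<le>n. \<Sum>i\<le>m. smult (coeff (coeff q j) i) (lead_coeff A ^ i * lead_coeff B ^ j)) = 0"
proof -
  have "P \<noteq> 0" using PAB by (auto simp: X_def)
  then obtain d q where q: "leads (degree A) (degree B) (int d) P q" "q \<noteq> 0" using ex_leads by blast
  obtain m where m: "\<And>j. degree (coeff q j) \<le> m" using ex_coeff_bounds [of q] by auto
  \<comment> \<open>Both weights are positive, so a leading form of weight 0 would make
    \<open>P\<close> constant, contrary to \<open>P(A, B) = x\<close>.\<close>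
  have "d \<noteq> 0"
  proof
    assume "d = 0"
    have "P = Const (coeff (coeff P 0) 0)"
    proof (intro poly_eqI)
      fix i j
      show "coeff (coeff P j) i = coeff (coeff (Const (coeff (coeff P 0) 0)) j) i"
      proof (cases "i = 0 \<and> j = 0")
        case False
        then have "0 < degree A * i + degree B * j" using uv by auto
        then have "int d < int (degree A * i + degree B * j)" using \<open>d = 0\<close> by linarith
        then have "coeff (coeff P j) i = 0" by (rule leadsD3 [OF q(1)])
        with False show ?thesis by (auto simp: Const_def coeff_pCons split: nat.split)
      qed (simp add: Const_def)
    qed
    with PAB have "X = Const (coeff (coeff P 0) 0)" by (metis psubst_Const)
    then show False by (simp add: X_def Const_def)
  qed
  \<comment> \<open>\<open>x\<close> does not involve \<open>y\<close>, so its coefficient at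
    \<open>y^d\<close> vanishes for \<open>d > 0\<close>.\<close>
  then have "coeff (psubst P (A, B)) d = 0" unfolding PAB by (simp add: X_def coeff_pCons split: nat.split)
  with coeff_psubst_leads [OF q(1) order_refl order_refl order_refl m]
  have "(\<Sum>j\<le>degree q. \<Sum>i\<le>m. smult (coeff (coeff q j) i) (lead_coeff A ^ i * lead_coeff B ^ j)) = 0"
    by simp
  with q m that show ?thesis by blast
qed

lemma sum_sum_single:
  fixes f :: "nat \<Rightarrow> nat \<Rightarrow> 'b::comm_monoid_add"
  assumes "j0 \<le> n" "i0 \<le> m" "\<And>i j. (i, j) \<noteq> (i0, j0) \<Longrightarrow> f j i = 0"
  shows "(\<Sum>j\<le>n. \<Sum>i\<le>m. f j i) = f j0 i0"
proof -
  have "(\<Sum>i\<le>m. f j i) = (if j = j0 then f j0 i0 else 0)" for j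
  proof (cases "j = j0")
    case True
    have "(\<Sum>i\<le>m. f j i) = (\<Sum>i\<in>{i0}. f j i)"
      using assms True by (intro sum.mono_neutral_right) auto
    then show ?thesis using True by simp
  qed (use assms(3) in auto)
  then show ?thesis using assms(1) by simp
qed

lemma X_dvd_iff: "X dvd p \<longleftrightarrow> (\<forall>j. coeff (coeff p j) 0 = 0)"
  for p :: "'a::field poly poly"
proof -
  have "[:0, 1:] dvd c \<longleftrightarrow> coeff c 0 = 0" for c :: "'a poly"
    using poly_eq_0_iff_dvd [of c 0] by (simp add: poly_0_coeff_0)
  then show ?thesis unfolding X_def const_poly_dvd_iff by simp
qed

lemma Y_dvd_iff: "Y dvd p \<longleftrightarrow> coeff p 0 = 0"
  for p :: "'a::field poly poly"
  using poly_eq_0_iff_dvd [of p 0] by (simp add: poly_0_coeff_0 Y_def)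

text \<open>The derivation \<open>jac q\<close> of the leading form \<open>q\<close> inherits local
  nilpotency from \<open>jac P\<close>. If neither degree divided the other, then \<open>Y\<close>
  would divide \<open>jac q X\<close> and \<open>X\<close> would divide \<open>jac q Y\<close>, both
  nonzero, which a locally nilpotent derivation does not allow.\<close>

lemma degree_dvd_if_inverse:
  fixes P Q :: "'a::field_char_0 poly poly"
  assumes A: "psubst A (P, Q) = X" and B: "psubst B (P, Q) = Y" and PAB: "psubst P (A, B) = X"
    and uv: "degree A > 0" "degree B > 0"
  shows "degree A dvd degree B \<or> degree B dvd degree A"
proof (rule ccontr)
  assume contr: "\<not> ?thesis"
  define u v where "u = degree A" and "v = degree B"
  obtain d q n m where q0: "leads (degree A) (degree B) (int d) P q" "q \<noteq> 0"
    "degree q \<le> n" "\<forall>j. degree (coeff q j) \<le> m"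
    and rel: "(\<Sum>j\<le>n. \<Sum>i\<le>m. smult (coeff (coeff q j) i) (lead_coeff A ^ i * lead_coeff B ^ j)) = 0"
    using leading_form_relation [OF PAB uv] .
  note q = q0 [folded u_def v_def]
  have weight: "u * i + v * j = d" if "coeff (coeff q j) i \<noteq> 0" for i j
    using leadsD2 [OF q(1), of i j] that by linarith
  from q(2) obtain j0 where "coeff q j0 \<noteq> 0" by (meson leading_coeff_0_iff)
  then obtain i0 where ij0: "coeff (coeff q j0) i0 \<noteq> 0" by (meson leading_coeff_0_iff)
  \<comment> \<open>A single monomial would evaluate at the leading coefficients to a nonzero
    product, against \<open>rel\<close>.\<close>
  obtain i1 j1 where ij1: "coeff (coeff q j1) i1 \<noteq> 0" "(i1, j1) \<noteq> (i0, j0)"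
  proof (rule ccontr)
    assume "\<not> thesis"
    with that have 0: "coeff (coeff q j) i = 0" if "(i, j) \<noteq> (i0, j0)" for i j using that by blast
    have "j0 \<le> n" "i0 \<le> m"
      using q(3) q(4) [rule_format, of j0] ij0 \<open>coeff q j0 \<noteq> 0\<close> le_degree order_trans by blast+
    from sum_sum_single [OF this, of
        "\<lambda>j i. smult (coeff (coeff q j) i) (lead_coeff A ^ i * lead_coeff B ^ j)"] 0 rel
    have "smult (coeff (coeff q j0) i0) (lead_coeff A ^ i0 * lead_coeff B ^ j0) = 0" by auto
    with ij0 uv show False by auto
  qed
  \<comment> \<open>Both exponents lie on the line \<open>u * i + v * j = d\<close> with positive
    \<open>u\<close>, \<open>v\<close>, so distinct points differ in both coordinates. Hence
    \<open>x\<close> and \<open>y\<close> both occur in \<open>q\<close>.\<close>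
  have ne: "i0 \<noteq> i1 \<and> j0 \<noteq> j1"
    using weight [OF ij0] weight [OF ij1(1)] ij1(2) uv by (auto simp: u_def v_def)
  have dxq: "dx q \<noteq> 0"
  proof -
    obtain i j where "coeff (coeff q j) (Suc i) \<noteq> 0"
      using ne ij0 ij1(1) by (metis not0_implies_Suc)
    then have "coeff (coeff (dx q) j) i \<noteq> 0"
      unfolding coeff_coeff_dx by (simp del: of_nat_Suc)
    then show ?thesis by force
  qed
  have dyq: "dy q \<noteq> 0"
  proof -
    obtain i j where "coeff (coeff q (Suc j)) i \<noteq> 0"
      using ne ij0 ij1(1) by (metis not0_implies_Suc)
    then have "coeff (coeff (dy q) j) i \<noteq> 0"
      unfolding coeff_coeff_dy by (simp del: of_nat_Suc)
    then show ?thesis by force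
  qed
  \<comment> \<open>\<open>r\<close> is weighted homogeneous, so the iterates of
    \<open>jac q\<close> on \<open>r\<close> are the leading parts of the iterates of
    \<open>jac P\<close>.\<close>
  have nilq: "\<exists>n. (jac q ^^ n) r = 0" if nil: "\<exists>n. (jac P ^^ n) r = 0" and r: "leads u v e r r" for r e
  proof -
    obtain k where "(jac P ^^ k) r = 0" using nil by blast
    with leads_jac_funpow [OF q(1) r, of k] have "(jac q ^^ k) r = 0"
      by (metis leads_0)
    then show ?thesis ..
  qed
  have "\<exists>n. (jac q ^^ n) X = 0" "\<exists>n. (jac q ^^ n) Y = 0"
    by (rule nilq [OF _ leads_X] nilq [OF _ leads_Y], rule jac_locally_nilpotent [OF A B])+
  then have nil: "\<exists>n. (jac q ^^ n) p = 0" for p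
    by (rule locally_nilpotentI [OF derivation_jac jac_Const])
  \<comment> \<open>\<open>jac q\<close> kills \<open>q\<close>, hence each factor of
    \<open>q\<close>; killing \<open>X\<close> would mean \<open>dy q = 0\<close>. Consequently
    \<open>q\<close> contains a pure power of \<open>y\<close>, and by the same argument for
    \<open>Y\<close> a pure power of \<open>x\<close>.\<close>
  have "\<not> X dvd q"
  proof
    assume "X dvd q"
    then obtain r where r: "q = X * r" by auto
    have "jac q (X * r) = 0" "X * r \<noteq> 0"
      using q(2) by (simp_all only: r [symmetric] jac_self not_False_eq_True)
    then have "jac q X = 0" by (rule locally_nilpotent_factor [OF derivation_jac nil])
    with dyq show False by (simp add: jac_X)
  qed
  then obtain j2 where "coeff (coeff q j2) 0 \<noteq> 0" by (auto simp: X_dvd_iff)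
  from weight [OF this] have j2: "v * j2 = d" by simp
  have "\<not> Y dvd q"
  proof
    assume "Y dvd q"
    then obtain r where r: "q = Y * r" by auto
    have "jac q (Y * r) = 0" "Y * r \<noteq> 0"
      using q(2) by (simp_all only: r [symmetric] jac_self not_False_eq_True)
    then have "jac q Y = 0" by (rule locally_nilpotent_factor [OF derivation_jac nil])
    with dxq show False by (simp add: jac_Y)
  qed
  then obtain i2 where "coeff (coeff q 0) i2 \<noteq> 0"
    unfolding Y_dvd_iff by (meson leading_coeff_0_iff)
  from weight [OF this] have i2: "u * i2 = d" by simp
  \<comment> \<open>A term of \<open>q\<close> linear in \<open>y\<close> would give
    \<open>u * i + v = d = u * i2\<close> and hence \<open>u dvd v\<close>.\<close>
  have "Y dvd dy q"
  proof -
    have "coeff (coeff (dy q) 0) i = 0" for i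
    proof (rule ccontr)
      assume "\<not> ?thesis"
      then have "u * i + v = d" using weight [of 1 i] by (simp add: coeff_coeff_dy)
      then have "u dvd v" using i2 by (metis dvd_add_right_iff dvd_triv_left)
      with contr show False by (simp add: u_def v_def)
    qed
    then show ?thesis by (simp add: Y_dvd_iff poly_eq_iff)
  qed
  then have "Y dvd jac q X" by (simp add: jac_X)
  moreover have "X dvd dx q"
    unfolding X_dvd_iff
  proof (intro allI, rule ccontr)
    fix j
    assume "coeff (coeff (dx q) j) 0 \<noteq> 0"
    then have "u + v * j = d" using weight [of j 1] by (simp add: coeff_coeff_dx)
    then have "v dvd u" using j2 by (metis dvd_add_left_iff dvd_triv_left)
    with contr show False by (simp add: u_def v_def)
  qed
  then have "X dvd jac q Y" by (simp add: jac_Y)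
  ultimately show False
    using locally_nilpotent_not_both_dvd [OF derivation_jac nil, of X Y] dxq dyq
    by (simp add: jac_X jac_Y)
qed

text \<open>If \<open>v = u * b\<close>, weighted homogeneity turns the relation between the leading
  coefficients into \<alpha>^k \<phi>(\<beta> / \<alpha>^b) = 0 with a nonzero polynomial \<phi>
  over the field. So \<beta> / \<alpha>^b takes only finitely many values, and on an infinite field
  it must be constant.\<close>

lemma lead_coeff_proportional:
  fixes P :: "'a::field_char_0 poly poly"
  assumes PAB: "psubst P (A, B) = X" and uv: "degree A > 0" "degree B > 0"
    and dvd: "degree B = degree A * b"
  shows "\<exists>l. lead_coeff B = smult l (lead_coeff A ^ b)"
proof -
  define u v where "u = degree A" and "v = degree B"
  define \<alpha> \<beta> where "\<alpha> = lead_coeff A" and "\<beta> = lead_coeff B"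
  obtain d q n m where q0: "leads (degree A) (degree B) (int d) P q" "q \<noteq> 0"
    "degree q \<le> n" "\<forall>j. degree (coeff q j) \<le> m"
    and rel0: "(\<Sum>j\<le>n. \<Sum>i\<le>m. smult (coeff (coeff q j) i) (lead_coeff A ^ i * lead_coeff B ^ j)) = 0"
    using leading_form_relation [OF PAB uv] .
  note q = q0 [folded u_def v_def] and rel = rel0 [folded \<alpha>_def \<beta>_def]
  have weight: "u * i + v * j = d" if "coeff (coeff q j) i \<noteq> 0" for i j
    using leadsD2 [OF q(1), of i j] that by linarith
  from q(2) obtain j0 where j0: "coeff q j0 \<noteq> 0" by (meson leading_coeff_0_iff)
  then obtain i0 where ij0: "coeff (coeff q j0) i0 \<noteq> 0" by (meson leading_coeff_0_iff)
  \<comment> \<open>\<open>k\<close> is the common value of \<open>i + b * j\<close> on the support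
    of \<open>q\<close>, that is, \<open>d\<close> divided by \<open>u\<close>.\<close>
  define k where "k = i0 + b * j0"
  have weight': "i + b * j = k" if "coeff (coeff q j) i \<noteq> 0" for i j
  proof -
    have "u * (i + b * j) = u * k"
      using weight [OF that] weight [OF ij0] dvd by (simp add: k_def u_def v_def distrib_left)
    then show ?thesis using uv by (simp add: u_def)
  qed
  \<comment> \<open>For each \<open>j\<close> at most one \<open>i\<close> satisfies
    \<open>i + b * j = k\<close>, so the inner sum only picks out that coefficient.\<close>
  define \<phi> where "\<phi> = (\<Sum>j\<le>n. monom (\<Sum>i\<le>m. coeff (coeff q j) i) j)"
  have "j0 \<le> n" "i0 \<le> m" using q(3) q(4) [rule_format, of j0] ij0 j0 le_degree order_trans by blast+
  have "coeff \<phi> j0 = (\<Sum>i\<le>m. coeff (coeff q j0) i)"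
    using \<open>j0 \<le> n\<close> by (simp add: \<phi>_def coeff_sum_monom)
  also have "\<dots> = (\<Sum>i\<in>{i0}. coeff (coeff q j0) i)"
    using \<open>i0 \<le> m\<close> weight' [of j0] by (intro sum.mono_neutral_right) (force simp: k_def)+
  finally have "\<phi> \<noteq> 0" using ij0 by auto
  have root: "poly \<phi> (poly \<beta> t / poly \<alpha> t ^ b) = 0" if t: "poly \<alpha> t \<noteq> 0" for t
  proof -
    define z where "z = poly \<beta> t / poly \<alpha> t ^ b"
    have \<beta>: "poly \<beta> t = z * poly \<alpha> t ^ b" using t by (simp add: z_def)
    have "0 = poly (\<Sum>j\<le>n. \<Sum>i\<le>m. smult (coeff (coeff q j) i) (\<alpha> ^ i * \<beta> ^ j)) t"
      by (simp add: rel)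
    also have "\<dots> = (\<Sum>j\<le>n. \<Sum>i\<le>m. poly \<alpha> t ^ k * (coeff (coeff q j) i * z ^ j))"
      unfolding poly_sum
    proof (intro sum.cong refl)
      fix i j
      show "poly (smult (coeff (coeff q j) i) (\<alpha> ^ i * \<beta> ^ j)) t =
          poly \<alpha> t ^ k * (coeff (coeff q j) i * z ^ j)"
      proof (cases "coeff (coeff q j) i = 0")
        case False
        from weight' [OF this] show ?thesis
          by (auto simp: \<beta> power_mult_distrib power_add power_mult)
      qed simp
    qed
    also have "\<dots> = poly \<alpha> t ^ k * poly \<phi> z"
      by (simp add: \<phi>_def poly_sum poly_monom sum_distrib_left sum_distrib_right)
    finally show ?thesis using t by (simp add: z_def)
  qed
  have "\<alpha> \<noteq> 0" using uv by (auto simp: \<alpha>_def)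
  define T where "T = {t. poly \<alpha> t \<noteq> 0}"
  have "infinite T"
  proof
    assume "finite T"
    moreover have "finite {t. poly \<alpha> t = 0}" using \<open>\<alpha> \<noteq> 0\<close> by (rule poly_roots_finite)
    moreover have "T \<union> {t. poly \<alpha> t = 0} = UNIV" by (auto simp: T_def)
    ultimately show False using infinite_UNIV_char_0 by (metis finite_UnI)
  qed
  moreover have "finite ((\<lambda>t. poly \<beta> t / poly \<alpha> t ^ b) ` T)"
    using poly_roots_finite [OF \<open>\<phi> \<noteq> 0\<close>] by (rule rev_finite_subset) (auto simp: T_def root)
  \<comment> \<open>One of the finitely many ratios is attained at infinitely many points; agreement
    there is an identity of polynomials.\<close>
  ultimately obtain t0 where t0: "infinite {t \<in> T. poly \<beta> t / poly \<alpha> t ^ b = poly \<beta> t0 / poly \<alpha> t0 ^ b}"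
    using pigeonhole_infinite by blast
  define l where "l = poly \<beta> t0 / poly \<alpha> t0 ^ b"
  have "{t \<in> T. poly \<beta> t / poly \<alpha> t ^ b = l} \<subseteq> {t. poly (\<beta> - smult l (\<alpha> ^ b)) t = 0}"
    by (auto simp: T_def field_simps)
  with t0 have "infinite {t. poly (\<beta> - smult l (\<alpha> ^ b)) t = 0}"
    unfolding l_def using finite_subset by blast
  then have "\<beta> - smult l (\<alpha> ^ b) = 0" using poly_roots_finite by blast
  then show ?thesis by (auto simp: \<alpha>_def \<beta>_def)
qed

section \<open>Affine and elementary maps\<close>

interpretation GA2: group "GA2 :: 'a::field polymap monoid"
  by (rule group_GA2)

lemma mult_GA2 [simp]: "mult GA2 = polymap_comp"
  and one_GA2 [simp]: "\<one>\<^bsub>GA2\<^esub> = (X, Y)"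
  by (simp_all add: GA2_def End2_def units_of_def)

lemma GA2_iff:
  "F \<in> carrier GA2 \<longleftrightarrow> (\<exists>G. polymap_comp G F = (X, Y) \<and> polymap_comp F G = (X, Y))"
  by (auto simp: GA2_def units_of_carrier Units_def End2_def)

lemma GA2_I: "polymap_comp G F = (X, Y) \<Longrightarrow> polymap_comp F G = (X, Y) \<Longrightarrow> F \<in> carrier GA2"
  unfolding GA2_iff by blast

lemma inv_GA2_eq:
  "polymap_comp G F = (X, Y) \<Longrightarrow> polymap_comp F G = (X, Y) \<Longrightarrow> inv\<^bsub>GA2\<^esub> F = (G :: 'a::field polymap)"
  by (rule GA2.inv_equality) (auto intro: GA2_I)

lemma subgroup_GA2I:
  fixes H :: "'a::field polymap set"
  assumes "H \<noteq> {}" "\<And>g h. g \<in> H \<Longrightarrow> h \<in> H \<Longrightarrow> polymap_comp g h \<in> H"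
    "\<And>g. g \<in> H \<Longrightarrow> \<exists>h\<in>H. polymap_comp g h = (X, Y) \<and> polymap_comp h g = (X, Y)"
  shows "subgroup H GA2"
proof (rule GA2.subgroupI)
  show "H \<subseteq> carrier GA2" using assms(3) GA2_I by blast
  show "inv\<^bsub>GA2\<^esub> g \<in> H" if "g \<in> H" for g
    using assms(3) [OF that] inv_GA2_eq by metis
qed (use assms in auto)

section \<open>The affine subgroup\<close>

lemma comp_affine:
  "polymap_comp (affine_polymap M a) (affine_polymap M' a') =
    affine_polymap (M ** M') (M *v a' + a)"
  by (simp add: affine_polymap_def polymap_comp_def psubst_add psubst_mult matrix_matrix_mult_def
      matrix_vector_mult_def sum_2 Const_add Const_mult algebra_simps)

lemma affine_id: "affine_polymap (mat 1) 0 = (X, Y)"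
  by (simp add: affine_polymap_def mat_def)

lemma affine_inverse:
  assumes "M ** M' = mat 1" "M' ** M = mat 1"
  shows "polymap_comp (affine_polymap M a) (affine_polymap M' (- (M' *v a))) = (X, Y)"
    "polymap_comp (affine_polymap M' (- (M' *v a))) (affine_polymap M a) = (X, Y)"
proof -
  have "M *v (- (M' *v a)) = - ((M ** M') *v a)"
    by (simp add: vec_eq_iff matrix_vector_mult_def matrix_matrix_mult_def sum_2 algebra_simps)
  then show "polymap_comp (affine_polymap M a) (affine_polymap M' (- (M' *v a))) = (X, Y)"
    "polymap_comp (affine_polymap M' (- (M' *v a))) (affine_polymap M a) = (X, Y)"
    using assms by (simp_all add: comp_affine affine_id)
qed

lemma subgroup_Aff: "subgroup Aff GA2"
proof (rule subgroup_GA2I)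
  have "invertible (mat 1 :: 'a^2^2)" by (auto simp: invertible_def)
  then show "Aff \<noteq> ({} :: 'a polymap set)" unfolding Aff_def by blast
  show "polymap_comp g h \<in> Aff" if "g \<in> Aff" "h \<in> Aff" for g h :: "'a polymap"
    using that unfolding Aff_def by (force simp: comp_affine intro: invertible_mult)
  show "\<exists>h\<in>Aff. polymap_comp g h = (X, Y) \<and> polymap_comp h g = (X, Y)"
    if "g \<in> Aff" for g :: "'a polymap"
  proof -
    obtain M a where g: "g = affine_polymap M a" "invertible M"
      using \<open>g \<in> Aff\<close> unfolding Aff_def by blast
    then obtain M' where M': "M ** M' = mat 1" "M' ** M = mat 1" by (auto simp: invertible_def)
    then have "affine_polymap M' (- (M' *v a)) \<in> Aff" by (auto simp: Aff_def invertible_def)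
    with affine_inverse [OF M'] g show ?thesis by blast
  qed
qed

section \<open>The elementary subgroup\<close>

abbreviation inY :: "'a::field poly \<Rightarrow> 'a poly poly" where
  "inY \<equiv> map_poly (\<lambda>c. [:c:])"

lemma inY_pCons [simp]: "inY (pCons c p) = Const c + Y * inY p"
  by (simp add: map_poly_pCons Const_def Y_def)

lemma coeff_inY: "coeff (inY p) j = [:coeff p j:]"
  by (simp add: coeff_map_poly)

lemma inY_add: "inY (p + q) = inY p + inY q"
  by (rule poly_eqI) (simp add: coeff_inY)

lemma inY_smult: "inY (smult c p) = Const c * inY p"
  by (rule poly_eqI) (simp add: coeff_inY Const_def)

lemma psubst_inY: "psubst (inY p) F = poly (map_poly Const p) (snd F)"
  by (induction p) (simp_all add: psubst_add psubst_mult map_poly_pCons)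

lemma inY_mult: "inY (p * q) = inY p * inY q"
  by (induction p) (simp_all add: inY_add inY_smult algebra_simps)

lemma inY_pcompose: "inY (pcompose p q) = poly (map_poly Const p) (inY q)"
  by (induction p) (simp_all add: pcompose_pCons inY_add inY_mult map_poly_pCons)

lemma comp_elementary:
  "polymap_comp (elementary_polymap \<alpha> P \<beta> v) (elementary_polymap \<alpha>' P' \<beta>' v') =
    elementary_polymap (\<alpha> * \<alpha>') (smult \<alpha> P' + pcompose P [:v', \<beta>':]) (\<beta> * \<beta>') (\<beta> * v' + v)"
  by (simp add: elementary_polymap_def polymap_comp_def psubst_add psubst_mult psubst_inY
      inY_add inY_smult inY_pcompose Const_add Const_mult algebra_simps)

lemma elementary_id: "elementary_polymap 1 0 1 0 = (X, Y)"
  by (simp add: elementary_polymap_def)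

text \<open>The second component is solved for \<open>y\<close> first; the result is then put into
  \<open>P\<close> to solve the first one for \<open>x\<close>.\<close>

lemma elementary_inverse:
  fixes P :: "'a::field poly"
  assumes "\<alpha> * \<beta> \<noteq> 0"
  defines "e \<equiv> \<lambda>v. elementary_polymap (1 / \<alpha>) (smult (- 1 / \<alpha>) (pcompose P [:- v / \<beta>, 1 / \<beta>:])) (1 / \<beta>) (- v / \<beta>)"
  shows "polymap_comp (elementary_polymap \<alpha> P \<beta> v) (e v) = (X, Y)"
    "polymap_comp (e v) (elementary_polymap \<alpha> P \<beta> v) = (X, Y)"
proof -
  have "pcompose (pcompose P [:- v / \<beta>, 1 / \<beta>:]) [:v, \<beta>:] = P"
  proof -
    have "pcompose [:- v / \<beta>, 1 / \<beta>:] [:v, \<beta>:] = [:0, 1:]"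
      using assms(1) by (simp add: pcompose_pCons)
    then show ?thesis by (simp add: pcompose_assoc [symmetric] pcompose_idR)
  qed
  then show "polymap_comp (elementary_polymap \<alpha> P \<beta> v) (e v) = (X, Y)"
    "polymap_comp (e v) (elementary_polymap \<alpha> P \<beta> v) = (X, Y)"
    using assms(1) unfolding e_def
    by (simp_all add: comp_elementary pcompose_smult pcompose_uminus elementary_id [symmetric])
qed

lemma ElemI: "\<alpha> * \<beta> \<noteq> 0 \<Longrightarrow> elementary_polymap \<alpha> P \<beta> v \<in> Elem"
  unfolding Elem_def by blast

lemma subgroup_Elem: "subgroup Elem GA2"
proof (rule subgroup_GA2I)
  show "Elem \<noteq> {}" using ElemI [of 1 1] by auto
  show "polymap_comp g h \<in> Elem" if gh: "g \<in> Elem" "h \<in> Elem" for g h :: "'a polymap"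
  proof -
    obtain \<alpha> P \<beta> v \<alpha>' P' \<beta>' v' where
      "g = elementary_polymap \<alpha> P \<beta> v" "\<alpha> * \<beta> \<noteq> 0"
      "h = elementary_polymap \<alpha>' P' \<beta>' v'" "\<alpha>' * \<beta>' \<noteq> 0"
      using gh unfolding Elem_def by blast
    then show ?thesis by (auto simp: comp_elementary intro!: ElemI)
  qed
  show "\<exists>h\<in>Elem. polymap_comp g h = (X, Y) \<and> polymap_comp h g = (X, Y)"
    if "g \<in> Elem" for g :: "'a polymap"
  proof -
    obtain \<alpha> P \<beta> v where g: "g = elementary_polymap \<alpha> P \<beta> v" "\<alpha> * \<beta> \<noteq> 0"
      using \<open>g \<in> Elem\<close> unfolding Elem_def by blast
    let ?e = "elementary_polymap (1 / \<alpha>) (smult (- 1 / \<alpha>) (pcompose P [:- v / \<beta>, 1 / \<beta>:])) (1 / \<beta>) (- v / \<beta>)"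
    have "?e \<in> Elem" using g(2) by (intro ElemI) auto
    with elementary_inverse [OF g(2)] show ?thesis unfolding g(1) by blast
  qed
qed

section \<open>The intersection: affine maps with upper triangular matrix\<close>

lemma elementary_linear:
  "elementary_polymap \<alpha> [:d, c:] \<beta> v =
    affine_polymap (vector [vector [\<alpha>, c], vector [0, \<beta>]]) (vector [d, v])"
  by (simp add: affine_polymap_def elementary_polymap_def algebra_simps)

lemma invertible_2: "invertible M \<longleftrightarrow> M $ 1 $ 1 * M $ 2 $ 2 - M $ 1 $ 2 * M $ 2 $ 1 \<noteq> 0"
  for M :: "'a::field^2^2"
  by (simp add: invertible_det_nz det_2)

lemma affine_eq_elementary:
  assumes "affine_polymap M a = elementary_polymap \<alpha> P \<beta> v"
  shows "M $ 2 $ 1 = 0" "degree P \<le> 1" "P = [:a $ 1, M $ 1 $ 2:]" "\<alpha> = M $ 1 $ 1" "\<beta> = M $ 2 $ 2" "v = a $ 2"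
proof -
  have 1: "coeff (coeff (Const (M $ 1 $ 1) * X + Const (M $ 1 $ 2) * Y + Const (a $ 1)) j) i =
      coeff (coeff (Const \<alpha> * X + inY P) j) i"
    and 2: "coeff (coeff (Const (M $ 2 $ 1) * X + Const (M $ 2 $ 2) * Y + Const (a $ 2)) j) i =
      coeff (coeff (Const \<beta> * Y + Const v) j) i" for i j
    using assms by (simp_all add: affine_polymap_def elementary_polymap_def)
  show "M $ 2 $ 1 = 0" "\<beta> = M $ 2 $ 2" "v = a $ 2"
    using 2 [where i=1 and j=0] 2 [where i=0 and j=1] 2 [where i=0 and j=0]
    by (simp_all add: Const_def coeff_coeff_X coeff_coeff_Y)
  show "\<alpha> = M $ 1 $ 1"
    using 1 [where i=1 and j=0] by (simp add: Const_def coeff_coeff_X coeff_coeff_Y coeff_inY)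
  show P: "P = [:a $ 1, M $ 1 $ 2:]"
  proof (rule poly_eqI)
    fix j
    show "coeff P j = coeff [:a $ 1, M $ 1 $ 2:] j"
      using 1 [where i=0 and j=j]
      by (cases j; cases "j - 1")
        (simp_all add: Const_def coeff_coeff_X coeff_coeff_Y coeff_inY)
  qed
  show "degree P \<le> 1" unfolding P by simp
qed

lemma AffI: "invertible M \<Longrightarrow> affine_polymap M a \<in> Aff"
  unfolding Aff_def by blast

lemma elementary_in_Aff_iff:
  assumes "\<alpha> * \<beta> \<noteq> 0"
  shows "elementary_polymap \<alpha> P \<beta> v \<in> Aff \<longleftrightarrow> degree P \<le> 1"
proof
  assume "elementary_polymap \<alpha> P \<beta> v \<in> Aff"
  then obtain M a where "elementary_polymap \<alpha> P \<beta> v = affine_polymap M a" unfolding Aff_def by blast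
  then show "degree P \<le> 1" by (rule affine_eq_elementary(2) [OF sym])
next
  assume "degree P \<le> 1"
  then have "P = [:coeff P 0, coeff P 1:]"
    by (intro poly_eqI) (auto simp: coeff_pCons coeff_eq_0 split: nat.split)
  then show "elementary_polymap \<alpha> P \<beta> v \<in> Aff"
    using assms by (metis elementary_linear AffI invertible_2 vector_2 mult_zero_right diff_zero)
qed

lemma affine_in_Elem_iff:
  assumes "invertible M"
  shows "affine_polymap M a \<in> Elem \<longleftrightarrow> M $ 2 $ 1 = 0"
proof
  assume "affine_polymap M a \<in> Elem"
  then show "M $ 2 $ 1 = 0" unfolding Elem_def using affine_eq_elementary(1) by blast
next
  assume 0: "M $ 2 $ 1 = 0"
  then have "affine_polymap M a = elementary_polymap (M $ 1 $ 1) [:a $ 1, M $ 1 $ 2:] (M $ 2 $ 2) (a $ 2)"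
    by (simp add: affine_polymap_def elementary_polymap_def algebra_simps)
  then show "affine_polymap M a \<in> Elem"
    using assms 0 by (auto simp: invertible_2 intro!: ElemI)
qed

lemma Elem_minus_BorE:
  assumes "g \<in> Elem - Bor"
  obtains \<alpha> P \<beta> v where "g = elementary_polymap \<alpha> P \<beta> v" "\<alpha> \<noteq> 0" "\<beta> \<noteq> 0" "degree P \<ge> 2"
proof -
  obtain \<alpha> P \<beta> v where g: "g = elementary_polymap \<alpha> P \<beta> v" "\<alpha> * \<beta> \<noteq> 0"
    using assms unfolding Elem_def by blast
  with assms have "\<not> degree P \<le> 1" by (auto simp: Bor_def elementary_in_Aff_iff)
  with g that show ?thesis by (metis less_eq_Suc_le mult_eq_0_iff not_le one_add_one plus_1_eq_Suc)
qed

lemma Aff_minus_BorE: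
  assumes "g \<in> Aff - Bor"
  obtains M a where "g = affine_polymap M a" "invertible M" "M $ 2 $ 1 \<noteq> 0"
  using assms by (auto simp: Bor_def affine_in_Elem_iff Aff_def)

lemma BorE:
  assumes "g \<in> Bor"
  obtains \<alpha> c d \<beta> v where "g = elementary_polymap \<alpha> [:d, c:] \<beta> v" "\<alpha> \<noteq> 0" "\<beta> \<noteq> 0"
proof -
  obtain \<alpha> P \<beta> v where g: "g = elementary_polymap \<alpha> P \<beta> v" "\<alpha> * \<beta> \<noteq> 0"
    using assms unfolding Elem_def Bor_def by blast
  obtain M a where M: "g = affine_polymap M a" using assms unfolding Aff_def Bor_def by blast
  with g that affine_eq_elementary(3) show ?thesis by (metis mult_eq_0_iff)
qed

section \<open>Generation by affine and elementary maps\<close>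

lemma psubst_power: "psubst (p ^ n) F = psubst p F ^ n"
  by (induction n) (simp_all add: psubst_mult psubst_Const [of 1, simplified])

definition swap :: "'a::field polymap" where
  "swap = (Y, X)"

lemma swap_Aff: "swap \<in> Aff"
proof -
  have "swap = affine_polymap (vector [vector [0, 1], vector [1, 0]]) 0"
    by (simp add: swap_def affine_polymap_def)
  then show ?thesis by (metis AffI invertible_2 vector_2 diff_0 mult_zero_left mult_1 neg_equal_0_iff_equal zero_neq_one)
qed

lemma comp_swap: "polymap_comp swap F = (snd F, fst F)"
  by (simp add: polymap_comp_def swap_def)

text \<open>Conjugation by the swap exchanges the roles of the variables: \<open>[:P:]\<close> is
  \<open>P(x)\<close>, now added to the second component. Degree reduction uses maps of this
  shape.\<close>

lemma swap_elementary_swap: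
  "polymap_comp swap (polymap_comp (elementary_polymap \<alpha> P \<beta> v) swap) =
    (Const \<beta> * X + Const v, Const \<alpha> * Y + [:P:])"
proof -
  have "psubst (inY P) (Y, X) = [:P:]"
    by (induction P) (simp_all add: psubst_add psubst_mult const_pCons_eq)
  then show ?thesis
    by (simp add: comp_swap)
      (simp add: polymap_comp_def swap_def elementary_polymap_def psubst_add psubst_mult)
qed

lemma ex_inverse_GA2:
  assumes "(A, B) \<in> carrier GA2"
  obtains P Q where "psubst P (A, B) = X" "psubst Q (A, B) = Y" "psubst A (P, Q) = X" "psubst B (P, Q) = Y"
  using assms unfolding GA2_iff by (auto simp: polymap_comp_def)

context
  fixes H :: "'a::field_char_0 polymap set"
  assumes H: "subgroup H GA2" and AH: "Aff \<subseteq> H" and EH: "Elem \<subseteq> H"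
begin

lemma in_subgroup_iff: "t \<in> H \<Longrightarrow> g \<in> carrier GA2 \<Longrightarrow> polymap_comp t g \<in> H \<longleftrightarrow> g \<in> H"
proof
  assume t: "t \<in> H" and g: "g \<in> carrier GA2" and tg: "polymap_comp t g \<in> H"
  have tc: "t \<in> carrier GA2" using subgroup.mem_carrier [OF H t] .
  have "inv\<^bsub>GA2\<^esub> t \<otimes>\<^bsub>GA2\<^esub> (t \<otimes>\<^bsub>GA2\<^esub> g) \<in> H"
    using subgroup.m_closed [OF H subgroup.m_inv_closed [OF H t]] tg by simp
  moreover have "inv\<^bsub>GA2\<^esub> t \<otimes>\<^bsub>GA2\<^esub> (t \<otimes>\<^bsub>GA2\<^esub> g) = g"
    using GA2.inv_solve_left [OF g tc GA2.m_closed [OF tc g]] by simp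
  ultimately show "g \<in> H" by (simp only:)
next
  assume "t \<in> H" "g \<in> H"
  then show "polymap_comp t g \<in> H" using subgroup.m_closed [OF H, of t g] by simp
qed

lemma swap_H: "swap \<in> H" using swap_Aff AH by auto

lemma swap_elementary_swap_H:
  "\<alpha> \<noteq> 0 \<Longrightarrow> \<beta> \<noteq> 0 \<Longrightarrow> (Const \<beta> * X + Const v, Const \<alpha> * Y + [:P:]) \<in> H"
  unfolding swap_elementary_swap [symmetric] mult_GA2 [symmetric]
  using swap_H EH ElemI [of \<alpha> \<beta> P v] by (intro subgroup.m_closed [OF H]) auto

text \<open>The base case of the reduction. As \<open>A\<close> lies in \<open>K[x]\<close>, the
  Jacobian is the product of the derivative of \<open>A\<close> and \<open>dy B\<close>; being a
  nonzero constant, it forces both factors to be constants. So \<open>A\<close> is linear in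
  \<open>x\<close>, and \<open>B\<close> is a multiple of \<open>y\<close> plus a polynomial in
  \<open>x\<close>.\<close>

lemma univariate_in_subgroup:
  assumes AB: "(A, B) \<in> carrier GA2" and A: "degree A = 0"
  shows "(A, B) \<in> H"
proof -
  obtain P Q where PQ: "psubst P (A, B) = X" "psubst Q (A, B) = Y"
    using ex_inverse_GA2 [OF AB] by metis
  obtain c where c: "jac A B = Const c" "c \<noteq> 0" using jac_const_if_inverse [OF PQ] by auto
  obtain a where a: "A = [:a:]" using A by (metis degree_eq_zeroE)
  have "jac A B = [:pderiv a:] * dy B" by (simp add: jac_def a dx_def map_poly_pCons)
  with c have prod: "[:pderiv a:] * dy B = Const c" by simp
  moreover have "Const c dvd 1"
    using c(2) by (simp add: Const_def is_unit_poly_iff) (metis is_unit_const_poly_iff dvd_field_iff)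
  ultimately have "[:pderiv a:] dvd 1" "dy B dvd 1"
    by (metis dvd_mult_left, metis dvd_mult_right)
  then obtain a1 b1 where a1: "pderiv a = [:a1:]" "a1 \<noteq> 0" and b1: "dy B = [:[:b1:]:]" "b1 \<noteq> 0"
    by (metis is_unit_poly_iff is_unit_const_poly_iff dvd_0_left_iff zero_neq_one)
  have "pderiv a \<noteq> 0" using a1 by simp
  then have "degree a \<noteq> 0" using pderiv_eq_0_iff by blast
  moreover have "degree a - 1 = 0" using degree_pderiv [of a] a1 by simp
  ultimately have "degree a = 1" by simp
  have aa: "a = [:coeff a 0, coeff a 1:]" "coeff a 1 \<noteq> 0"
    using \<open>degree a = 1\<close> by (auto intro!: poly_eqI simp: coeff_pCons coeff_eq_0 split: nat.split)
      (metis leading_coeff_0_iff degree_0 zero_neq_one One_nat_def)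
  have "dy B \<noteq> 0" using b1 by simp
  then have "degree B \<noteq> 0" using pderiv_eq_0_iff by blast
  moreover have "degree B - 1 = 0" using degree_pderiv [of B] b1 by simp
  ultimately have "degree B = 1" by simp
  then have B: "B = [:coeff B 0, coeff B 1:]"
    by (auto intro!: poly_eqI simp: coeff_pCons coeff_eq_0 split: nat.split)
  have "coeff B 1 = [:b1:]"
    using coeff_pderiv [of B 0] b1(1) by simp
  with B have B': "B = Const b1 * Y + [:coeff B 0:]" by (simp add: Const_def Y_def)
  have A': "A = Const (coeff a 1) * X + Const (coeff a 0)"
    using aa(1) a by (simp add: Const_def X_def)
  show ?thesis
    using swap_elementary_swap_H [of b1 "coeff a 1" "coeff a 0" "coeff B 0"] aa(2) b1(2) A' B' by simp
qed

text \<open>The leading coefficient of \<open>B\<close> is \<open>l\<close> times that of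
  \<open>A ^ b\<close>, so subtracting \<open>l A^b\<close> from \<open>B\<close> cancels the top
  term.\<close>

lemma degree_reduction:
  assumes AB: "(A, B) \<in> carrier GA2" and uv: "degree A > 0" "degree B > 0"
    and dvd: "degree A dvd degree B"
  shows "\<exists>t\<in>H. \<exists>B'. polymap_comp t (A, B) = (A, B') \<and> degree B' < degree B"
proof -
  obtain P Q where P: "psubst P (A, B) = X"
    using ex_inverse_GA2 [OF AB] by metis
  obtain b where b: "degree B = degree A * b" using dvd by auto
  obtain l where l: "lead_coeff B = smult l (lead_coeff A ^ b)"
    using lead_coeff_proportional [OF P uv b] by auto
  define B' where "B' = B - Const l * A ^ b"
  have "degree (Const l * A ^ b) \<le> degree B"
    using degree_mult_le [of "Const l" "A ^ b"] degree_power_le [of A b] by (simp add: b Const_def)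
  then have "degree B' \<le> degree B" unfolding B'_def by (intro degree_diff_le) auto
  moreover have "coeff B' (degree B) = 0"
    using l coeff_power_le [of A "degree A" b] by (simp add: B'_def Const_def b)
  ultimately have "degree B' < degree B" using uv eq_zero_or_degree_less by fastforce
  \<comment> \<open>The map \<open>(x, y - l x^b)\<close>, written in the shape produced by
    conjugating an elementary map with the swap.\<close>
  define t :: "'a polymap" where "t = (Const 1 * X + Const 0, Const 1 * Y + [:- monom l b:])"
  have "[:monom l b:] = Const l * X ^ b"
    unfolding X_def poly_const_pow monom_altdef by (simp add: Const_def)
  moreover have "[:- monom l b:] = - [:monom l b:]" by simp
  ultimately have "t = (X, Y - Const l * X ^ b)" unfolding t_def by simp
  then have "polymap_comp t (A, B) = (A, B')"
    by (simp add: polymap_comp_def psubst_diff psubst_mult psubst_power B'_def)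
  moreover have "t \<in> H" unfolding t_def by (rule swap_elementary_swap_H) simp_all
  ultimately show ?thesis using \<open>degree B' < degree B\<close> by blast
qed

text \<open>Induction on the sum of the degrees in \<open>y\<close>. The swap allows either
  component to play the role of \<open>A\<close>.\<close>

lemma GA2_subset_subgroup: "carrier GA2 \<subseteq> H"
proof
  fix F :: "'a polymap"
  assume "F \<in> carrier GA2"
  then show "F \<in> H"
  proof (induction "degree (fst F) + degree (snd F)" arbitrary: F rule: less_induct)
    case less
    have closed: "polymap_comp t F \<in> carrier GA2" if "t \<in> H" "F \<in> carrier GA2" for t F :: "'a polymap"
      using GA2.m_closed [OF subgroup.mem_carrier [OF H that(1)] that(2)] by simp
    obtain A B where F: "F = (A, B)" by force
    have swapF: "(B, A) \<in> carrier GA2" using closed [OF swap_H less.prems] by (simp add: comp_swap F)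
    have swap_iff: "F \<in> H \<longleftrightarrow> (B, A) \<in> H"
      using in_subgroup_iff [OF swap_H less.prems] by (simp add: comp_swap F)
    consider "degree A = 0" | "degree B = 0" | "degree A > 0" "degree B > 0" by auto
    then show ?case
    proof cases
      case 1
      then show ?thesis using univariate_in_subgroup less.prems F by blast
    next
      case 2
      then show ?thesis using univariate_in_subgroup swapF swap_iff by blast
    next
      case 3
      obtain P Q where "psubst P (A, B) = X" "psubst A (P, Q) = X" "psubst B (P, Q) = Y"
        using ex_inverse_GA2 less.prems F by metis
      then consider "degree A dvd degree B" | "degree B dvd degree A"
        using degree_dvd_if_inverse 3 by blast
      then show ?thesis
      proof cases
        case 1
        then obtain t B' where t: "t \<in> H" "polymap_comp t F = (A, B')" "degree B' < degree B"
          using degree_reduction 3 less.prems F by blast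
        then have "(A, B') \<in> H" using less.hyps [of "(A, B')"] closed [OF t(1) less.prems] F by simp
        then show ?thesis using in_subgroup_iff [OF t(1) less.prems] t(2) by simp
      next
        case 2
        then obtain t A' where t: "t \<in> H" "polymap_comp t (B, A) = (B, A')" "degree A' < degree A"
          using degree_reduction [OF swapF] 3 by blast
        then have "(B, A') \<in> H" using less.hyps [of "(B, A')"] closed [OF t(1) swapF] F by simp
        then show ?thesis using in_subgroup_iff [OF t(1) swapF] t(2) swap_iff by simp
      qed
    qed
  qed
qed

end

lemma generate_GA2: "generate GA2 (Aff \<union> Elem) = (carrier GA2 :: 'a::field_char_0 polymap set)"
proof
  have sub: "Aff \<union> Elem \<subseteq> (carrier GA2 :: 'a polymap set)"
    using subgroup.subset subgroup_Aff subgroup_Elem by (metis Un_subset_iff)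
  then show "generate GA2 (Aff \<union> Elem) \<subseteq> (carrier GA2 :: 'a polymap set)"
    by (rule GA2.generate_incl)
  show "(carrier GA2 :: 'a polymap set) \<subseteq> generate GA2 (Aff \<union> Elem)"
    by (rule GA2_subset_subgroup [OF GA2.generate_is_subgroup [OF sub]]) (auto intro: generate.incl)
qed

section \<open>Reduced words in amalgamated products\<close>

text \<open>The group-theoretic form of \<open>normal_form\<close>: outside
  \<open>A \<inter> E\<close> a letter lies in exactly one of \<open>A\<close>, \<open>E\<close>, so
  comparing membership in \<open>A\<close> decides alternation.\<close>

definition alternating :: "'g set \<Rightarrow> 'g set \<Rightarrow> 'g list \<Rightarrow> bool" where
  "alternating A E gs \<longleftrightarrow> gs \<noteq> [] \<and> set gs \<subseteq> (A \<union> E) - (A \<inter> E) \<and>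
     successively (\<lambda>u v. (u \<in> A) \<noteq> (v \<in> A)) gs"

lemma alternating_Cons:
  "alternating A E (x # xs) \<longleftrightarrow> x \<in> (A \<union> E) - (A \<inter> E) \<and>
     (xs = [] \<or> alternating A E xs \<and> (x \<in> A) \<noteq> (hd xs \<in> A))"
  by (cases xs) (auto simp: alternating_def)

lemma alternating_append:
  "xs \<noteq> [] \<Longrightarrow> ys \<noteq> [] \<Longrightarrow> alternating A E (xs @ ys) \<longleftrightarrow>
     alternating A E xs \<and> alternating A E ys \<and> (last xs \<in> A) \<noteq> (hd ys \<in> A)"
  by (auto simp: alternating_def successively_append_iff)

text \<open>Each step changes the factor. Thus even length means that the two ends lie in different
  factors and the word can be repeated without cancellation.\<close>

lemma alternating_parity:
  "alternating A E gs \<Longrightarrow> (hd gs \<in> A \<longleftrightarrow> last gs \<in> A) \<longleftrightarrow> odd (length gs)"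
proof (induction gs)
  case Nil
  then show ?case by (simp add: alternating_def)
qed (auto simp: alternating_Cons)

lemma (in group) subgroup_mult_left_iff:
  assumes "subgroup H G" "b \<in> H" "u \<in> carrier G"
  shows "b \<otimes> u \<in> H \<longleftrightarrow> u \<in> H"
proof
  assume "b \<otimes> u \<in> H"
  then have "inv b \<otimes> (b \<otimes> u) \<in> H"
    using assms by (simp add: subgroup.m_closed subgroup.m_inv_closed)
  then show "u \<in> H"
    using assms subgroup.mem_carrier [OF assms(1,2)] by (simp add: m_assoc [symmetric])
qed (use assms subgroup.m_closed [OF assms(1)] in auto)

lemma (in group) subgroup_mult_right_iff:
  assumes "subgroup H G" "b \<in> H" "u \<in> carrier G"
  shows "u \<otimes> b \<in> H \<longleftrightarrow> u \<in> H"
proof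
  assume "u \<otimes> b \<in> H"
  then have "(u \<otimes> b) \<otimes> inv b \<in> H"
    using assms by (simp add: subgroup.m_closed subgroup.m_inv_closed)
  then show "u \<in> H"
    using assms subgroup.mem_carrier [OF assms(1,2)] by (simp add: m_assoc)
qed (use assms subgroup.m_closed [OF assms(1)] in auto)

lemma (in group) subgroup_inv_iff:
  assumes "subgroup H G" "u \<in> carrier G"
  shows "inv u \<in> H \<longleftrightarrow> u \<in> H"
  using assms subgroup.m_inv_closed by (metis inv_inv)

text \<open>The last assumption is the internal criterion for \<open>G\<close> to be the free
  product of \<open>A\<close> and \<open>E\<close> amalgamated over
  \<open>A \<inter> E\<close>.\<close>

locale amalgam = group G for G (structure) +
  fixes A E :: "'a set"
  assumes subgroup_A: "subgroup A G" and subgroup_E: "subgroup E G"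
    and generate_AE: "generate G (A \<union> E) = carrier G"
    and alternating_notin: "alternating A E gs \<Longrightarrow> foldr (\<otimes>) gs \<one> \<notin> A \<inter> E"
begin

abbreviation B :: "'a set" where "B \<equiv> A \<inter> E"
abbreviation L :: "'a set" where "L \<equiv> (A \<union> E) - (A \<inter> E)"
abbreviation wprod :: "'a list \<Rightarrow> 'a" where "wprod gs \<equiv> foldr (\<otimes>) gs \<one>"
abbreviation alt :: "'a list \<Rightarrow> bool" where "alt \<equiv> alternating A E"

lemma AE_carrier: "u \<in> A \<union> E \<Longrightarrow> u \<in> carrier G"
  using subgroup.mem_carrier [OF subgroup_A] subgroup.mem_carrier [OF subgroup_E] by blast

lemma subgroup_B: "subgroup B G"
  by (rule subgroups_Inter_pair [OF subgroup_A subgroup_E])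

lemma L_carrier: "u \<in> L \<Longrightarrow> u \<in> carrier G" and B_carrier: "u \<in> B \<Longrightarrow> u \<in> carrier G"
  by (auto intro: AE_carrier)

section \<open>Letters, words and their inverses\<close>

lemma B_mult_L:
  assumes "b \<in> B" "u \<in> L"
  shows "b \<otimes> u \<in> L" "b \<otimes> u \<in> A \<longleftrightarrow> u \<in> A"
  using subgroup_mult_left_iff [OF subgroup_A, of b u] subgroup_mult_left_iff [OF subgroup_E, of b u]
    assms L_carrier by auto

lemma L_mult_B:
  assumes "b \<in> B" "u \<in> L"
  shows "u \<otimes> b \<in> L" "u \<otimes> b \<in> A \<longleftrightarrow> u \<in> A"
  using subgroup_mult_right_iff [OF subgroup_A, of b u] subgroup_mult_right_iff [OF subgroup_E, of b u]
    assms L_carrier by auto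

lemma inv_L:
  assumes "u \<in> L"
  shows "inv u \<in> L" "inv u \<in> A \<longleftrightarrow> u \<in> A"
  using subgroup_inv_iff [OF subgroup_A, of u] subgroup_inv_iff [OF subgroup_E, of u]
    assms L_carrier by auto

lemma L_mult_L:
  assumes "u \<in> L" "w \<in> L" "u \<in> A \<longleftrightarrow> w \<in> A" "u \<otimes> w \<notin> B"
  shows "u \<otimes> w \<in> L" "u \<otimes> w \<in> A \<longleftrightarrow> u \<in> A"
  using assms subgroup.m_closed [OF subgroup_A, of u w] subgroup.m_closed [OF subgroup_E, of u w]
  by auto

lemma alt_letters: "alt gs \<Longrightarrow> set gs \<subseteq> L"
  by (simp add: alternating_def)

lemma alt_ne: "alt gs \<Longrightarrow> gs \<noteq> []"
  by (simp add: alternating_def)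

lemma wprod_closed [simp]: "set gs \<subseteq> carrier G \<Longrightarrow> wprod gs \<in> carrier G"
  by (induction gs) auto

lemma alt_carrier: "alt gs \<Longrightarrow> set gs \<subseteq> carrier G"
  using alt_letters L_carrier by blast

lemma wprod_append: "set xs \<subseteq> carrier G \<Longrightarrow> set ys \<subseteq> carrier G \<Longrightarrow>
    wprod (xs @ ys) = wprod xs \<otimes> wprod ys"
  by (induction xs) (simp_all add: m_assoc)

lemma wprod_inv: "set gs \<subseteq> carrier G \<Longrightarrow> wprod (rev (map (m_inv G) gs)) = inv (wprod gs)"
proof (induction gs)
  case (Cons x gs)
  then have "set (rev (map (m_inv G) gs)) \<subseteq> carrier G" by auto
  with Cons show ?case by (simp add: wprod_append inv_mult_group del: foldr_append)
qed simp

lemma alt_inv: "alt gs \<Longrightarrow> alt (rev (map (m_inv G) gs))"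
proof (induction gs)
  case (Cons x gs)
  show ?case
  proof (cases "gs = []")
    case True
    then show ?thesis using Cons.prems inv_L [of x] by (simp add: alternating_Cons)
  next
    case False
    then have "alt gs" and x: "(x \<in> A) \<noteq> (hd gs \<in> A)" "x \<in> L"
      using Cons.prems by (auto simp: alternating_Cons)
    then have "alt (rev (map (m_inv G) gs))" "hd gs \<in> L"
      using Cons.IH alt_letters [of gs] hd_in_set [OF False] by blast+
    with False x show ?thesis
      using inv_L [of x] inv_L [of "hd gs"]
      by (simp add: alternating_append alternating_Cons last_rev hd_map)
  qed
qed (simp add: alternating_def)

text \<open>A new letter is either prepended, or merged with the first letter. If the merged letter
  falls into \<open>B\<close>, it is absorbed by the second one. The length grows by at most
  one.\<close>

lemma mult_reduced:
  assumes a: "a \<in> A \<union> E" and g: "g \<in> B \<or> (\<exists>gs. alt gs \<and> wprod gs = g \<and> length gs \<le> n)"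
  shows "a \<otimes> g \<in> B \<or> (\<exists>gs. alt gs \<and> wprod gs = a \<otimes> g \<and> length gs \<le> Suc n)"
  using g
proof (elim disjE conjE exE)
  assume "g \<in> B"
  show ?thesis
  proof (cases "a \<in> B")
    case True
    with \<open>g \<in> B\<close> show ?thesis using subgroup.m_closed [OF subgroup_B] by auto
  next
    case False
    then have "alt [a \<otimes> g]" using a \<open>g \<in> B\<close> L_mult_B [of g a] by (simp add: alternating_Cons)
    moreover have "wprod [a \<otimes> g] = a \<otimes> g"
      using a \<open>g \<in> B\<close> AE_carrier [OF a] B_carrier by simp
    ultimately show ?thesis by (intro disjI2 exI [of _ "[a \<otimes> g]"]) simp
  qed
next
  fix gs assume gs: "alt gs" "wprod gs = g" "length gs \<le> n"
  then obtain x xs where xs: "gs = x # xs" by (cases gs) (auto simp: alternating_def)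
  have carr: "set xs \<subseteq> carrier G" "x \<in> carrier G" using alt_carrier [OF gs(1)] xs by auto
  have x: "x \<in> L" using alt_letters [OF gs(1)] xs by auto
  have ag: "a \<otimes> g = wprod ((a \<otimes> x) # xs)"
    using gs(2) xs carr AE_carrier [OF a] by (simp add: m_assoc)
  show ?thesis
  proof (cases "a \<otimes> x \<in> L \<and> (a \<otimes> x \<in> A \<longleftrightarrow> x \<in> A)")
    case True
    then have "alt ((a \<otimes> x) # xs)" using gs(1) xs by (auto simp: alternating_Cons)
    with ag gs(3) xs show ?thesis by (intro disjI2 exI [of _ "(a \<otimes> x) # xs"]) simp
  next
    case False
    then have "a \<in> L" using B_mult_L [of a x] x a by blast
    show ?thesis
    proof (cases "(a \<in> A) = (x \<in> A)")
      case True
      then have b: "a \<otimes> x \<in> B" using L_mult_L [OF \<open>a \<in> L\<close> x] False by blast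
      show ?thesis
      proof (cases xs)
        case Nil
        then show ?thesis using ag b B_carrier [OF b] by simp
      next
        case (Cons y ys)
        then have y: "y \<in> L" using alt_letters [OF gs(1)] xs by auto
        have "alt ((a \<otimes> x \<otimes> y) # ys)"
          using gs(1) xs Cons B_mult_L [OF b y] by (auto simp: alternating_Cons)
        moreover have "a \<otimes> g = wprod ((a \<otimes> x \<otimes> y) # ys)"
          using ag Cons carr AE_carrier [OF a] by (simp add: m_assoc)
        ultimately show ?thesis
          using Cons xs gs(3) by (intro disjI2 exI [of _ "(a \<otimes> x \<otimes> y) # ys"]) simp
      qed
    next
      case False
      then have "alt (a # gs)" using gs(1) xs \<open>a \<in> L\<close> by (auto simp: alternating_Cons)
      then show ?thesis using gs by (intro disjI2 exI [of _ "a # gs"]) simp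
    qed
  qed
qed

lemma wprod_reduced:
  assumes "set xs \<subseteq> A \<union> E"
  shows "wprod xs \<in> B \<or> (\<exists>gs. alt gs \<and> wprod gs = wprod xs \<and> length gs \<le> length xs)"
  using assms
proof (induction xs)
  case Nil
  then show ?case using subgroup.one_closed [OF subgroup_B] by simp
next
  case (Cons a xs)
  then show ?case using mult_reduced [of a "wprod xs" "length xs"] by simp
qed

lemma ex_alternating:
  assumes "g \<in> carrier G" "g \<notin> B"
  shows "\<exists>gs. alt gs \<and> wprod gs = g"
proof -
  have "\<exists>xs. set xs \<subseteq> A \<union> E \<and> wprod xs = g" if "g \<in> generate G (A \<union> E)" for g
    using that
  proof (induction g rule: generate.induct)
    case one
    then show ?case by (intro exI [of _ "[]"]) simp
  next
    case (incl h)
    then show ?case using AE_carrier by (intro exI [of _ "[h]"]) auto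
  next
    case (inv h)
    then have "inv h \<in> A \<union> E"
      using subgroup.m_inv_closed [OF subgroup_A] subgroup.m_inv_closed [OF subgroup_E] by blast
    then show ?case using AE_carrier by (intro exI [of _ "[inv h]"]) auto
  next
    case (eng h1 h2)
    then obtain xs ys where "set xs \<subseteq> A \<union> E" "wprod xs = h1" "set ys \<subseteq> A \<union> E" "wprod ys = h2"
      by blast
    moreover then have "set xs \<subseteq> carrier G" "set ys \<subseteq> carrier G" using AE_carrier by blast+
    ultimately show ?case
      by (intro exI [of _ "xs @ ys"]) (simp add: wprod_append del: foldr_append)
  qed
  then obtain xs where "set xs \<subseteq> A \<union> E" "wprod xs = g" using assms(1) generate_AE by metis
  with wprod_reduced [of xs] assms(2) show ?thesis by auto
qed

text \<open>Whenever the first letters do not agree up to \<open>B\<close>, the inverse of one word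
  times the other is an alternating word with product \<open>\<one>\<close>. Otherwise the
  discrepancy \<open>c\<close> moves into the next letter and the words get shorter.\<close>

lemma alternating_length_unique:
  assumes "alt gs" "alt hs" "wprod gs = wprod hs"
  shows "length gs = length hs"
  using assms
proof (induction "length gs" arbitrary: gs hs rule: less_induct)
  case less
  obtain g gs' h hs' where gs: "gs = g # gs'" and hs: "hs = h # hs'"
    using less.prems(1,2) by (metis alt_ne list.exhaust)
  have L: "g \<in> L" "h \<in> L" "set gs' \<subseteq> L" "set hs' \<subseteq> L"
    using less.prems(1,2) alt_letters gs hs by fastforce+
  then have carr: "g \<in> carrier G" "h \<in> carrier G" "set gs' \<subseteq> carrier G" "set hs' \<subseteq> carrier G"
    using L_carrier by auto
  have one: "\<one> \<in> B" using subgroup.one_closed [OF subgroup_B] .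
  \<comment> \<open>With first letters in different factors nothing cancels in the inverse of
    \<open>hs\<close> followed by \<open>gs\<close>.\<close>
  have side: "(g \<in> A) = (h \<in> A)"
  proof (rule ccontr)
    assume "\<not> ?thesis"
    then have "alt (rev (map (m_inv G) hs) @ gs)"
      using less.prems(1) alt_inv [OF less.prems(2)] inv_L [OF L(2)]
      by (subst alternating_append) (auto simp: gs hs)
    moreover have "wprod (rev (map (m_inv G) hs) @ gs) = \<one>"
      using less.prems alt_carrier by (subst wprod_append) (auto simp: wprod_inv)
    ultimately show False using alternating_notin one by metis
  qed
  define c where "c = inv h \<otimes> g"
  \<comment> \<open>If \<open>c\<close> were outside \<open>B\<close> it would be a letter of the
    same factor as \<open>g\<close> and \<open>h\<close>, joining the inverse of \<open>hs'\<close>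
    to \<open>gs'\<close> in an alternating word.\<close>
  have cB: "c \<in> B"
  proof (rule ccontr)
    assume "c \<notin> B"
    have "(inv h \<in> A) = (g \<in> A)" using inv_L(2) [OF L(2)] side by simp
    from L_mult_L [OF inv_L(1) [OF L(2)] L(1) this \<open>c \<notin> B\<close> [unfolded c_def]]
    have c: "c \<in> L" "c \<in> A \<longleftrightarrow> h \<in> A"
      unfolding c_def using inv_L(2) [OF L(2)] by (simp_all only: )
    have "alt (c # gs')" using c less.prems(1) gs side by (auto simp: alternating_Cons)
    moreover have "alt (rev (map (m_inv G) hs') @ c # gs')" if "hs' \<noteq> []"
    proof -
      have "alt hs'" "(h \<in> A) \<noteq> (hd hs' \<in> A)"
        using that less.prems(2) hs by (auto simp: alternating_Cons)
      moreover have "hd hs' \<in> L" using hd_in_set [OF that] L(4) by blast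
      moreover note that
      ultimately show ?thesis
        using alt_inv [of hs'] inv_L [of "hd hs'"] c \<open>alt (c # gs')\<close>
        by (subst alternating_append) (simp_all add: last_rev hd_map)
    qed
    ultimately have "alt (rev (map (m_inv G) hs') @ c # gs')" by (cases "hs' = []") auto
    moreover have "wprod (rev (map (m_inv G) hs') @ c # gs') = \<one>"
    proof -
      have "wprod (rev (map (m_inv G) hs') @ c # gs') = inv (wprod hs') \<otimes> (inv h \<otimes> (g \<otimes> wprod gs'))"
        using carr by (subst wprod_append) (auto simp: wprod_inv c_def m_assoc)
      also have "g \<otimes> wprod gs' = h \<otimes> wprod hs'" using less.prems(3) gs hs by simp
      finally show ?thesis using carr by (simp add: m_assoc [symmetric])
    qed
    ultimately show False using alternating_notin one by metis
  qed
  have eq: "c \<otimes> wprod gs' = wprod hs'"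
  proof -
    have "c \<otimes> wprod gs' = inv h \<otimes> (g \<otimes> wprod gs')" using carr by (simp add: c_def m_assoc)
    also have "g \<otimes> wprod gs' = h \<otimes> wprod hs'" using less.prems(3) gs hs by simp
    finally show ?thesis using carr by (simp add: m_assoc [symmetric])
  qed
  show ?case
  proof (cases gs')
    case Nil
    then have "wprod hs' \<in> B" using eq cB B_carrier [OF cB] by simp
    then have "hs' = []" using alternating_notin [of hs'] less.prems(2) hs by (auto simp: alternating_Cons)
    then show ?thesis using Nil gs hs by simp
  next
    case (Cons x xs)
    have x: "x \<in> L" "x \<in> carrier G" "set xs \<subseteq> carrier G" using Cons L carr by auto
    have alt: "alt ((c \<otimes> x) # xs)"
      using less.prems(1) gs Cons B_mult_L [OF cB x(1)] by (auto simp: alternating_Cons)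
    have eq': "wprod ((c \<otimes> x) # xs) = wprod hs'"
      using eq Cons x B_carrier [OF cB] by (simp add: m_assoc)
    have "hs' \<noteq> []"
    proof
      assume "hs' = []"
      with eq' have "wprod ((c \<otimes> x) # xs) \<in> B" using one by simp
      with alternating_notin [OF alt] show False by simp
    qed
    then have "alt hs'" using less.prems(2) hs by (auto simp: alternating_Cons)
    with less.hyps [OF _ alt this eq'] Cons gs hs show ?thesis by simp
  qed
qed

text \<open>The two adjacent letters lie in one factor and merge, which loses at least one
  letter.\<close>

lemma alternating_append_shorter:
  assumes "alt hs" "alt gs" "(last hs \<in> A) = (hd gs \<in> A)"
  shows "wprod hs \<otimes> wprod gs \<in> B \<or>
    (\<exists>ks. alt ks \<and> wprod ks = wprod hs \<otimes> wprod gs \<and> length ks < length hs + length gs)"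
proof -
  obtain hs' x where hs: "hs = hs' @ [x]" using alt_ne [OF assms(1)] by (metis rev_exhaust)
  obtain y gs' where gs: "gs = y # gs'" using alt_ne [OF assms(2)] by (metis list.exhaust)
  have L: "set hs' \<subseteq> L" "x \<in> L" "y \<in> L" "set gs' \<subseteq> L"
    using alt_letters [OF assms(1)] alt_letters [OF assms(2)] hs gs by auto
  have xy: "x \<otimes> y \<in> A \<union> E"
    using L assms(3) hs gs subgroup.m_closed [OF subgroup_A, of x y]
      subgroup.m_closed [OF subgroup_E, of x y] by auto
  have carr: "set hs' \<subseteq> carrier G" "x \<in> carrier G" "y \<in> carrier G" "set gs' \<subseteq> carrier G"
    using L L_carrier by auto
  have "wprod (hs' @ (x \<otimes> y) # gs') = wprod hs \<otimes> wprod gs"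
    using carr unfolding hs gs
    by (subst wprod_append; simp del: foldr_append add: wprod_append m_assoc)
  with wprod_reduced [of "hs' @ (x \<otimes> y) # gs'"] xy L
  have "wprod hs \<otimes> wprod gs \<in> B \<or> (\<exists>ks. alt ks \<and> wprod ks = wprod hs \<otimes> wprod gs \<and>
      length ks \<le> length (hs' @ (x \<otimes> y) # gs'))"
    by auto
  moreover have "length (hs' @ (x \<otimes> y) # gs') < length hs + length gs" by (simp add: hs gs)
  ultimately show ?thesis by (meson le_less_trans)
qed

text \<open>The product in one order is reduced of full length. If letters merged in the other
  order, the same element would also have a shorter word.\<close>

lemma commuting_ends:
  assumes "alt gs" "alt hs" "wprod gs \<otimes> wprod hs = wprod hs \<otimes> wprod gs"
    and "(last gs \<in> A) \<noteq> (hd hs \<in> A)"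
  shows "(last hs \<in> A) \<noteq> (hd gs \<in> A)"
proof
  assume eq: "(last hs \<in> A) = (hd gs \<in> A)"
  have alt: "alt (gs @ hs)"
    using assms by (subst alternating_append) (auto simp: alt_ne)
  have prod: "wprod (gs @ hs) = wprod hs \<otimes> wprod gs"
    using assms by (subst wprod_append) (auto simp: alt_carrier)
  show False
    using alternating_append_shorter [OF assms(2,1) eq]
  proof (elim disjE exE conjE)
    assume "wprod hs \<otimes> wprod gs \<in> B"
    with alternating_notin [OF alt] prod show False by simp
  next
    fix ks assume "alt ks" "wprod ks = wprod hs \<otimes> wprod gs" "length ks < length hs + length gs"
    with alternating_length_unique [OF alt, of ks] prod show False by simp
  qed
qed

text \<open>Copies of \<open>hs\<close> concatenate without cancellation. The last letter is
  recorded to keep the induction going; exponent 0 is excluded because alternating words are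
  nonempty.\<close>

lemma cyclically_alternating_pow:
  assumes "alt hs" "(last hs \<in> A) \<noteq> (hd hs \<in> A)"
  shows "\<exists>ks. alt ks \<and> last ks = last hs \<and> wprod ks = wprod hs [^] Suc n"
proof (induction n)
  case 0
  then show ?case using assms alt_carrier by (intro exI [of _ hs]) simp
next
  case (Suc n)
  then obtain ks where ks: "alt ks" "last ks = last hs" "wprod ks = wprod hs [^] Suc n" by auto
  have "alt (ks @ hs)" "last (ks @ hs) = last hs"
    using assms ks by (simp_all add: alternating_append alt_ne)
  moreover have "wprod (ks @ hs) = wprod hs [^] Suc (Suc n)"
    using assms ks by (subst wprod_append) (simp_all add: alt_carrier)
  ultimately show ?case by blast
qed

text \<open>
  Since the two ends of \<open>g\<close> lie in different factors, \<open>h\<close> multiplies one of \<open>g\<close>, \<open>g\<inverse>\<close> from the right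
  without cancellation, hence also from the left. Thus an \<open>h\<close> outside \<open>B\<close> is itself
  cyclically reduced and has infinite order.
\<close>

lemma finite_order_commuting_in_B:
  assumes gs: "alt gs" "even (length gs)"
    and h: "h \<in> carrier G" "wprod gs \<otimes> h = h \<otimes> wprod gs" "h [^] (n::nat) = \<one>" "n > 0"
  shows "h \<in> B"
proof (rule ccontr)
  assume "h \<notin> B"
  then obtain hs where hs: "alt hs" "wprod hs = h" using ex_alternating h(1) by blast
  define gs' where "gs' = rev (map (m_inv G) gs)"
  have ne: "gs \<noteq> []" using alt_ne gs by blast
  have ends: "(hd gs \<in> A) \<noteq> (last gs \<in> A)" using alternating_parity [OF gs(1)] gs(2) by auto
  have "(last hs \<in> A) \<noteq> (hd hs \<in> A)"
  proof (cases "(last gs \<in> A) = (hd hs \<in> A)")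
    case False
    with commuting_ends [OF gs(1) hs(1)] h(2) hs(2) ends show ?thesis by auto
  next
    \<comment> \<open>Now the inverse of \<open>gs\<close> is used, whose last letter lies in the
      other factor and which also commutes with \<open>h\<close>.\<close>
    case True
    have "hd gs \<in> L" "last gs \<in> L"
      using alt_letters [OF gs(1)] ne hd_in_set last_in_set by blast+
    then have ends': "last gs' \<in> A \<longleftrightarrow> hd gs \<in> A" "hd gs' \<in> A \<longleftrightarrow> last gs \<in> A"
      using inv_L ne by (simp_all add: gs'_def last_rev hd_rev hd_map last_map)
    have gs': "alt gs'" "wprod gs' = inv (wprod gs)"
      using alt_inv [OF gs(1)] wprod_inv alt_carrier [OF gs(1)] by (simp_all add: gs'_def)
    have g: "wprod gs \<in> carrier G" using alt_carrier [OF gs(1)] by simp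
    have "wprod gs' \<otimes> h = wprod gs' \<otimes> (h \<otimes> wprod gs) \<otimes> wprod gs'"
      unfolding gs' using g h(1) by (simp add: m_assoc)
    also have "\<dots> = h \<otimes> wprod gs'"
      unfolding gs' h(2) [symmetric] using g h(1) by (simp add: m_assoc [symmetric])
    finally show ?thesis using commuting_ends [OF gs'(1) hs(1)] hs(2) ends ends' True by auto
  qed
  then obtain ks where "alt ks" "wprod ks = h [^] Suc (n - 1)"
    using cyclically_alternating_pow [OF hs(1), of "n - 1"] hs(2) by auto
  then show False
    using alternating_notin [of ks] h(3,4) subgroup.one_closed [OF subgroup_B] by simp
qed

text \<open>If the conjugate \<open>y\<close> of \<open>h\<close> by the innermost letter left
  \<open>B\<close>, it would be a letter of the factor of \<open>x\<close>, and \<open>ws\<close>,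
  \<open>y\<close>, inverse of \<open>ws\<close> would form an alternating word with product in
  \<open>B\<close>. So conjugations can be peeled off letter by letter.\<close>

lemma conjugate_in_B:
  assumes alt: "alt (ws @ [x])" and h: "h \<in> B"
    and conj: "wprod (ws @ [x]) \<otimes> h \<otimes> inv (wprod (ws @ [x])) \<in> B"
  shows "x \<otimes> h \<otimes> inv x \<in> B" "wprod ws \<otimes> (x \<otimes> h \<otimes> inv x) \<otimes> inv (wprod ws) \<in> B"
proof -
  define y where "y = x \<otimes> h \<otimes> inv x"
  have x: "x \<in> L" and ws: "set ws \<subseteq> L" using alt_letters [OF alt] by auto
  have carr: "x \<in> carrier G" "set ws \<subseteq> carrier G" "h \<in> carrier G"
    using x ws h L_carrier B_carrier by blast+
  then have "y \<in> carrier G" "wprod ws \<in> carrier G" by (simp_all add: y_def)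
  note carr = carr this
  have "wprod (ws @ [x]) = wprod ws \<otimes> x" using carr by (subst wprod_append) auto
  then have "wprod (ws @ [x]) \<otimes> h \<otimes> inv (wprod (ws @ [x])) = wprod ws \<otimes> y \<otimes> inv (wprod ws)"
    using carr by (simp add: y_def inv_mult_group m_assoc)
  with conj have conj': "wprod ws \<otimes> y \<otimes> inv (wprod ws) \<in> B" by simp
  then show "wprod ws \<otimes> (x \<otimes> h \<otimes> inv x) \<otimes> inv (wprod ws) \<in> B" by (simp add: y_def)
  show "x \<otimes> h \<otimes> inv x \<in> B"
  proof (rule ccontr)
    assume "x \<otimes> h \<otimes> inv x \<notin> B"
    then have "y \<notin> B" by (simp add: y_def)
    have "x \<in> A \<Longrightarrow> y \<in> A" "x \<in> E \<Longrightarrow> y \<in> E"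
      using h unfolding y_def
      by (blast intro: subgroup.m_closed [OF subgroup_A] subgroup.m_inv_closed [OF subgroup_A]
          subgroup.m_closed [OF subgroup_E] subgroup.m_inv_closed [OF subgroup_E])+
    with \<open>y \<notin> B\<close> x have y: "y \<in> L" "y \<in> A \<longleftrightarrow> x \<in> A" by auto
    show False
    proof (cases "ws = []")
      case True
      with conj' carr \<open>y \<notin> B\<close> show False by simp
    next
      case False
      then have ws': "alt ws" "(last ws \<in> A) \<noteq> (x \<in> A)" using alt by (auto simp: alternating_append)
      have "last ws \<in> L" using ws last_in_set [OF False] by blast
      then have "alt (y # rev (map (m_inv G) ws))"
        using alt_inv [OF ws'(1)] ws'(2) y False inv_L [OF \<open>last ws \<in> L\<close>]
        by (simp add: alternating_Cons hd_rev last_map)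
      then have "alt (ws @ y # rev (map (m_inv G) ws))"
        using ws' y False by (subst alternating_append) auto
      moreover have "wprod (ws @ y # rev (map (m_inv G) ws)) = wprod ws \<otimes> y \<otimes> inv (wprod ws)"
        using carr by (subst wprod_append) (auto simp: wprod_inv m_assoc)
      ultimately show False using alternating_notin conj' by metis
    qed
  qed
qed

end

section \<open>The structure of the automorphism group\<close>

lemma degree_Const_mult: "c \<noteq> 0 \<Longrightarrow> degree (Const c * p) = degree p"
  for c :: "'a::field"
  by (simp add: Const_def)

lemma degree_Const_mult_le: "degree (Const c * p) \<le> degree p"
  for c :: "'a::field"
  by (simp add: Const_def)

lemma degree_Const [simp]: "degree (Const c) = 0"
  by (simp add: Const_def)

lemma degree_psubst_inY: "degree (psubst (inY P) F) = degree P * degree (snd F)"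
proof -
  have "map_poly Const P = map_poly (\<lambda>c. [:c:]) (inY P)"
    by (rule poly_eqI) (simp add: coeff_map_poly Const_def)
  then have "psubst (inY P) F = pcompose (inY P) (snd F)"
    by (simp add: psubst_inY pcompose_altdef)
  then show ?thesis by (simp add: degree_pcompose degree_map_poly)
qed

text \<open>As \<open>P\<close> has degree at least 2, \<open>P\<close> of the second component has
  at least twice its degree and dominates the first component.\<close>

lemma degree_comp_elementary:
  assumes "g \<in> Elem - Bor" "degree (fst F) \<le> degree (snd F)" "1 \<le> degree (snd F)"
  shows "degree (snd (polymap_comp g F)) = degree (snd F)"
    "degree (snd F) < degree (fst (polymap_comp g F))"
proof -
  obtain \<alpha> P \<beta> v where g: "g = elementary_polymap \<alpha> P \<beta> v" "\<alpha> \<noteq> 0" "\<beta> \<noteq> 0" "degree P \<ge> 2"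
    using assms(1) by (rule Elem_minus_BorE)
  have comp: "fst (polymap_comp g F) = Const \<alpha> * fst F + psubst (inY P) F"
    "snd (polymap_comp g F) = Const \<beta> * snd F + Const v"
    by (simp_all add: g(1) polymap_comp_def elementary_polymap_def psubst_add psubst_mult)
  show "degree (snd (polymap_comp g F)) = degree (snd F)"
    unfolding comp using g assms(3) by (subst degree_add_eq_left) (simp_all add: degree_Const_mult)
  have "2 * degree (snd F) \<le> degree (psubst (inY P) F)"
    unfolding degree_psubst_inY using g(4) by (rule mult_le_mono1)
  moreover from this have "degree (Const \<alpha> * fst F) < degree (psubst (inY P) F)"
    using assms(2,3) g by (simp add: degree_Const_mult)
  ultimately show "degree (snd F) < degree (fst (polymap_comp g F))"
    unfolding comp using assms(3) by (subst degree_add_eq_right) simp_all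
qed

text \<open>The nonzero lower left entry carries the dominant first component into the
  second.\<close>

lemma degree_comp_affine:
  assumes "g \<in> Aff - Bor" "degree (snd F) < degree (fst F)"
  shows "degree (snd (polymap_comp g F)) = degree (fst F)"
    "degree (fst (polymap_comp g F)) \<le> degree (fst F)"
proof -
  obtain M a where g: "g = affine_polymap M a" "M $ 2 $ 1 \<noteq> 0"
    using assms(1) by (rule Aff_minus_BorE)
  have comp: "fst (polymap_comp g F) = Const (M $ 1 $ 1) * fst F + Const (M $ 1 $ 2) * snd F + Const (a $ 1)"
    "snd (polymap_comp g F) = Const (M $ 2 $ 1) * fst F + (Const (M $ 2 $ 2) * snd F + Const (a $ 2))"
    by (simp_all add: g(1) polymap_comp_def affine_polymap_def psubst_add psubst_mult)
  show "degree (fst (polymap_comp g F)) \<le> degree (fst F)"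
    unfolding comp using assms(2) degree_Const_mult_le [of "M $ 1 $ 1" "fst F"]
      degree_Const_mult_le [of "M $ 1 $ 2" "snd F"]
    by (intro degree_add_le) auto
  have "degree (Const (M $ 2 $ 2) * snd F + Const (a $ 2)) \<le> degree (snd F)"
    using degree_Const_mult_le by (intro degree_add_le) auto
  then have "degree (Const (M $ 2 $ 2) * snd F + Const (a $ 2)) < degree (Const (M $ 2 $ 1) * fst F)"
    using assms(2) g(2) by (simp add: degree_Const_mult)
  then show "degree (snd (polymap_comp g F)) = degree (fst F)"
    unfolding comp using g(2) by (subst degree_add_eq_left) (simp_all add: degree_Const_mult)
qed

text \<open>Starting from the degrees 0 and 1 of \<open>(X, Y)\<close>, elementary letters make the
  first component strictly dominant, and affine letters give the second one at least the degree of
  the first. In both cases some component has degree at least 2.\<close>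

lemma degree_alternating:
  fixes gs :: "'a::field polymap list"
  assumes "alternating Aff Elem gs" "last gs \<notin> Aff"
  defines "F \<equiv> \<lambda>gs. foldr polymap_comp gs (X, Y)"
  shows "if hd gs \<in> Aff then degree (fst (F gs)) \<le> degree (snd (F gs)) \<and> 2 \<le> degree (snd (F gs))
     else degree (snd (F gs)) < degree (fst (F gs)) \<and> 1 \<le> degree (snd (F gs))"
  using assms(1,2)
proof (induction gs)
  case Nil
  then show ?case by (simp add: alternating_def)
next
  case (Cons x xs)
  show ?case
  proof (cases "xs = []")
    case True
    with Cons.prems have x: "x \<in> Elem - Bor" "x \<notin> Aff" by (auto simp: alternating_Cons Bor_def)
    have "degree (fst (X, Y :: 'a poly poly)) \<le> degree (snd (X, Y))" "1 \<le> degree (snd (X, Y :: 'a poly poly))"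
      by (simp_all add: X_def Y_def)
    from degree_comp_elementary [OF x(1) this] x(2) True show ?thesis by (simp add: F_def Y_def)
  next
    case False
    then have xs: "alternating Aff Elem xs" "last xs \<notin> Aff" "(x \<in> Aff) \<noteq> (hd xs \<in> Aff)"
      and x: "x \<in> Aff - Bor \<or> x \<in> Elem - Bor \<and> x \<notin> Aff"
      using Cons.prems by (auto simp: alternating_Cons Bor_def)
    have F: "F (x # xs) = polymap_comp x (F xs)" by (simp add: F_def)
    show ?thesis
    proof (cases "x \<in> Aff")
      case True
      then have "degree (snd (F xs)) < degree (fst (F xs)) \<and> 1 \<le> degree (snd (F xs))"
        using Cons.IH xs by auto
      with True degree_comp_affine [of x "F xs"] x show ?thesis by (auto simp: F Bor_def)
    next
      case False
      then have "degree (fst (F xs)) \<le> degree (snd (F xs)) \<and> 2 \<le> degree (snd (F xs))"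
        using Cons.IH xs by auto
      with False degree_comp_elementary [of x "F xs"] x show ?thesis by (auto simp: F)
    qed
  qed
qed

lemma degree_Aff:
  assumes "g \<in> Aff"
  shows "degree (fst g) \<le> 1" "degree (snd g) \<le> 1"
proof -
  obtain M a where g: "g = affine_polymap M a" using assms unfolding Aff_def by blast
  have "degree (Const p * X + Const q * Y + Const r) \<le> 1" for p q r :: 'a
    using degree_Const_mult_le [of p X] degree_Const_mult_le [of q Y]
    by (intro degree_add_le) (auto simp: X_def Y_def)
  then show "degree (fst g) \<le> 1" "degree (snd g) \<le> 1" by (simp_all add: g affine_polymap_def)
qed

lemma alternating_last_Elem_notin_Aff:
  fixes gs :: "'a::field polymap list"
  assumes "alternating Aff Elem gs" "last gs \<notin> Aff"
  shows "foldr polymap_comp gs (X, Y) \<notin> Aff"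
proof
  assume "foldr polymap_comp gs (X, Y) \<in> Aff"
  from degree_Aff [OF this] degree_alternating [OF assms] show False by (auto split: if_splits)
qed

section \<open>The amalgamated product structure\<close>

lemma polymap_comp_assoc: "polymap_comp (polymap_comp f g) h = polymap_comp f (polymap_comp g h)"
  by (simp add: polymap_comp_def psubst_psubst)

lemma comp_closed: "F \<in> carrier GA2 \<Longrightarrow> G \<in> carrier GA2 \<Longrightarrow> polymap_comp F G \<in> carrier GA2"
  for F :: "'a::field polymap"
  using GA2.m_closed [of F G] by simp

lemma id_closed: "(X, Y) \<in> (carrier GA2 :: 'a::field polymap set)"
  using GA2.one_closed by simp

lemma foldr_comp_append: "foldr polymap_comp (gs @ [g]) (X, Y) = polymap_comp (foldr polymap_comp gs (X, Y)) g"
proof (induction gs)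
  case Nil
  show ?case by (simp add: polymap_comp_def)
next
  case (Cons a gs)
  then show ?case by (simp add: polymap_comp_assoc)
qed

interpretation GA2: amalgam "GA2 :: 'a::field_char_0 polymap monoid" Aff Elem
proof (intro amalgam.intro amalgam_axioms.intro)
  show "group (GA2 :: 'a polymap monoid)" by (rule group_GA2)
  show "subgroup Aff (GA2 :: 'a polymap monoid)" "subgroup Elem (GA2 :: 'a polymap monoid)"
    by (rule subgroup_Aff subgroup_Elem)+
  show "generate GA2 (Aff \<union> Elem) = (carrier GA2 :: 'a polymap set)" by (rule generate_GA2)
  fix gs :: "'a polymap list"
  assume alt: "alternating Aff Elem gs"
  have "foldr polymap_comp gs (X, Y) \<notin> Aff \<inter> Elem"
  proof (cases "last gs \<in> Aff")
    case False
    then show ?thesis using alternating_last_Elem_notin_Aff [OF alt] by simp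
  next
    \<comment> \<open>An affine innermost letter is split off; the rest is not affine, and right
      multiplication by an affine map cannot change that.\<close>
    case True
    obtain hs a where gs: "gs = hs @ [a]" using alt by (metis alternating_def rev_exhaust)
    with True have a: "a \<in> Aff" by simp
    show ?thesis
    proof (cases "hs = []")
      case True
      with alt gs show ?thesis by (auto simp: alternating_Cons polymap_comp_def)
    next
      case False
      have "last hs \<notin> Aff" "alternating Aff Elem hs"
        using alt a False by (auto simp: gs alternating_append)
      then have "foldr polymap_comp hs (X, Y) \<notin> Aff" by (rule alternating_last_Elem_notin_Aff [rotated])
      moreover have "foldr polymap_comp hs (X, Y) \<in> carrier GA2"
      proof -
        have "set hs \<subseteq> carrier GA2"
          using alt subgroup.subset [OF subgroup_Aff] subgroup.subset [OF subgroup_Elem]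
          by (fastforce simp: gs alternating_def)
        then show ?thesis
          by (induction hs) (simp_all add: comp_closed id_closed)
      qed
      ultimately show ?thesis
        using GA2.subgroup_mult_right_iff [OF subgroup_Aff a] by (simp add: gs foldr_comp_append del: foldr_append)
    qed
  qed
  then show "foldr (\<otimes>\<^bsub>GA2\<^esub>) gs \<one>\<^bsub>GA2\<^esub> \<notin> Aff \<inter> Elem" by simp
qed

lemma normal_form_iff:
  "normal_form gs g \<longleftrightarrow> alternating Aff Elem gs \<and> g = foldr (mult GA2) gs \<one>\<^bsub>GA2\<^esub>"
  for g :: "'a::field polymap"
proof -
  have eq: "(Aff - Bor) \<union> (Elem - Bor) = (Aff \<union> Elem) - (Aff \<inter> Elem :: 'a polymap set)"
    by (auto simp: Bor_def)
  have "successively (\<lambda>u v. (u \<in> Aff - Bor \<and> v \<in> Elem - Bor) \<or> (u \<in> Elem - Bor \<and> v \<in> Aff - Bor)) gs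
     \<longleftrightarrow> successively (\<lambda>u v. (u \<in> Aff) \<noteq> (v \<in> Aff)) gs"
    if "set gs \<subseteq> (Aff \<union> Elem) - (Aff \<inter> Elem)"
    using that by (intro successively_cong) (auto simp: Bor_def)
  then show ?thesis unfolding normal_form_def alternating_def eq by blast
qed

text \<open>All normal forms of an element have the same length, so the definite description in
  \<open>len\<close> denotes it.\<close>

lemma len_alternating:
  fixes gs :: "'a::field_char_0 polymap list"
  assumes "alternating Aff Elem gs"
  shows "len (foldr (mult GA2) gs \<one>\<^bsub>GA2\<^esub>) = length gs"
proof -
  have "foldr (mult GA2) gs \<one>\<^bsub>GA2\<^esub> \<notin> Bor"
    using GA2.alternating_notin [OF assms] by (simp add: Bor_def)
  then show ?thesis
    unfolding len_def normal_form_iff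
    using assms by (auto intro!: the_equality dest: GA2.alternating_length_unique [OF assms])
qed

lemma cyclically_reduced_word:
  fixes g :: "'a::field_char_0 polymap"
  assumes "cyclically_reduced g"
  obtains gs where "alternating Aff Elem gs" "even (length gs)" "g = foldr (mult GA2) gs \<one>\<^bsub>GA2\<^esub>"
proof -
  have "g \<in> carrier GA2" "g \<notin> Bor" using assms by (auto simp: cyclically_reduced_def len_def)
  then obtain gs where gs: "alternating Aff Elem gs" "foldr (mult GA2) gs \<one>\<^bsub>GA2\<^esub> = g"
    using GA2.ex_alternating [of g] unfolding Bor_def by blast
  moreover have "even (length gs)"
    using assms len_alternating [OF gs(1)] gs(2) by (simp add: cyclically_reduced_def)
  ultimately show thesis using that by blast
qed

section \<open>Triangular affine maps fixing a long segment\<close>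

lemma elementary_inj:
  assumes "elementary_polymap \<alpha> P \<beta> v = elementary_polymap \<alpha>' P' \<beta>' v'"
  shows "\<alpha> = \<alpha>'" "P = P'" "\<beta> = \<beta>'" "v = v'"
proof -
  have 1: "coeff (coeff (Const \<alpha> * X + inY P) j) i = coeff (coeff (Const \<alpha>' * X + inY P') j) i"
    and 2: "coeff (coeff (Const \<beta> * Y + Const v) j) i = coeff (coeff (Const \<beta>' * Y + Const v') j) i" for i j
    using assms by (simp_all add: elementary_polymap_def)
  show \<alpha>: "\<alpha> = \<alpha>'"
    using 1 [where i=1 and j=0] by (simp add: Const_def coeff_coeff_X coeff_inY)
  show "\<beta> = \<beta>'" "v = v'"
    using 2 [where i=0 and j=1] 2 [where i=0 and j=0] by (simp_all add: Const_def coeff_coeff_Y)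
  have "coeff P j = coeff P' j" for j
    using 1 [where i=0 and j=j] by (simp add: Const_def coeff_coeff_X coeff_inY \<alpha>)
  then show "P = P'" by (rule poly_eqI)
qed

lemma affine_inj:
  assumes "affine_polymap M a = affine_polymap M' a'"
  shows "M = M'" "a = a'"
proof -
  have *: "p = p'" "q = q'" "r = r'"
    if "Const p * X + Const q * Y + Const r = Const p' * X + Const q' * Y + Const r'" for p q r p' q' r' :: 'a
  proof -
    have "coeff (coeff (Const p * X + Const q * Y + Const r) j) i =
        coeff (coeff (Const p' * X + Const q' * Y + Const r') j) i" for i j
      using that by simp
    from this [where i=1 and j=0] this [where i=0 and j=1] this [where i=0 and j=0]
    show "p = p'" "q = q'" "r = r'" by (simp_all add: Const_def coeff_coeff_X coeff_coeff_Y)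
  qed
  have "fst (affine_polymap M a) = fst (affine_polymap M' a')"
    "snd (affine_polymap M a) = snd (affine_polymap M' a')" using assms by simp_all
  note eq = this [unfolded affine_polymap_def fst_conv snd_conv]
  show "M = M'" using * [OF eq(1)] * [OF eq(2)] by (simp add: vec_eq_iff forall_2)
  show "a = a'" using * [OF eq(1)] * [OF eq(2)] by (simp add: vec_eq_iff forall_2)
qed

text \<open>If \<open>v\<close> were nonzero, \<open>P\<close> would agree with a polynomial of
  degree at most 1 at all multiples \<open>n v\<close>, which are infinitely many in characteristic
  0.\<close>

lemma pcompose_shift_const:
  fixes P :: "'a::field_char_0 poly"
  assumes eq: "pcompose P [:v, 1:] = P + [:k:]" and deg: "degree P \<ge> 2"
  shows "v = 0"
proof (rule ccontr)
  assume "v \<noteq> 0"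
  have step: "poly P (x + v) = poly P x + k" for x
    using arg_cong [OF eq, of "\<lambda>p. poly p x"] by (simp add: poly_pcompose add.commute)
  have "poly P (of_nat n * v) = poly P 0 + of_nat n * k" for n
  proof (induction n)
    case (Suc n)
    then show ?case using step [of "of_nat n * v"] by (simp add: algebra_simps)
  qed simp
  then have "range (\<lambda>n. of_nat n * v) \<subseteq> {x. poly (P - [:poly P 0, k / v:]) x = 0}"
    using \<open>v \<noteq> 0\<close> by auto
  moreover have "inj (\<lambda>n::nat. of_nat n * v)" using \<open>v \<noteq> 0\<close> by (auto simp: inj_def)
  then have "infinite (range (\<lambda>n::nat. of_nat n * v))" by (rule range_inj_infinite)
  ultimately have "P - [:poly P 0, k / v:] = 0" using poly_roots_finite finite_subset by blast
  then have "P = [:poly P 0, k / v:]" by simp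
  then have "degree P \<le> 1" by (metis degree_pCons_le degree_pCons_0 One_nat_def)
  with deg show False by simp
qed

text \<open>The equation says that the second triangular map is the conjugate of the first by
  \<open>e\<close>. Comparing coefficients at the top power of \<open>P\<close> gives the power
  relation; for a translation, \<open>P(y + v)\<close> differs from \<open>P(y)\<close> by a
  constant, which forces \<open>v = 0\<close>.\<close>

lemma elementary_step:
  fixes e :: "'a::field_char_0 polymap"
  assumes e: "e \<in> Elem - Bor" and \<beta>: "\<beta> \<noteq> 0"
    and eq: "polymap_comp e (elementary_polymap \<alpha> [:d, c:] \<beta> v) =
      polymap_comp (elementary_polymap \<alpha>' [:d', c':] \<beta>' v') e"
  shows "\<exists>m. \<alpha> = \<beta> ^ m" "\<alpha>' = \<alpha>" "\<beta>' = \<beta>"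
    "\<alpha> = 1 \<Longrightarrow> \<beta> = 1 \<Longrightarrow> c = 0 \<Longrightarrow> c' = 0 \<Longrightarrow> v = 0 \<and> v' = 0 \<and> (\<exists>\<kappa>. \<kappa> \<noteq> 0 \<and> d' = \<kappa> * d)"
proof -
  obtain a P b w where g: "e = elementary_polymap a P b w" "a \<noteq> 0" "b \<noteq> 0" "degree P \<ge> 2"
    using e by (rule Elem_minus_BorE)
  note inj = elementary_inj [OF eq [unfolded g(1) comp_elementary]]
  show \<alpha>': "\<alpha>' = \<alpha>" and \<beta>': "\<beta>' = \<beta>" using inj(1,3) g by simp_all
  have P: "smult a [:d, c:] + pcompose P [:v, \<beta>:] = smult \<alpha> P + [:d' + w * c', b * c':]"
    using inj(2) \<alpha>' by (simp add: pcompose_pCons)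
  have "coeff (pcompose P [:v, \<beta>:]) (degree P) = lead_coeff P * \<beta> ^ degree P"
    using lead_coeff_comp [of "[:v, \<beta>:]" P] \<beta> by (simp add: degree_pcompose)
  moreover have "coeff [:x, y:] (degree P) = 0" for x y :: 'a
    using g(4) by (intro coeff_eq_0) auto
  ultimately have "lead_coeff P * \<beta> ^ degree P = \<alpha> * lead_coeff P"
    using arg_cong [OF P, of "\<lambda>p. coeff p (degree P)"] by (simp del: coeff_pCons)
  moreover have "lead_coeff P \<noteq> 0" using g(4) by auto
  ultimately show "\<exists>m. \<alpha> = \<beta> ^ m" by (auto simp: mult.commute)
  assume 1: "\<alpha> = 1" "\<beta> = 1" "c = 0" "c' = 0"
  then have "[:a * d:] + pcompose P [:v, 1:] = P + [:d':]"
    using P by (simp add: algebra_simps)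
  then have "pcompose P [:v, 1:] = P + ([:d':] - [:a * d:])" by (simp only: algebra_simps)
  then have "pcompose P [:v, 1:] = P + [:d' - a * d:]" by simp
  then have v: "v = 0" using g(4) by (rule pcompose_shift_const)
  have "v' = 0" using inj(4) 1 \<beta>' v by simp
  moreover have "d' = a * d" using P 1 v by simp
  ultimately show "v = 0 \<and> v' = 0 \<and> (\<exists>\<kappa>. \<kappa> \<noteq> 0 \<and> d' = \<kappa> * d)" using v g(2) by blast
qed

text \<open>The lower left entry of the matrix equation yields \<open>\<beta>' = \<alpha>\<close>,
  and determinants then yield \<open>\<alpha>' = \<beta>\<close>. For equal eigenvalues the
  remaining entries force both shears to vanish.\<close>

lemma affine_step:
  fixes a :: "'a::field polymap"
  assumes a: "a \<in> Aff - Bor" and \<alpha>: "\<alpha> \<noteq> 0"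
    and eq: "polymap_comp a (elementary_polymap \<alpha> [:d, c:] \<beta> v) =
      polymap_comp (elementary_polymap \<alpha>' [:d', c':] \<beta>' v') a"
  shows "\<alpha>' = \<beta>" "\<beta>' = \<alpha>" "\<alpha> = \<beta> \<Longrightarrow> c = 0 \<and> c' = 0"
    "\<alpha> = 1 \<Longrightarrow> v = 0 \<Longrightarrow> \<exists>\<kappa>. \<kappa> \<noteq> 0 \<and> v' = \<kappa> * d"
proof -
  obtain M t where g: "a = affine_polymap M t" "invertible M" "M $ 2 $ 1 \<noteq> 0"
    using a by (rule Aff_minus_BorE)
  note inj = affine_inj [OF eq [unfolded g(1) elementary_linear comp_affine]]
  have M: "M $ 1 $ 1 * \<alpha> = \<alpha>' * M $ 1 $ 1 + c' * M $ 2 $ 1"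
    "M $ 1 $ 1 * c + M $ 1 $ 2 * \<beta> = \<alpha>' * M $ 1 $ 2 + c' * M $ 2 $ 2"
    "M $ 2 $ 1 * \<alpha> = \<beta>' * M $ 2 $ 1" "M $ 2 $ 1 * c + M $ 2 $ 2 * \<beta> = \<beta>' * M $ 2 $ 2"
    using inj(1) by (simp_all add: vec_eq_iff forall_2 matrix_matrix_mult_def sum_2)
  have t: "M $ 2 $ 1 * d + M $ 2 $ 2 * v + t $ 2 = \<beta>' * t $ 2 + v'"
    using inj(2) by (simp add: vec_eq_iff forall_2 matrix_vector_mult_def sum_2)
  show \<beta>': "\<beta>' = \<alpha>" using M(3) g(3) by simp
  have "det (vector [vector [\<alpha>, c], vector [0, \<beta>]] :: 'a^2^2) = \<alpha> * \<beta>"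
    "det (vector [vector [\<alpha>', c'], vector [0, \<beta>']] :: 'a^2^2) = \<alpha>' * \<beta>'"
    by (simp_all add: det_2)
  then have "det M * (\<alpha> * \<beta>) = (\<alpha>' * \<beta>') * det M"
    using arg_cong [OF inj(1), of det] by (simp only: det_mul)
  moreover have "det M \<noteq> 0" using g(2) by (simp add: invertible_det_nz)
  ultimately show \<alpha>': "\<alpha>' = \<beta>" using \<beta>' \<alpha> by simp
  show "c = 0 \<and> c' = 0" if "\<alpha> = \<beta>"
    using M(1,4) \<alpha>' \<beta>' that g(3) by simp
  show "\<exists>\<kappa>. \<kappa> \<noteq> 0 \<and> v' = \<kappa> * d" if "\<alpha> = 1" "v = 0"
    using t \<beta>' that g(3) by auto
qed

text \<open>Turns a conjugate inside \<open>Bor\<close> into an equation of compositions, whose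
  coefficients can be compared.\<close>

lemma Bor_conjugate:
  fixes x :: "'a::field polymap"
  assumes "x \<in> carrier GA2" "h \<in> carrier GA2" "x \<otimes>\<^bsub>GA2\<^esub> h \<otimes>\<^bsub>GA2\<^esub> inv\<^bsub>GA2\<^esub> x \<in> Bor"
  obtains \<alpha> c d \<beta> v where "x \<otimes>\<^bsub>GA2\<^esub> h \<otimes>\<^bsub>GA2\<^esub> inv\<^bsub>GA2\<^esub> x = elementary_polymap \<alpha> [:d, c:] \<beta> v"
    "\<alpha> \<noteq> 0" "\<beta> \<noteq> 0"
    "polymap_comp x h = polymap_comp (elementary_polymap \<alpha> [:d, c:] \<beta> v) x"
proof -
  obtain \<alpha> c d \<beta> v where h': "x \<otimes>\<^bsub>GA2\<^esub> h \<otimes>\<^bsub>GA2\<^esub> inv\<^bsub>GA2\<^esub> x = elementary_polymap \<alpha> [:d, c:] \<beta> v"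
    "\<alpha> \<noteq> 0" "\<beta> \<noteq> 0"
    using assms(3) by (rule BorE)
  have "x \<otimes>\<^bsub>GA2\<^esub> h = (x \<otimes>\<^bsub>GA2\<^esub> h \<otimes>\<^bsub>GA2\<^esub> inv\<^bsub>GA2\<^esub> x) \<otimes>\<^bsub>GA2\<^esub> x"
    using assms(1,2) by (simp add: GA2.m_assoc del: mult_GA2 one_GA2)
  with h' have "polymap_comp x h = polymap_comp (elementary_polymap \<alpha> [:d, c:] \<beta> v) x" by simp
  with h' that show thesis by blast
qed

text \<open>
  \<open>h\<close> fixes the segment of the Bass--Serre tree spelled by the last four letters. Each pair of
  letters exchanges the two eigenvalues, and each elementary letter makes one of them a power of
  the other.
\<close>

lemma segment_stabilizer:
  fixes h :: "'a::field_char_0 polymap"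
  assumes alt: "alternating Aff Elem (ws @ [a', e', a, e])" and e: "e \<notin> Aff"
    and h: "elementary_polymap \<alpha> [:d, c:] \<beta> v \<in> Bor" "h = elementary_polymap \<alpha> [:d, c:] \<beta> v"
    and \<alpha>\<beta>: "\<alpha> \<noteq> 0" "\<beta> \<noteq> 0"
    and comm: "foldr (mult GA2) (ws @ [a', e', a, e]) \<one>\<^bsub>GA2\<^esub> \<otimes>\<^bsub>GA2\<^esub> h =
      h \<otimes>\<^bsub>GA2\<^esub> foldr (mult GA2) (ws @ [a', e', a, e]) \<one>\<^bsub>GA2\<^esub>"
  shows "\<exists>m. \<alpha> = \<beta> ^ m" "\<exists>m. \<beta> = \<alpha> ^ m"
    "\<alpha> = 1 \<Longrightarrow> \<beta> = 1 \<Longrightarrow> c = 0 \<Longrightarrow> v = 0 \<and> d = 0"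
proof -
  have B: "h \<in> Aff \<inter> Elem" using h by (simp add: Bor_def)
  have hc: "h \<in> carrier GA2" using GA2.B_carrier [OF B] .
  define w where "w = foldr (mult GA2) (ws @ [a', e', a, e]) \<one>\<^bsub>GA2\<^esub>"
  have wc: "w \<in> carrier GA2" unfolding w_def using GA2.alt_carrier [OF alt] by (rule GA2.wprod_closed)
  have "w \<otimes>\<^bsub>GA2\<^esub> h \<otimes>\<^bsub>GA2\<^esub> inv\<^bsub>GA2\<^esub> w = h"
    using comm [folded w_def] wc hc by (simp add: GA2.m_assoc del: mult_GA2 one_GA2)
  with B have 0: "w \<otimes>\<^bsub>GA2\<^esub> h \<otimes>\<^bsub>GA2\<^esub> inv\<^bsub>GA2\<^esub> w \<in> Aff \<inter> Elem" by simp
  have split: "ws @ [a', e', a, e] = (ws @ [a', e', a]) @ [e]" "ws @ [a', e', a] = (ws @ [a', e']) @ [a]"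
    "ws @ [a', e'] = (ws @ [a']) @ [e']" by simp_all
  have alts: "alternating Aff Elem ((ws @ [a', e', a]) @ [e])" "alternating Aff Elem ((ws @ [a', e']) @ [a])"
    "alternating Aff Elem ((ws @ [a']) @ [e'])" "alternating Aff Elem (ws @ [a'])"
    using alt alternating_append [of "ws @ [a', e', a]" "[e]" Aff Elem]
      alternating_append [of "ws @ [a', e']" "[a, e]" Aff Elem]
      alternating_append [of "ws @ [a']" "[e', a, e]" Aff Elem] by simp_all
  have "alternating Aff Elem [a', e', a, e]"
    using alt by (cases "ws = []") (auto simp: alternating_append)
  then have letters: "e \<in> Elem - Bor" "a \<in> Aff - Bor" "e' \<in> Elem - Bor" "a' \<in> Aff - Bor"
    using e by (auto simp: alternating_Cons Bor_def)
  then have carr: "e \<in> carrier GA2" "a \<in> carrier GA2" "e' \<in> carrier GA2" "a' \<in> carrier GA2"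
    using GA2.AE_carrier by blast+
  define h1 where "h1 = e \<otimes>\<^bsub>GA2\<^esub> h \<otimes>\<^bsub>GA2\<^esub> inv\<^bsub>GA2\<^esub> e"
  define h2 where "h2 = a \<otimes>\<^bsub>GA2\<^esub> h1 \<otimes>\<^bsub>GA2\<^esub> inv\<^bsub>GA2\<^esub> a"
  define h3 where "h3 = e' \<otimes>\<^bsub>GA2\<^esub> h2 \<otimes>\<^bsub>GA2\<^esub> inv\<^bsub>GA2\<^esub> e'"
  define h4 where "h4 = a' \<otimes>\<^bsub>GA2\<^esub> h3 \<otimes>\<^bsub>GA2\<^esub> inv\<^bsub>GA2\<^esub> a'"
  \<comment> \<open>The conjugates by the right segments of the word are shown to stay in
    \<open>B\<close>, one letter at a time.\<close>
  note 1 = GA2.conjugate_in_B [OF alts(1) B, folded h1_def, OF 0 [unfolded w_def split(1)]]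
  note 2 = GA2.conjugate_in_B [OF alts(2) 1(1), folded h2_def, OF 1(2) [unfolded split(2)]]
  note 3 = GA2.conjugate_in_B [OF alts(3) 2(1), folded h3_def, OF 2(2) [unfolded split(3)]]
  note 4 = GA2.conjugate_in_B [OF alts(4) 3(1), folded h4_def, OF 3(2)]
  obtain \<alpha>1 c1 d1 \<beta>1 v1 where h1: "h1 = elementary_polymap \<alpha>1 [:d1, c1:] \<beta>1 v1" "\<alpha>1 \<noteq> 0" "\<beta>1 \<noteq> 0"
    "polymap_comp e h = polymap_comp (elementary_polymap \<alpha>1 [:d1, c1:] \<beta>1 v1) e"
    using Bor_conjugate [OF carr(1) hc] 1(1) unfolding h1_def Bor_def by metis
  have h1c: "h1 \<in> carrier GA2" using GA2.B_carrier [OF 1(1)] .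
  obtain \<alpha>2 c2 d2 \<beta>2 v2 where h2: "h2 = elementary_polymap \<alpha>2 [:d2, c2:] \<beta>2 v2" "\<alpha>2 \<noteq> 0" "\<beta>2 \<noteq> 0"
    "polymap_comp a h1 = polymap_comp (elementary_polymap \<alpha>2 [:d2, c2:] \<beta>2 v2) a"
    using Bor_conjugate [OF carr(2) h1c] 2(1) unfolding h2_def Bor_def by metis
  have h2c: "h2 \<in> carrier GA2" using GA2.B_carrier [OF 2(1)] .
  obtain \<alpha>3 c3 d3 \<beta>3 v3 where h3: "h3 = elementary_polymap \<alpha>3 [:d3, c3:] \<beta>3 v3" "\<alpha>3 \<noteq> 0" "\<beta>3 \<noteq> 0"
    "polymap_comp e' h2 = polymap_comp (elementary_polymap \<alpha>3 [:d3, c3:] \<beta>3 v3) e'"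
    using Bor_conjugate [OF carr(3) h2c] 3(1) unfolding h3_def Bor_def by metis
  have h3c: "h3 \<in> carrier GA2" using GA2.B_carrier [OF 3(1)] .
  obtain \<alpha>4 c4 d4 \<beta>4 v4 where h4:
    "polymap_comp a' h3 = polymap_comp (elementary_polymap \<alpha>4 [:d4, c4:] \<beta>4 v4) a'"
    using Bor_conjugate [OF carr(4) h3c] 4(1) unfolding h4_def Bor_def by metis
  note s1 = elementary_step [OF letters(1) \<alpha>\<beta>(2) h1(4) [unfolded h(2)]]
  note s2 = affine_step [OF letters(2) h1(2) h2(4) [unfolded h1(1)]]
  note s3 = elementary_step [OF letters(3) h2(3) h3(4) [unfolded h2(1)]]
  note s4 = affine_step [OF letters(4) h3(2) h4 [unfolded h3(1)]]
  show "\<exists>m. \<alpha> = \<beta> ^ m" by (rule s1(1))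
  \<comment> \<open>The letter \<open>a\<close> has exchanged the eigenvalues, so at
    \<open>e'\<close> the power relation holds with their roles reversed.\<close>
  show "\<exists>m. \<beta> = \<alpha> ^ m" using s3(1) s2(1,2) s1(2,3) by simp
  assume hyp: "\<alpha> = 1" "\<beta> = 1" "c = 0"
  \<comment> \<open>The letter \<open>a\<close> removes the shears \<open>c1\<close>,
    \<open>c2\<close>, and the fourth letter \<open>a'\<close> removes \<open>c3\<close>, as the
    translation argument at \<open>e'\<close> requires.\<close>
  then have c: "c1 = 0" "c2 = 0" "c3 = 0"
    using s2(3) s4(3) s1(2,3) s2(1,2) s3(2,3) by simp_all
  obtain k1 where k1: "v = 0" "v1 = 0" "k1 \<noteq> 0" "d1 = k1 * d" using s1(4) hyp c by auto
  obtain k2 where k2: "k2 \<noteq> 0" "v2 = k2 * d1" using s2(4) hyp s1(2) k1 by auto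
  \<comment> \<open>\<open>e\<close> forces \<open>v = 0\<close>; \<open>a\<close> turns the
    translation along \<open>x\<close> into one along \<open>y\<close>, up to a nonzero factor, and
    \<open>e'\<close> forces that one to vanish too.\<close>
  have "v2 = 0" using s3(4) c s2(1,2) s1(2,3) hyp by simp
  with k1 k2 show "v = 0 \<and> d = 0" by simp
qed

section \<open>Symmetries of finite order\<close>

lemma elementary_in_GA2: "\<alpha> \<noteq> 0 \<Longrightarrow> \<beta> \<noteq> 0 \<Longrightarrow> elementary_polymap \<alpha> P \<beta> v \<in> carrier GA2"
  by (rule subgroup.mem_carrier [OF subgroup_Elem]) (simp add: ElemI)

lemma elementary_pow:
  "\<exists>Q w. elementary_polymap \<alpha> P \<beta> v [^]\<^bsub>GA2\<^esub> (n::nat) = elementary_polymap (\<alpha> ^ n) Q (\<beta> ^ n) w"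
proof (induction n)
  case 0
  show ?case by (intro exI [of _ 0]) (simp add: elementary_id)
next
  case (Suc n)
  then obtain Q w where
    "elementary_polymap \<alpha> P \<beta> v [^]\<^bsub>GA2\<^esub> n = elementary_polymap (\<alpha> ^ n) Q (\<beta> ^ n) w"
    by blast
  then have "elementary_polymap \<alpha> P \<beta> v [^]\<^bsub>GA2\<^esub> Suc n = elementary_polymap (\<alpha> ^ Suc n)
      (smult (\<alpha> ^ n) P + pcompose Q [:v, \<beta>:]) (\<beta> ^ Suc n) (\<beta> ^ n * v + w)"
    by (simp add: comp_elementary mult.commute)
  then show ?case by blast
qed

lemma unipotent_pow:
  "\<exists>Q. elementary_polymap 1 P 1 v [^]\<^bsub>GA2\<^esub> (n::nat) = elementary_polymap 1 Q 1 (of_nat n * v)"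
proof (induction n)
  case 0
  show ?case by (intro exI [of _ 0]) (simp add: elementary_id)
next
  case (Suc n)
  then show ?case by (auto simp: comp_elementary algebra_simps)
qed

lemma shear_pow:
  "elementary_polymap 1 P 1 0 [^]\<^bsub>GA2\<^esub> (n::nat) = elementary_polymap 1 (smult (of_nat n) P) 1 0"
  by (induction n) (simp_all add: elementary_id comp_elementary smult_add_left)

text \<open>The \<open>n\<close>-th power translates \<open>y\<close> by \<open>n v\<close>, so
  \<open>v = 0\<close>; then it adds \<open>n P\<close> to the first component, so
  \<open>P = 0\<close>. Characteristic 0 enters both times.\<close>

lemma unipotent_finite_order:
  fixes P :: "'a::field_char_0 poly"
  assumes "elementary_polymap 1 P 1 v [^]\<^bsub>GA2\<^esub> (n::nat) = (X, Y)" "n > 0"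
  shows "elementary_polymap 1 P 1 v = (X, Y)"
proof -
  obtain Q where "elementary_polymap 1 Q 1 (of_nat n * v) = elementary_polymap 1 0 1 0"
    using assms(1) unipotent_pow [of P v n] by (metis elementary_id)
  then have v: "v = 0" using assms(2) by (auto dest: elementary_inj(4))
  then have "elementary_polymap 1 (smult (of_nat n) P) 1 0 = elementary_polymap 1 0 1 0"
    using assms(1) shear_pow [of P n] by (simp add: elementary_id)
  then have "P = 0" using assms(2) by (auto dest: elementary_inj(2))
  with v show ?thesis by (simp add: elementary_id)
qed

text \<open>Both eigenvalues are roots of unity, and being powers of each other rules out opposite
  signs. If both are 1, the map is unipotent of finite order.\<close>

lemma triangular_finite_order:
  fixes \<alpha> :: "'a::field_char_0"
  assumes roots: "\<And>(z::'a) n. n > 0 \<Longrightarrow> z ^ n = 1 \<Longrightarrow> z = 1 \<or> z = - 1"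
    and h: "h = elementary_polymap \<alpha> [:d, c:] \<beta> v"
    and powers: "\<exists>m. \<alpha> = \<beta> ^ m" "\<exists>m. \<beta> = \<alpha> ^ m"
    and fin: "h [^]\<^bsub>GA2\<^esub> (n::nat) = (X, Y)" "n > 0"
  shows "h = (X, Y) \<or> (\<exists>d v. h = elementary_polymap (- 1) [:d:] (- 1) v)"
proof -
  obtain Q w where "elementary_polymap (\<alpha> ^ n) Q (\<beta> ^ n) w = elementary_polymap 1 0 1 0"
    using fin(1) elementary_pow [of \<alpha> "[:d, c:]" \<beta> v n] h by (metis elementary_id)
  then have "\<alpha> ^ n = 1" "\<beta> ^ n = 1" by (auto dest: elementary_inj)
  then have "\<alpha> = 1 \<or> \<alpha> = - 1" "\<beta> = 1 \<or> \<beta> = - 1" using roots fin(2) by blast+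
  then consider "\<alpha> = 1" "\<beta> = 1" | "\<alpha> = - 1" "\<beta> = - 1" using powers by auto
  then show ?thesis
  proof cases
    case 1
    then show ?thesis using unipotent_finite_order [of "[:d, c:]" v n] fin h by simp
  next
    case 2
    \<comment> \<open>The square of \<open>h\<close> is unipotent of finite order, hence trivial,
      and its shear \<open>- (2 * c)\<close> shows \<open>c = 0\<close>.\<close>
    define h2 where "h2 = polymap_comp h h"
    have h2: "h2 = elementary_polymap 1 [:c * v, - (2 * c):] 1 0"
      by (simp add: h2_def h 2 comp_elementary pcompose_pCons)
    have hc: "h \<in> carrier GA2"
      unfolding h 2 by (rule elementary_in_GA2) simp_all
    have "h2 [^]\<^bsub>GA2\<^esub> n = (h [^]\<^bsub>GA2\<^esub> n) [^]\<^bsub>GA2\<^esub> (2::nat)"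
      using hc GA2.nat_pow_pow [OF hc, of 2 n] GA2.nat_pow_pow [OF hc, of n 2]
      by (simp add: h2_def numeral_2_eq_2 mult.commute polymap_comp_def [of "(X, Y)"])
    also have "\<dots> = (X, Y)" unfolding fin(1) using GA2.nat_pow_one [of 2] by simp
    finally have "h2 = (X, Y)" using fin(2) unfolding h2 by (rule unipotent_finite_order)
    then have "[:c * v, - (2 * c):] = 0"
      unfolding h2 elementary_id [symmetric] by (rule elementary_inj(2))
    then have "c = 0" by simp
    with h 2 show ?thesis by auto
  qed
qed

lemma length_ge_4E:
  fixes xs :: "'a list"
  assumes "length xs \<ge> 4"
  obtains ws a b c d where "xs = ws @ [a, b, c, d]"
proof -
  have "\<exists>a b c d. zs = [a, b, c, d]" if "length zs = 4" for zs :: "'a list"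
    using that by (auto simp: length_Suc_conv numeral_eq_Suc)
  moreover have "length (drop (length xs - 4) xs) = 4" using assms by simp
  ultimately obtain a b c d where "drop (length xs - 4) xs = [a, b, c, d]" by blast
  then have "xs = take (length xs - 4) xs @ [a, b, c, d]" by (metis append_take_drop_id)
  with that show thesis by blast
qed

context
  fixes gs :: "'a::field_char_0 polymap list" and g :: "'a polymap"
  assumes alt: "alternating Aff Elem gs" and even: "even (length gs)" and last: "last gs \<notin> Aff"
    and g: "g = foldr (mult GA2) gs \<one>\<^bsub>GA2\<^esub>"
begin

text \<open>An even word may have only two letters, while the stabilizer argument takes four; the
  square has them, without cancellation.\<close>

lemma square_word:
  obtains ws a' e' a e where "alternating Aff Elem (ws @ [a', e', a, e])" "e \<notin> Aff"
    "foldr (mult GA2) (ws @ [a', e', a, e]) \<one>\<^bsub>GA2\<^esub> = polymap_comp g g"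
proof -
  have ne: "gs \<noteq> []" using GA2.alt_ne [OF alt] .
  have "length gs \<ge> 2" using ne even by (cases gs; cases "tl gs") auto
  then have "length (gs @ gs) \<ge> 4" by simp
  then obtain ws a' e' a e where eq: "gs @ gs = ws @ [a', e', a, e]" by (rule length_ge_4E)
  have "alternating Aff Elem (gs @ gs)"
    using alternating_parity [OF alt] even alt ne by (subst alternating_append) auto
  moreover have "last (gs @ gs) = e" by (simp only: eq) simp
  then have "e \<notin> Aff" using last ne by simp
  moreover have "foldr (mult GA2) (gs @ gs) \<one>\<^bsub>GA2\<^esub> = g \<otimes>\<^bsub>GA2\<^esub> g"
    unfolding g using GA2.alt_carrier [OF alt] by (intro GA2.wprod_append)
  ultimately show thesis using that unfolding eq mult_GA2 by blast
qed

lemma commute_square: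
  assumes "h \<in> carrier GA2" "polymap_comp g h = polymap_comp h g"
  shows "polymap_comp (polymap_comp g g) h = polymap_comp h (polymap_comp g g)"
  using assms(2) by (metis polymap_comp_assoc)

lemma finite_order_commuting:
  assumes roots: "\<And>(z::'a) n. n > 0 \<Longrightarrow> z ^ n = 1 \<Longrightarrow> z = 1 \<or> z = - 1"
    and h: "h \<in> carrier GA2" "polymap_comp g h = polymap_comp h g"
    and fin: "h [^]\<^bsub>GA2\<^esub> (n::nat) = \<one>\<^bsub>GA2\<^esub>" "n > 0"
  shows "h = (X, Y) \<or> (\<exists>d v. h = elementary_polymap (- 1) [:d:] (- 1) v)"
proof -
  have "h \<in> Aff \<inter> Elem"
    using h(2) unfolding g
    by (intro GA2.finite_order_commuting_in_B [OF alt even h(1) _ fin]) simp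
  then have "h \<in> Bor" by (simp add: Bor_def)
  then obtain \<alpha> c d \<beta> v where h': "h = elementary_polymap \<alpha> [:d, c:] \<beta> v" "\<alpha> \<noteq> 0" "\<beta> \<noteq> 0"
    by (rule BorE)
  obtain ws a' e' a e where w: "alternating Aff Elem (ws @ [a', e', a, e])" "e \<notin> Aff"
    "foldr (mult GA2) (ws @ [a', e', a, e]) \<one>\<^bsub>GA2\<^esub> = polymap_comp g g"
    by (rule square_word)
  have comm: "foldr (mult GA2) (ws @ [a', e', a, e]) \<one>\<^bsub>GA2\<^esub> \<otimes>\<^bsub>GA2\<^esub> h =
      h \<otimes>\<^bsub>GA2\<^esub> foldr (mult GA2) (ws @ [a', e', a, e]) \<one>\<^bsub>GA2\<^esub>"
    unfolding w(3) by (simp add: commute_square [OF h])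
  have B: "elementary_polymap \<alpha> [:d, c:] \<beta> v \<in> Bor" using \<open>h \<in> Bor\<close> h'(1) by simp
  note powers = segment_stabilizer(1,2) [OF w(1,2) B h' comm]
  have "h [^]\<^bsub>GA2\<^esub> n = (X, Y)" using fin(1) by simp
  from triangular_finite_order [OF roots h'(1) powers this fin(2)] show ?thesis .
qed

lemma half_turns_commuting_unique:
  assumes s: "s = elementary_polymap (- 1) [:d:] (- 1) v" "polymap_comp g s = polymap_comp s g"
    and s': "s' = elementary_polymap (- 1) [:d':] (- 1) v'" "polymap_comp g s' = polymap_comp s' g"
  shows "s = s'"
proof -
  \<comment> \<open>Both half-turns have linear part -1, so \<open>t\<close> is a translation
    commuting with \<open>g\<close>.\<close>
  define t where "t = polymap_comp s s'"
  have t: "t = elementary_polymap 1 [:d - d', 0:] 1 (v - v')"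
    by (simp add: t_def s(1) s'(1) comp_elementary)
  have comm: "polymap_comp g t = polymap_comp t g"
    using s(2) s'(2) unfolding t_def by (metis polymap_comp_assoc)
  have "t \<in> Elem" unfolding t by (rule ElemI) simp
  then have tc: "t \<in> carrier GA2" using GA2.AE_carrier by blast
  have B: "elementary_polymap 1 [:d - d', 0:] 1 (v - v') \<in> Bor"
    unfolding Bor_def using \<open>t \<in> Elem\<close> t by (simp add: elementary_in_Aff_iff)
  obtain ws a' e' a e where w: "alternating Aff Elem (ws @ [a', e', a, e])" "e \<notin> Aff"
    "foldr (mult GA2) (ws @ [a', e', a, e]) \<one>\<^bsub>GA2\<^esub> = polymap_comp g g"
    by (rule square_word)
  have "foldr (mult GA2) (ws @ [a', e', a, e]) \<one>\<^bsub>GA2\<^esub> \<otimes>\<^bsub>GA2\<^esub> t =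
      t \<otimes>\<^bsub>GA2\<^esub> foldr (mult GA2) (ws @ [a', e', a, e]) \<one>\<^bsub>GA2\<^esub>"
    unfolding w(3) by (simp add: commute_square [OF tc comm])
  from segment_stabilizer(3) [OF w(1,2) B t _ _ this] have "v - v' = 0 \<and> d - d' = 0" by simp
  then show ?thesis using s(1) s'(1) by simp
qed

end

section \<open>Half-turns, and conjugation of a CR element to a word\<close>

lemma half_turn_square: "polymap_comp (elementary_polymap (- 1) [:d:] (- 1) v) (elementary_polymap (- 1) [:d:] (- 1) v) = (X, Y)"
  by (simp add: comp_elementary elementary_id)

lemma (in group) conjugate_trans:
  assumes "conjugate G a b" "conjugate G b c"
  shows "conjugate G a c"
proof -
  obtain g h where gh: "g \<in> carrier G" "b = g \<otimes> a \<otimes> inv g" "h \<in> carrier G" "c = h \<otimes> b \<otimes> inv h"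
    and a: "a \<in> carrier G" and c: "c \<in> carrier G"
    using assms by (auto simp: conjugate_def)
  have "c = (h \<otimes> g) \<otimes> a \<otimes> inv (h \<otimes> g)"
    using gh a by (simp add: inv_mult_group m_assoc)
  with gh a c show ?thesis unfolding conjugate_def by blast
qed

lemma half_turn_conjugate:
  fixes d v :: "'a::field_char_0"
  shows "conjugate GA2 (elementary_polymap (- 1) [:d:] (- 1) v) (linear_polymap (mat (-1)))"
proof -
  define s where "s = elementary_polymap (- 1) [:d:] (- 1) v"
  \<comment> \<open>The translation taking the fixed point \<open>(d / 2, v / 2)\<close> of the
    half-turn to the origin.\<close>
  define t where "t = elementary_polymap 1 [:- d / 2:] 1 (- v / 2)"
  define r :: "'a polymap" where "r = elementary_polymap (- 1) 0 (- 1) 0"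
  have r: "linear_polymap (mat (-1)) = r"
    by (simp add: r_def affine_polymap_def elementary_polymap_def mat_def)
  have carr: "s \<in> carrier GA2" "t \<in> carrier GA2" "r \<in> carrier GA2"
    unfolding s_def t_def r_def by (rule elementary_in_GA2; simp)+
  have "t \<otimes>\<^bsub>GA2\<^esub> s = r \<otimes>\<^bsub>GA2\<^esub> t"
    by (simp add: s_def t_def r_def comp_elementary field_simps)
  then have "t \<otimes>\<^bsub>GA2\<^esub> s \<otimes>\<^bsub>GA2\<^esub> inv\<^bsub>GA2\<^esub> t = r"
    using carr by (simp add: GA2.m_assoc del: mult_GA2 one_GA2)
  with carr show ?thesis unfolding r s_def [symmetric] conjugate_def by metis
qed

text \<open>An even word can be rotated cyclically by conjugating with its innermost letter, so that
  letter may be taken to be elementary.\<close>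

lemma CR_element_word:
  fixes f :: "'a::field_char_0 polymap"
  assumes "CR_element f"
  obtains k gs where "k \<in> carrier GA2" "alternating Aff Elem gs" "even (length gs)" "last gs \<notin> Aff"
    "k \<otimes>\<^bsub>GA2\<^esub> f \<otimes>\<^bsub>GA2\<^esub> inv\<^bsub>GA2\<^esub> k = foldr (mult GA2) gs \<one>\<^bsub>GA2\<^esub>"
proof -
  obtain g where g: "cyclically_reduced g" "conjugate GA2 f g" using assms by (auto simp: CR_element_def)
  then obtain k where k: "k \<in> carrier GA2" "f \<in> carrier GA2" "g = k \<otimes>\<^bsub>GA2\<^esub> f \<otimes>\<^bsub>GA2\<^esub> inv\<^bsub>GA2\<^esub> k"
    unfolding conjugate_def by blast
  obtain gs where gs: "alternating Aff Elem gs" "even (length gs)" "g = foldr (mult GA2) gs \<one>\<^bsub>GA2\<^esub>"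
    using cyclically_reduced_word [OF g(1)] .
  show thesis
  proof (cases "last gs \<in> Aff")
    case False
    then show thesis using that [OF k(1) gs(1,2)] gs(3) k(3) by simp
  next
    case True
    obtain hs a where hs: "gs = hs @ [a]" using GA2.alt_ne [OF gs(1)] by (metis rev_exhaust)
    with gs(2) have ne: "hs \<noteq> []" by auto
    have parts: "alternating Aff Elem hs" "last hs \<notin> Aff" "alternating Aff Elem [a]" "hd hs \<notin> Aff"
      using gs(1) True ne alternating_parity [OF gs(1)] gs(2) by (auto simp: hs alternating_append)
    have a: "a \<in> carrier GA2" and hc: "set hs \<subseteq> carrier GA2" using GA2.alt_carrier [OF gs(1)] hs by auto
    define p where "p = foldr (mult GA2) hs \<one>\<^bsub>GA2\<^esub>"
    have pc: "p \<in> carrier GA2" unfolding p_def using hc by (rule GA2.wprod_closed)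
    have "g = p \<otimes>\<^bsub>GA2\<^esub> foldr (mult GA2) [a] \<one>\<^bsub>GA2\<^esub>"
      unfolding gs(3) hs p_def using hc a by (intro GA2.wprod_append) auto
    then have gp: "g = p \<otimes>\<^bsub>GA2\<^esub> a" using GA2.r_one [OF a] by simp
    have "(a \<otimes>\<^bsub>GA2\<^esub> k) \<otimes>\<^bsub>GA2\<^esub> f \<otimes>\<^bsub>GA2\<^esub> inv\<^bsub>GA2\<^esub> (a \<otimes>\<^bsub>GA2\<^esub> k) =
        a \<otimes>\<^bsub>GA2\<^esub> g \<otimes>\<^bsub>GA2\<^esub> inv\<^bsub>GA2\<^esub> a"
      unfolding k(3) using a k(1,2)
      by (simp add: GA2.m_assoc GA2.inv_mult_group del: mult_GA2 one_GA2)
    also have "\<dots> = a \<otimes>\<^bsub>GA2\<^esub> p"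
      unfolding gp using a pc by (simp add: GA2.m_assoc del: mult_GA2 one_GA2)
    also have "\<dots> = foldr (mult GA2) (a # hs) \<one>\<^bsub>GA2\<^esub>" by (simp add: p_def)
    finally show thesis
      using parts ne gs(2) True hs a k(1)
      by (intro that [of "a \<otimes>\<^bsub>GA2\<^esub> k" "a # hs"])
        (auto simp: alternating_Cons comp_closed)
  qed
qed

text \<open>A group of order 2 containing the distinct elements 1 and -1 consists of these
  two.\<close>

lemma roots_of_unity_C2:
  fixes z :: "'a::field_char_0"
  assumes iso: "(roots_of_unity :: 'a monoid) \<cong> integer_mod_group 2" and "n > 0" "z ^ n = 1"
  shows "z = 1 \<or> z = - 1"
proof -
  let ?U = "carrier (roots_of_unity :: 'a monoid)"
  have card: "card ?U = 2"
    using iso_same_card [OF iso] by (simp add: carrier_integer_mod_group)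
  have "1 \<in> ?U" "- 1 \<in> ?U"
    by (auto simp: roots_of_unity_def intro: exI [of _ 1] exI [of _ 2])
  then have sub: "{1, - 1} \<subseteq> ?U" by simp
  have "card {1, - 1 :: 'a} = 2" by simp
  then have "{1, - 1} = ?U"
    using card sub by (intro card_subset_eq) (auto intro: card_ge_0_finite)
  moreover have "z \<in> ?U" using assms(2,3) by (auto simp: roots_of_unity_def)
  ultimately show ?thesis by blast
qed

section \<open>Centralizers, torsion and conjugation in groups\<close>

lemma (in group) subgroup_centralizer:
  assumes "f \<in> carrier G"
  shows "subgroup {h \<in> carrier G. f \<otimes> h = h \<otimes> f} G"
proof (rule subgroupI)
  fix a assume "a \<in> {h \<in> carrier G. f \<otimes> h = h \<otimes> f}"
  then have a: "a \<in> carrier G" "f \<otimes> a = a \<otimes> f" by auto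
  have "f \<otimes> inv a = inv a \<otimes> (a \<otimes> f) \<otimes> inv a"
    using a(1) assms by (simp add: m_assoc [symmetric])
  also have "\<dots> = inv a \<otimes> f"
    unfolding a(2) [symmetric] using a(1) assms by (simp add: m_assoc)
  finally show "inv a \<in> {h \<in> carrier G. f \<otimes> h = h \<otimes> f}" using a by simp
next
  fix a b assume "a \<in> {h \<in> carrier G. f \<otimes> h = h \<otimes> f}" "b \<in> {h \<in> carrier G. f \<otimes> h = h \<otimes> f}"
  then show "a \<otimes> b \<in> {h \<in> carrier G. f \<otimes> h = h \<otimes> f}"
    using assms by simp (metis m_assoc)
next
  show "{h \<in> carrier G. f \<otimes> h = h \<otimes> f} \<noteq> {}" using assms by (auto intro: exI [of _ \<one>])
qed auto

lemma (in group) finite_subgroup_torsion: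
  assumes H: "subgroup H G" "finite H" "h \<in> H"
  shows "\<exists>n::nat. n > 0 \<and> h [^] n = \<one>"
proof -
  have hc: "h \<in> carrier G" using subgroup.mem_carrier [OF H(1,3)] .
  have "h [^] (n::nat) \<in> H" for n
    using H by (induction n) (auto simp: subgroup.one_closed subgroup.m_closed)
  then have "finite (range (\<lambda>n::nat. h [^] n))" using H(2) by (auto intro: finite_subset)
  then have "\<not> inj (\<lambda>n::nat. h [^] n)" using range_inj_infinite by blast
  then obtain m n :: nat where "h [^] m = h [^] n" "m \<noteq> n" by (auto simp: inj_def)
  then obtain m n :: nat where "h [^] m = h [^] n" "m < n" by (metis nat_neq_iff)
  then show ?thesis using pow_eq_div2 [OF hc, of n m] by (intro exI [of _ "n - m"]) auto
qed

lemma (in group) generate_pair: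
  assumes "subgroup H G" "H = {\<one>, s}"
  shows "generate G {s} = H"
proof
  show "generate G {s} \<subseteq> H" using assms by (intro generate_subgroup_incl) auto
  show "H \<subseteq> generate G {s}" using assms(2) by (auto intro: generate.one generate.incl)
qed

lemma (in group) conj_pow:
  assumes "k \<in> carrier G" "h \<in> carrier G"
  shows "(k \<otimes> h \<otimes> inv k) [^] (n::nat) = k \<otimes> h [^] n \<otimes> inv k"
proof (induction n)
  case 0
  then show ?case using assms by simp
next
  case (Suc n)
  have "(k \<otimes> h [^] n \<otimes> inv k) \<otimes> (k \<otimes> h \<otimes> inv k) = k \<otimes> h [^] n \<otimes> (inv k \<otimes> k) \<otimes> h \<otimes> inv k"
    using assms by (simp only: m_assoc m_closed inv_closed nat_pow_closed)
  also have "\<dots> = k \<otimes> h [^] Suc n \<otimes> inv k" using assms by (simp add: m_assoc)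
  finally show ?case using Suc by simp
qed

lemma (in group) conj_mult:
  assumes "k \<in> carrier G" "a \<in> carrier G" "b \<in> carrier G"
  shows "(k \<otimes> a \<otimes> inv k) \<otimes> (k \<otimes> b \<otimes> inv k) = k \<otimes> (a \<otimes> b) \<otimes> inv k"
proof -
  have "(k \<otimes> a \<otimes> inv k) \<otimes> (k \<otimes> b \<otimes> inv k) = k \<otimes> a \<otimes> (inv k \<otimes> k) \<otimes> b \<otimes> inv k"
    using assms by (simp only: m_assoc m_closed inv_closed)
  then show ?thesis using assms by (simp add: m_assoc)
qed

lemma (in group) conj_cancel:
  assumes "k \<in> carrier G" "a \<in> carrier G" "b \<in> carrier G" "k \<otimes> a \<otimes> inv k = k \<otimes> b \<otimes> inv k"
  shows "a = b"
  using assms by simp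

theorem theorem2:
  fixes f :: "'a::field_char_0 polymap"
  assumes "(roots_of_unity :: 'a monoid) \<cong> integer_mod_group 2"
    and "f \<in> carrier GA2"
    and "CR_element f"
  shows "(\<forall>h \<in> carrier (symmetry_group f). has_finite_order GA2 h \<longrightarrow>
            h = \<one>\<^bsub>GA2\<^esub> \<or> involution GA2 h) \<and>
         (\<forall>H H'. nontrivial_finite_subgroup H (symmetry_group f) \<longrightarrow>
                 nontrivial_finite_subgroup H' (symmetry_group f) \<longrightarrow> H = H') \<and>
         (\<forall>H. nontrivial_finite_subgroup H (symmetry_group f) \<longrightarrow>
            (\<exists>s. involution GA2 s \<and> H = generate GA2 {s} \<and>
                 conjugate GA2 s (linear_polymap (mat (-1)))))"
proof -
  obtain k gs where k: "k \<in> carrier GA2" and gs: "alternating Aff Elem gs" "even (length gs)" "last gs \<notin> Aff"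
    and g: "k \<otimes>\<^bsub>GA2\<^esub> f \<otimes>\<^bsub>GA2\<^esub> inv\<^bsub>GA2\<^esub> k = foldr (mult GA2) gs \<one>\<^bsub>GA2\<^esub>"
    using CR_element_word [OF assms(3)] .
  \<comment> \<open>Conjugation by \<open>k\<close> carries symmetries of \<open>f\<close> to maps
    commuting with the cyclically reduced word, where nontrivial ones of finite order are
    half-turns.\<close>
  define \<phi> where "\<phi> h = k \<otimes>\<^bsub>GA2\<^esub> h \<otimes>\<^bsub>GA2\<^esub> inv\<^bsub>GA2\<^esub> k" for h
  define S where "S = {h \<in> carrier GA2. f \<otimes>\<^bsub>GA2\<^esub> h = h \<otimes>\<^bsub>GA2\<^esub> f}"
  have S: "carrier (symmetry_group f) = S" "symmetry_group f = GA2\<lparr>carrier := S\<rparr>"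
    by (simp_all add: symmetry_group_def S_def)
  have subS: "subgroup S GA2" unfolding S_def using assms(2) by (rule GA2.subgroup_centralizer)
  have \<phi>_closed: "\<phi> h \<in> carrier GA2" if "h \<in> carrier GA2" for h
    unfolding \<phi>_def using k that by (simp only: GA2.m_closed GA2.inv_closed)
  have \<phi>_one: "\<phi> h = \<one>\<^bsub>GA2\<^esub> \<longleftrightarrow> h = \<one>\<^bsub>GA2\<^esub>" if "h \<in> carrier GA2" for h
  proof -
    have "\<phi> \<one>\<^bsub>GA2\<^esub> = \<one>\<^bsub>GA2\<^esub>" unfolding \<phi>_def using k by (simp del: mult_GA2 one_GA2)
    then show ?thesis using GA2.conj_cancel [OF k that GA2.one_closed] unfolding \<phi>_def by metis
  qed
  have comm: "polymap_comp (\<phi> f) (\<phi> h) = polymap_comp (\<phi> h) (\<phi> f)" if "h \<in> S" for h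
    using that GA2.conj_mult [OF k] assms(2) unfolding \<phi>_def S_def mult_GA2 [symmetric]
    by (simp del: mult_GA2)
  have half_turn: "\<exists>d v. \<phi> h = elementary_polymap (- 1) [:d:] (- 1) v"
    if "h \<in> S" "has_finite_order GA2 h" "h \<noteq> \<one>\<^bsub>GA2\<^esub>" for h
  proof -
    have hc: "h \<in> carrier GA2" using that(1) by (simp add: S_def)
    obtain n :: nat where n: "n > 0" "h [^]\<^bsub>GA2\<^esub> n = \<one>\<^bsub>GA2\<^esub>"
      using \<open>has_finite_order GA2 h\<close> by (auto simp: has_finite_order_def)
    have "\<phi> h [^]\<^bsub>GA2\<^esub> n = \<one>\<^bsub>GA2\<^esub>"
      using GA2.conj_pow [OF k hc, of n] n(2) k unfolding \<phi>_def by (simp del: mult_GA2 one_GA2)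
    from finite_order_commuting [OF gs g [folded \<phi>_def] roots_of_unity_C2 [OF assms(1)]
        \<phi>_closed [OF hc] comm [OF that(1)] this n(1)]
    show ?thesis using \<phi>_one [OF hc] that(3) by simp
  qed
  have unique: "s = s'"
    if "s \<in> S" "has_finite_order GA2 s" "s \<noteq> \<one>\<^bsub>GA2\<^esub>" "s' \<in> S" "has_finite_order GA2 s'" "s' \<noteq> \<one>\<^bsub>GA2\<^esub>"
    for s s'
  proof -
    have "\<phi> s = \<phi> s'"
      using half_turn [OF that(1-3)] half_turn [OF that(4-6)] comm [OF that(1)] comm [OF that(4)]
        half_turns_commuting_unique [OF gs g [folded \<phi>_def]] by blast
    then show ?thesis
      using GA2.conj_cancel [OF k] that(1,4) unfolding \<phi>_def S_def by blast
  qed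
  have invol: "involution GA2 s" if "s \<in> S" "has_finite_order GA2 s" "s \<noteq> \<one>\<^bsub>GA2\<^esub>" for s
  proof -
    have sc: "s \<in> carrier GA2" using that(1) by (simp add: S_def)
    have "\<phi> s \<otimes>\<^bsub>GA2\<^esub> \<phi> s = \<one>\<^bsub>GA2\<^esub>" using half_turn [OF that] half_turn_square by auto
    then have "\<phi> (s \<otimes>\<^bsub>GA2\<^esub> s) = \<one>\<^bsub>GA2\<^esub>"
      using GA2.conj_mult [OF k sc sc] unfolding \<phi>_def by simp
    then have "s \<otimes>\<^bsub>GA2\<^esub> s = \<one>\<^bsub>GA2\<^esub>" using \<phi>_one GA2.m_closed [OF sc sc] by blast
    with sc that(3) show ?thesis by (simp add: involution_def)
  qed
  have conj: "conjugate GA2 s (linear_polymap (mat (-1)))"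
    if "s \<in> S" "has_finite_order GA2 s" "s \<noteq> \<one>\<^bsub>GA2\<^esub>" for s
  proof -
    have sc: "s \<in> carrier GA2" using that(1) by (simp add: S_def)
    have "conjugate GA2 s (\<phi> s)"
      unfolding conjugate_def using sc k \<phi>_closed [OF sc] \<phi>_def by blast
    moreover have "conjugate GA2 (\<phi> s) (linear_polymap (mat (-1)))"
      using half_turn [OF that] half_turn_conjugate by auto
    ultimately show ?thesis by (rule GA2.conjugate_trans)
  qed
  have finite_subgroup: "\<exists>s. s \<in> S \<and> has_finite_order GA2 s \<and> s \<noteq> \<one>\<^bsub>GA2\<^esub> \<and> H = {\<one>\<^bsub>GA2\<^esub>, s} \<and> H = generate GA2 {s}"
    if H: "nontrivial_finite_subgroup H (symmetry_group f)" for H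
  proof -
    have "subgroup H (GA2\<lparr>carrier := S\<rparr>)" "finite H" "H \<noteq> {\<one>\<^bsub>GA2\<^esub>}"
      using H by (simp_all add: nontrivial_finite_subgroup_def S)
    note H' = GA2.incl_subgroup [OF subS this(1)] this(2,3)
    have HS: "H \<subseteq> S" using subgroup.subset [OF \<open>subgroup H (GA2\<lparr>carrier := S\<rparr>)\<close>] by simp
    have tors: "has_finite_order GA2 h" if "h \<in> H" for h
      using GA2.finite_subgroup_torsion [OF H'(1,2) that] subgroup.mem_carrier [OF H'(1) that]
      by (simp add: has_finite_order_def)
    have one: "\<one>\<^bsub>GA2\<^esub> \<in> H" using subgroup.one_closed [OF H'(1)] .
    then obtain s where s: "s \<in> H" "s \<noteq> \<one>\<^bsub>GA2\<^esub>" using H'(3) by blast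
    have sS: "s \<in> S" using HS s(1) by (rule subsetD)
    \<comment> \<open>Every element of a finite subgroup has finite order, and at most one
      nontrivial symmetry has finite order.\<close>
    have pair: "H = {\<one>\<^bsub>GA2\<^esub>, s}"
    proof
      show "H \<subseteq> {\<one>\<^bsub>GA2\<^esub>, s}"
        using unique [OF _ _ _ sS tors [OF s(1)] s(2)] HS tors by blast
    qed (use s one in auto)
    show ?thesis
      by (intro exI [of _ s] conjI sS tors [OF s(1)] s(2) pair
          GA2.generate_pair [OF H'(1) pair, symmetric])
  qed
  show ?thesis
  proof (intro conjI allI impI ballI)
    fix h assume "h \<in> carrier (symmetry_group f)" "has_finite_order GA2 h"
    then show "h = \<one>\<^bsub>GA2\<^esub> \<or> involution GA2 h" using invol S(1) by blast
  next
    fix H H' assume "nontrivial_finite_subgroup H (symmetry_group f)"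
      "nontrivial_finite_subgroup H' (symmetry_group f)"
    then show "H = H'" using finite_subgroup [of H] finite_subgroup [of H'] unique by blast
  next
    fix H assume "nontrivial_finite_subgroup H (symmetry_group f)"
    then show "\<exists>s. involution GA2 s \<and> H = generate GA2 {s} \<and> conjugate GA2 s (linear_polymap (mat (-1)))"
      using finite_subgroup [of H] invol conj by blast
  qed
qed

end
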